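(* Let $d\ge 2$ and $1\le k<d$ be integers, let $\Gamma\subseteq G(d,k)$ and let $E\subseteq\mathbb{R}^d$ be a compact $(d,k,\Gamma)$-set. If $2(\dim_{\mathrm H}\Gamma-k(d-1-k))\le d$, then $$\dim_{\mathrm F}E\ge 2(\dim_{\mathrm H}\Gamma-k(d-1-k)).$$ Otherwise, if $2(\dim_{\mathrm H}\Gamma-k(d-1-k))>d$, then $\dim_{\mathrm F}E=d$ and $E$ has positive $d$-dimensional Lebesgue measure.
   Context: $G(d,k)$ is the Grassmannian of all $k$-dimensional linear subspaces of $\mathbb{R}^d$, metrised by $d_{(d,k)}(s,t)=d_H(s\cap S^{d-1},t\cap S^{d-1})$, where $d_H$ is the Hausdorff distance and $S^{d-1}$ is the unit sphere of $\mathbb{R}^d$. $\dim_{\mathrm H}$ denotes Hausdorff dimension, taken with respect to this metric. To each $s\in G(d,k)$ associate, once and for all, an orthonormal basis $\{x_1^s,\dots,x_k^s\}\subseteq\mathbb{R}^d$ of $s$; the specific choice is irrelevant. $(d,k,\Gamma)$-sets: for $\Gamma\subseteq G(d,k)$, a set $E\subseteq\mathbb{R}^d$ is a $(d,k,\Gamma)$-set if for all $s\in\Gamma$ there exists $t_s\in\mathbb{R}^d$ such that $t_s+\sum_{i=1}^k r_i x_i^s\in E$ for all $(r_1,\dots,r_k)\in[0,1]^k$. Fourier dimension: for a Borel measure $\mu$ on $\mathbb{R}^d$, $\hat\mu(\xi)=\int_{\mathbb{R}^d} e^{-2\pi i\xi\cdot x}\,d\mu(x)$. For a closed set $E\subseteq\mathbb{R}^d$,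 $\dim_{\mathrm F}E$ is the supremum of those $s\in[0,d]$ for which there exist a Borel probability measure $\mu$ supported on $E$ and a constant $C>0$ with $|\hat\mu(\xi)|\le C|\xi|^{-s/2}$ for all $\xi\in\mathbb{R}^d\setminus\{0\}$. *)

theory Defs
  imports "HOL-Probability.Probability"
begin

definition diam_on :: "('a \<Rightarrow> 'a \<Rightarrow> real) \<Rightarrow> 'a set \<Rightarrow> real" where
  "diam_on \<rho> U = (SUP p\<in>U \<times> U. \<rho> (fst p) (snd p))"

(* The s-th power of the diameter. Isabelle has 0 powr 0 = 0, whereas the Hausdorff measure
   of exponent 0 (counting measure) needs 0^0 = 1 for nonempty sets, and 0 for the empty set. *)
definition diam_pow :: "('a \<Rightarrow> 'a \<Rightarrow> real) \<Rightarrow> real \<Rightarrow> 'a set \<Rightarrow> ennreal" where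
  "diam_pow \<rho> s U =
     (if U = {} then 0 else if s = 0 then 1 else ennreal (diam_on \<rho> U powr s))"

(* M is the carrier of a metric space with distance \<rho>; the bound on distances says that every covering set has diameter at most \<delta>. *)
definition hausdorff_premeasure ::
    "'a set \<Rightarrow> ('a \<Rightarrow> 'a \<Rightarrow> real) \<Rightarrow> real \<Rightarrow> real \<Rightarrow> 'a set \<Rightarrow> ennreal" where
  "hausdorff_premeasure M \<rho> s \<delta> A =
     (INF U \<in> {U :: nat \<Rightarrow> 'a set.
                 (\<forall>i. U i \<subseteq> M \<and> (\<forall>x\<in>U i. \<forall>y\<in>U i. \<rho> x y \<le> \<delta>)) \<and> A \<subseteq> (\<Union>i. U i)}.
        \<Sum>i. diam_pow \<rho> s (U i))"

definition hausdorff_measure ::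
    "'a set \<Rightarrow> ('a \<Rightarrow> 'a \<Rightarrow> real) \<Rightarrow> real \<Rightarrow> 'a set \<Rightarrow> ennreal" where
  "hausdorff_measure M \<rho> s A = (SUP \<delta>\<in>{0<..}. hausdorff_premeasure M \<rho> s \<delta> A)"

(* Extended-real valued, so that infinite dimension is represented; the empty set has dimension 0. *)
definition hausdorff_dim :: "'a set \<Rightarrow> ('a \<Rightarrow> 'a \<Rightarrow> real) \<Rightarrow> 'a set \<Rightarrow> ereal" where
  "hausdorff_dim M \<rho> A = (INF s\<in>{s. 0 \<le> s \<and> hausdorff_measure M \<rho> s A = 0}. ereal s)"

definition grassmannian :: "nat \<Rightarrow> (real ^ 'n) set set" where
  "grassmannian k = {s. subspace s \<and> dim s = k}"

(* Intended for nonempty bounded sets, where the suprema are finite. *)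
definition hausdorff_distance :: "'a::metric_space set \<Rightarrow> 'a set \<Rightarrow> real" where
  "hausdorff_distance A B = max (SUP a\<in>A. infdist a B) (SUP b\<in>B. infdist b A)"

definition grassmannian_dist :: "(real ^ 'n) set \<Rightarrow> (real ^ 'n) set \<Rightarrow> real" where
  "grassmannian_dist s t = hausdorff_distance (s \<inter> sphere 0 1) (t \<inter> sphere 0 1)"

definition orthonormal_basis_of :: "nat \<Rightarrow> (nat \<Rightarrow> real ^ 'n) \<Rightarrow> (real ^ 'n) set \<Rightarrow> bool" where
  "orthonormal_basis_of k x s \<longleftrightarrow>
     (\<forall>i\<in>{1..k}. \<forall>j\<in>{1..k}. x i \<bullet> x j = (if i = j then 1 else 0)) \<and> span (x ` {1..k}) = s"

(* x s 1, ..., x s k is the orthonormal basis attached to the subspace s. *)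
definition dk_Gamma_set ::
    "((real ^ 'n) set \<Rightarrow> nat \<Rightarrow> real ^ 'n) \<Rightarrow> nat \<Rightarrow> (real ^ 'n) set set \<Rightarrow> (real ^ 'n) set \<Rightarrow> bool" where
  "dk_Gamma_set x k \<Gamma> E \<longleftrightarrow>
     (\<forall>s\<in>\<Gamma>. \<exists>t. \<forall>r :: nat \<Rightarrow> real.
        (\<forall>i\<in>{1..k}. r i \<in> {0..1}) \<longrightarrow> t + (\<Sum>i = 1..k. r i *\<^sub>R x s i) \<in> E)"

definition fourier_transform :: "(real ^ 'n) measure \<Rightarrow> real ^ 'n \<Rightarrow> complex" where
  "fourier_transform \<mu> \<xi> = (\<integral>x. exp (- 2 * of_real pi * \<i> * of_real (\<xi> \<bullet> x)) \<partial>\<mu>)"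

definition fourier_decay_exponents :: "(real ^ 'n) set \<Rightarrow> real set" where
  "fourier_decay_exponents E =
     {s. 0 \<le> s \<and> s \<le> real CARD('n) \<and>
         (\<exists>(\<mu> :: (real ^ 'n) measure) C.
            prob_space \<mu> \<and> sets \<mu> = sets borel \<and> emeasure \<mu> (- E) = 0 \<and> C > 0 \<and>
            (\<forall>\<xi>. \<xi> \<noteq> 0 \<longrightarrow> norm (fourier_transform \<mu> \<xi>) \<le> C * norm \<xi> powr (- s / 2)))}"

(* Meant for closed E, where "supported on E" is equivalent to the complement being null.
   The supremum is taken in the ordered set [0,d], i.e. the supremum of the empty set is 0.
   Inserting 0 only matters for E = {}: for nonempty E, a point mass shows that 0 is an exponent. *)
definition fourier_dim :: "(real ^ 'n) set \<Rightarrow> real" where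
  "fourier_dim E = Sup (insert 0 (fourier_decay_exponents E))"

end

theory Submission
  imports Defs
begin

text \<open>
For every \<open>s \<in> \<Gamma>\<close> the set \<open>E\<close> contains a translate of the cube spanned by the orthonormal
basis of \<open>s\<close>. Put a sufficiently smooth probability density on each of these cubes and average over a random
\<open>s\<close>. The transform of such a density on the cube of \<open>s\<close> is negligible at \<open>\<xi>\<close> unless the
projection of \<open>\<xi>\<close> to \<open>s\<close> is of bounded length, so the transform of the average is at most about
the probability that \<open>s\<close> is nearly orthogonal to \<open>\<xi>\<close>. The \<open>k\<close>-dimensional subspaces of the
hyperplane orthogonal to \<open>\<xi>\<close> form a family of dimension \<open>k (d - 1 - k)\<close>, so those \<open>s\<close> whose
projection of \<open>\<xi>\<close> has length at most \<open>\<eta>\<close> are covered by about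
\<open>(\<bar>\<xi>\<bar> / \<eta>)\<^bsup>k (d - 1 - k)\<^esup>\<close> cells of diameter \<open>\<eta> / \<bar>\<xi>\<bar>\<close>. If \<open>s\<close> is
drawn from a Frostman measure of exponent \<open>\<alpha> < dim \<Gamma>\<close>, each such cell has probability
\<open>O((\<eta> / \<bar>\<xi>\<bar>)\<^bsup>\<alpha>\<^esup>)\<close>; altogether the transform is \<open>O(\<bar>\<xi>\<bar>\<^bsup>-\<beta>\<^esup>)\<close> with
\<open>\<beta> = \<alpha> - k (d - 1 - k)\<close>, which is decay of exponent \<open>2 \<beta>\<close>. The lemmas carrying this are
\<open>frostman_in_chart\<close>, \<open>card_slab_cells\<close>, \<open>random_frame\<close> and \<open>fourier_decay_of_random_frame\<close>.
If \<open>2 \<beta> > d\<close>, the transform is square integrable. Then \<open>E\<close> has positive Lebesgue measure: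
a bound for the transform in \<open>L\<^sup>2\<close> bounds the probability that two independent points of
\<open>E\<close> are \<open>\<rho>\<close>-close by a multiple of \<open>\<rho>\<^sup>d\<close> (\<open>difference_law_ball_le\<close>), and a set of small measure
cannot carry so spread out a measure (\<open>positive_measure_of_difference_law_bound\<close>).

Neither \<open>\<Gamma>\<close> nor the choice of the cubes in \<open>E\<close> has any measurability. This is met by discrete approximation.
The Frostman measure is constructed from the top down on a tree of dyadic cells that partition
\<open>\<Gamma>\<close> (\<open>tree_mass\<close>), and is represented by random elements of \<open>\<Gamma>\<close>, the \<open>n\<close>-th of which takes
finitely many values and determines the cell of level \<open>n\<close> (\<open>tree_random_path\<close>). For each
outcome a subsequence along which translations and bases converge is chosen in a measurable way
(\<open>measurable_convergent_subsequence\<close>), and the limiting cube still lies in \<open>E\<close> because \<open>E\<close> is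
compact. Cells and metric are made explicit in charts: every subspace is the graph of a
matrix over one of finitely many coordinate subspaces, and near orthogonality to \<open>\<xi>\<close> confines every
row of the matrix to a thin slab.
\<close>

section \<open>Random paths through a tree of cells\<close>

text \<open>Cells of a tree are addressed by numbers: the cell of level \<open>n\<close> containing \<open>x\<close> is given by the
  first \<open>n\<close> digits of \<open>x\<close>, read in base \<open>b\<close>. In this order the children of cell \<open>j\<close> are the
  consecutive numbers \<open>b * j + c\<close> with \<open>c < b\<close>.\<close>

primrec digit_code :: "nat \<Rightarrow> (nat \<Rightarrow> 'a \<Rightarrow> nat) \<Rightarrow> nat \<Rightarrow> 'a \<Rightarrow> nat" where
  "digit_code b D 0 x = 0"
| "digit_code b D (Suc n) x = b * digit_code b D n x + D n x"

lemma digit_code_less: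
  assumes "\<And>n x. D n x < b"
  shows "digit_code b D n x < b ^ n"
proof (induction n)
  case 0 then show ?case by simp
next
  case (Suc n)
  have "b * digit_code b D n x + D n x < b * digit_code b D n x + b" using assms by simp
  also have "\<dots> = b * Suc (digit_code b D n x)" by simp
  also have "\<dots> \<le> b * b ^ n" using Suc by (intro mult_le_mono2) simp
  finally show ?case by simp
qed

lemma digit_code_Suc_div:
  assumes "\<And>n x. D n x < b"
  shows "digit_code b D (Suc n) x div b = digit_code b D n x"
proof -
  have "D n x < b" "b \<noteq> 0" using assms[of n x] by auto
  then show ?thesis by (simp add: div_mult_self4)
qed

lemma sum_lessThan_mult:
  fixes f :: "nat \<Rightarrow> 'a::comm_monoid_add"
  shows "(\<Sum>i<b * j. f i) = (\<Sum>l<j. \<Sum>c<b. f (b * l + c))"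
proof -
  have "(\<Sum>i<b * j. f i) = (\<Sum>l<j. sum f {l * b..<l * b + b})"
    by (simp add: sum.nat_group mult.commute)
  also have "\<dots> = (\<Sum>l<j. \<Sum>c<b. f (b * l + c))"
  proof (rule sum.cong)
    fix l
    have "{l * b..<l * b + b} = {0 + l * b..<b + l * b}" by (simp add: add.commute)
    then have "sum f {l * b..<l * b + b} = (\<Sum>c = 0..<b. f (c + l * b))"
      using sum.shift_bounds_nat_ivl[of f 0 "l * b" b] by simp
    also have "\<dots> = (\<Sum>c<b. f (b * l + c))"
      unfolding atLeast0LessThan by (intro sum.cong refl arg_cong[of _ _ f]) (simp add: mult.commute)
    finally show "sum f {l * b..<l * b + b} = (\<Sum>c<b. f (b * l + c))" .
  qed simp
  finally show ?thesis .
qed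

text \<open>Frostman's lemma without limits. The root has mass \<open>1\<close>, and every cell distributes its mass among
  its children in proportion to their \<open>h\<close>-values. The bound by \<open>h\<close> survives each step, since by
  subadditivity the children have at least the \<open>h\<close>-value of the parent to share.\<close>

lemma tree_mass:
  fixes D :: "nat \<Rightarrow> 'a \<Rightarrow> nat" and h :: "'a set \<Rightarrow> real"
  assumes D: "\<And>n x. D n x < b"
    and h0: "\<And>S. 0 \<le> h S" and hA: "0 < h A"
    and hsub: "\<And>S n. S \<subseteq> A \<Longrightarrow> h S \<le> (\<Sum>c<b. h {x\<in>S. D n x = c})"
  obtains w :: "nat \<Rightarrow> nat \<Rightarrow> real"
  where "\<And>n j. 0 \<le> w n j"
    and "\<And>n j. w n j \<le> h {x\<in>A. digit_code b D n x = j} / h A"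
    and "\<And>n j. (\<Sum>c<b. w (Suc n) (b * j + c)) = w n j"
    and "w 0 0 = 1"
    and "\<And>j. j > 0 \<Longrightarrow> w 0 j = 0"
proof -
  let ?c = "digit_code b D"
  define Q where "Q n j = {x\<in>A. ?c n x = j}" for n j
  \<comment> \<open>if all children have \<open>h\<close>-value \<open>0\<close>, division by zero assigns them mass \<open>0\<close>, as it should: the parent then has mass \<open>0\<close> as well\<close>
  define w where "w = rec_nat (\<lambda>j::nat. if j = 0 then 1 else (0::real))
     (\<lambda>n v j. v (j div b) * h (Q (Suc n) j) / (\<Sum>c<b. h (Q (Suc n) (b * (j div b) + c))))"
  have w0: "w 0 j = (if j = 0 then 1 else 0)" for j by (simp add: w_def)
  have wS: "w (Suc n) j = w n (j div b) * h (Q (Suc n) j) / (\<Sum>c<b. h (Q (Suc n) (b * (j div b) + c)))" for n j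
    by (simp add: w_def)
  have child: "Q (Suc n) (b * j + c) = {x\<in>Q n j. D n x = c}" if "c < b" for n j c
  proof -
    have "b * ?c n x + D n x = b * j + c \<longleftrightarrow> ?c n x = j \<and> D n x = c" for x
    proof
      assume *: "b * ?c n x + D n x = b * j + c"
      have "(b * ?c n x + D n x) div b = ?c n x" 
        using digit_code_Suc_div[of D b n x, OF D] by simp
      moreover have "(b * j + c) div b = j" using that by simp
      ultimately show "?c n x = j \<and> D n x = c" using * by auto
    qed auto
    then show ?thesis by (auto simp: Q_def)
  qed
  have hQ: "h (Q n j) \<le> (\<Sum>c<b. h (Q (Suc n) (b * j + c)))" for n j
  proof -
    have "h (Q n j) \<le> (\<Sum>c<b. h {x\<in>Q n j. D n x = c})" by (rule hsub) (auto simp: Q_def)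
    then show ?thesis by (simp add: child)
  qed
  have nn: "0 \<le> w n j" for n j
    by (induction n arbitrary: j) (auto simp: w0 wS h0 sum_nonneg intro!: divide_nonneg_nonneg mult_nonneg_nonneg)
  have le: "w n j \<le> h (Q n j) / h A" for n j
  proof (induction n arbitrary: j)
    case 0
    show ?case using h0 hA by (auto simp: w0 Q_def)
  next
    case (Suc n)
    define S where "S = (\<Sum>c<b. h (Q (Suc n) (b * (j div b) + c)))"
    have S0: "S \<ge> 0" unfolding S_def using h0 by (intro sum_nonneg) auto
    have "w n (j div b) \<le> S / h A"
      using Suc[of "j div b"] hQ[of n "j div b"] hA unfolding S_def by (meson divide_right_mono less_imp_le order_trans)
    then have "w n (j div b) * h (Q (Suc n) j) \<le> (S / h A) * h (Q (Suc n) j)"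
      by (rule mult_right_mono) (rule h0)
    then have "w (Suc n) j \<le> (S / h A) * h (Q (Suc n) j) / S"
      unfolding wS S_def[symmetric] using S0 by (rule divide_right_mono)
    also have "\<dots> \<le> h (Q (Suc n) j) / h A"
      using h0 hA by (cases "S = 0") auto
    finally show ?case .
  qed
  have sum: "(\<Sum>c<b. w (Suc n) (b * j + c)) = w n j" for n j
  proof -
    define S where "S = (\<Sum>c<b. h (Q (Suc n) (b * j + c)))"
    have "(\<Sum>c<b. w (Suc n) (b * j + c)) = (\<Sum>c<b. w n j * h (Q (Suc n) (b * j + c)) / S)"
      by (intro sum.cong) (auto simp: wS S_def)
    also have "\<dots> = w n j * S / S" by (simp add: S_def sum_distrib_left sum_divide_distrib)
    also have "\<dots> = w n j"
    proof (cases "S = 0")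
      case True
      then have "h (Q n j) \<le> 0" using hQ[of n j] by (simp add: S_def)
      with le[of n j] nn[of n j] hA have "w n j = 0"
        by (metis divide_nonpos_pos order_antisym order_trans)
      then show ?thesis by simp
    qed simp
    finally show ?thesis .
  qed
  show ?thesis
    by (rule that[of w]) (use nn le sum w0 in \<open>auto simp: Q_def\<close>)
qed

definition unit_space :: "real measure" where
  "unit_space = restrict_space lborel {0..<1}"

lemma space_unit_space [simp]: "space unit_space = {0..<1}"
  by (simp add: unit_space_def space_restrict_space)

lemma prob_space_unit_space: "prob_space unit_space"
  by (rule prob_spaceI) (simp add: unit_space_def space_restrict_space emeasure_restrict_space)

text \<open>Realises the masses of \<open>tree_mass\<close> by nested partitions of \<open>[0,1)\<close> into half-open intervals:
  the interval of a cell is cut into those of its children, from left to right. The random cell of level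
  \<open>n\<close> is the one whose interval contains \<open>\<omega>\<close>, and \<open>a n \<omega>\<close> is a fixed representative in \<open>A\<close>
  of that cell.\<close>

lemma tree_random_path:
  fixes D :: "nat \<Rightarrow> 'a \<Rightarrow> nat" and h :: "'a set \<Rightarrow> real"
  assumes D: "\<And>n x. D n x < b"
    and h0: "\<And>S. 0 \<le> h S" and hempty: "h {} = 0" and hA: "0 < h A"
    and hsub: "\<And>S n. S \<subseteq> A \<Longrightarrow> h S \<le> (\<Sum>c<b. h {x\<in>S. D n x = c})"
  obtains a :: "nat \<Rightarrow> real \<Rightarrow> 'a"
  where "\<And>n. a n \<in> measurable unit_space (count_space UNIV)"
    and "\<And>n \<omega>. \<omega> \<in> {0..<1} \<Longrightarrow> a n \<omega> \<in> A"
    and "\<And>n m \<omega>. \<omega> \<in> {0..<1} \<Longrightarrow> n \<le> m \<Longrightarrow> digit_code b D n (a m \<omega>) = digit_code b D n (a n \<omega>)"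
    and "\<And>n j. measure unit_space {\<omega>\<in>{0..<1}. digit_code b D n (a n \<omega>) = j}
           \<le> h {x\<in>A. digit_code b D n x = j} / h A"
proof -
  obtain w :: "nat \<Rightarrow> nat \<Rightarrow> real"
    where w0: "\<And>n j. 0 \<le> w n j"
    and wh: "\<And>n j. w n j \<le> h {x\<in>A. digit_code b D n x = j} / h A"
    and wsum: "\<And>n j. (\<Sum>c<b. w (Suc n) (b * j + c)) = w n j"
    and w00: "w 0 0 = 1" and w0j: "\<And>j. j > 0 \<Longrightarrow> w 0 j = 0"
    by (rule tree_mass[where D = D and b = b and h = h and A = A, OF D h0 hA hsub]) blast+
  let ?c = "digit_code b D"
  have bpos: "b > 0" using D[of 0 undefined] by simp
  define F where "F n j = (\<Sum>i<j. w n i)" for n j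
  have F0: "F n 0 = 0" for n by (simp add: F_def)
  have FS: "F n (Suc j) = F n j + w n j" for n j by (simp add: F_def)
  have Fmono: "i \<le> j \<Longrightarrow> F n i \<le> F n j" for n i j
    unfolding F_def by (intro sum_mono2) (auto simp: w0)
  have Fb: "F (Suc n) (b * j) = F n j" for n j
    by (simp add: F_def sum_lessThan_mult wsum)
  have Fone: "F n (b ^ n) = 1" for n
    by (induction n) (simp_all add: Fb, simp add: F_def w00)
  have Fle1: "F 0 j \<le> 1" for j
  proof -
    have "(\<Sum>i<j. w 0 i) \<le> (\<Sum>i\<in>{0}. w 0 i)"
    proof -
      have "(\<Sum>i<j. w 0 i) \<le> (\<Sum>i\<in>{..<j} \<union> {0}. w 0 i)" by (intro sum_mono2) (auto simp: w0)
      also have "\<dots> = (\<Sum>i\<in>{0}. w 0 i)" by (intro sum.mono_neutral_right) (auto simp: w0j)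
      finally show ?thesis .
    qed
    then show ?thesis by (simp add: F_def w00)
  qed
  have Fle: "F n j \<le> 1" for n j
  proof (induction n arbitrary: j)
    case (Suc n)
    have "F (Suc n) j \<le> F (Suc n) (b * j)" using bpos by (intro Fmono) simp
    then show ?case using Fb Suc by (metis order_trans)
  qed (rule Fle1)
  \<comment> \<open>the index of the interval \<open>[F n j, F n (j + 1))\<close> that contains \<open>\<omega>\<close>; cells of mass \<open>0\<close> have empty intervals and are never selected\<close>
  define J where "J n \<omega> = (LEAST j. \<omega> < F n (Suc j))" for n \<omega>
  have J1: "F n (J n \<omega>) \<le> \<omega> \<and> \<omega> < F n (Suc (J n \<omega>))" if "\<omega> \<in> {0..<1}" for n \<omega>
  proof -
    have "\<omega> < F n (Suc (b ^ n))" using Fmono[of "b^n" "Suc (b^n)" n] Fone that by auto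
    then have *: "\<omega> < F n (Suc (J n \<omega>))" unfolding J_def by (rule LeastI)
    have "F n (J n \<omega>) \<le> \<omega>"
    proof (cases "J n \<omega>")
      case 0 then show ?thesis using F0 that by simp
    next
      case (Suc i)
      then have "\<not> \<omega> < F n (Suc i)" unfolding J_def by (metis lessI not_less_Least)
      then show ?thesis using Suc by simp
    qed
    with * show ?thesis by (rule conjI[rotated])
  qed
  have Juniq: "J n \<omega> = j" if "\<omega> \<in> {0..<1}" "F n j \<le> \<omega>" "\<omega> < F n (Suc j)" for n \<omega> j
  proof -
    have "\<not> J n \<omega> < j" using J1[OF that(1), of n] that Fmono[of "Suc (J n \<omega>)" j n] by force
    moreover have "\<not> j < J n \<omega>" using J1[OF that(1), of n] that Fmono[of "Suc j" "J n \<omega>" n] by force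
    ultimately show ?thesis by simp
  qed
  have Jset: "{\<omega>\<in>{0..<1}. J n \<omega> = j} = {F n j..<F n (Suc j)}" for n j
  proof -
    have "0 \<le> F n j" "F n (Suc j) \<le> 1" using Fmono[of 0 j n] F0 Fle by auto
    then show ?thesis using J1 Juniq by (force)
  qed
  have Jdiv: "J (Suc n) \<omega> div b = J n \<omega>" if "\<omega> \<in> {0..<1}" for n \<omega>
  proof -
    let ?j = "J (Suc n) \<omega> div b"
    have b1: "b * ?j \<le> J (Suc n) \<omega>" by simp
    have b2: "Suc (J (Suc n) \<omega>) \<le> b * Suc ?j"
      using bpos by (metis dividend_less_times_div less_eq_Suc_le mult_Suc_right add.commute)
    have "F n ?j \<le> \<omega>" using J1[OF that, of "Suc n"] Fmono[OF b1, of "Suc n"] Fb[of n ?j] by linarith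
    moreover have "\<omega> < F n (Suc ?j)" using J1[OF that, of "Suc n"] Fmono[OF b2, of "Suc n"] Fb[of n "Suc ?j"] by linarith
    ultimately show ?thesis using Juniq[OF that] by metis
  qed
  define sel where "sel n j = (SOME x. x \<in> A \<and> ?c n x = j)" for n j
  have sel: "sel n (J n \<omega>) \<in> A \<and> ?c n (sel n (J n \<omega>)) = J n \<omega>" if "\<omega> \<in> {0..<1}" for n \<omega>
  proof -
    have "0 < w n (J n \<omega>)" using J1[OF that, of n] FS by force
    with wh[of n "J n \<omega>"] have "0 < h {x\<in>A. ?c n x = J n \<omega>} / h A" by linarith
    then have "{x\<in>A. ?c n x = J n \<omega>} \<noteq> {}" using hempty by (metis div_0 less_irrefl)
    then show ?thesis unfolding sel_def by (metis (mono_tags, lifting) Collect_empty_eq someI_ex)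
  qed
  have Jm: "?c n (sel m (J m \<omega>)) = J n \<omega>" if "\<omega> \<in> {0..<1}" "n \<le> m" for n m \<omega>
    using that(2)
  proof (induction rule: inc_induct)
    case base then show ?case using sel[OF that(1)] by simp
  next
    case (step i)
    from step.IH have "?c (Suc i) (sel m (J m \<omega>)) div b = J (Suc i) \<omega> div b" by simp
    then show ?case by (simp only: digit_code_Suc_div[of D b i, OF D] Jdiv[OF that(1), of i])
  qed
  have meas: "(\<lambda>\<omega>. sel n (J n \<omega>)) \<in> measurable unit_space (count_space UNIV)" for n
  proof -
    have "J n -` {j} \<inter> space unit_space \<in> sets unit_space" for j
    proof -
      have "J n -` {j} \<inter> space unit_space = {\<omega>\<in>{0..<1}. J n \<omega> = j}" by auto
      also have "\<dots> = {F n j..<F n (Suc j)}" by (rule Jset)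
      finally have "J n -` {j} \<inter> space unit_space = {0..<1} \<inter> {F n j..<F n (Suc j)}" by auto
      moreover have "{F n j..<F n (Suc j)} \<in> sets lborel" by simp
      ultimately show ?thesis unfolding unit_space_def sets_restrict_space by blast
    qed
    then have "J n \<in> measurable unit_space (count_space UNIV)"
      by (subst measurable_count_space_eq_countable) auto
    then show ?thesis by (rule measurable_compose) simp
  qed
  have prob: "measure unit_space {\<omega>\<in>{0..<1}. ?c n (sel n (J n \<omega>)) = j}
           \<le> h {x\<in>A. ?c n x = j} / h A" for n j
  proof -
    have "{\<omega>\<in>{0..<1}. ?c n (sel n (J n \<omega>)) = j} = {\<omega>\<in>{0..<1}. J n \<omega> = j}"
      using sel by auto
    then have eq: "{\<omega>\<in>{0..<1}. ?c n (sel n (J n \<omega>)) = j} = {F n j..<F n (Suc j)}"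
      using Jset by simp
    have "0 \<le> F n j" "F n (Suc j) \<le> 1" using Fmono[of 0 j n] F0 Fle by auto
    then have "measure unit_space {F n j..<F n (Suc j)} = w n j"
      unfolding unit_space_def using FS[of n j] w0[of n j]
      by (subst measure_restrict_space) auto
    then show ?thesis
      unfolding eq using wh[of n j] by simp
  qed
  have inA: "sel n (J n \<omega>) \<in> A" if "\<omega> \<in> {0..<1}" for n \<omega> using sel[OF that] by simp
  have agree: "?c n (sel m (J m \<omega>)) = ?c n (sel n (J n \<omega>))"
    if "\<omega> \<in> {0..<1}" "n \<le> m" for n m \<omega>
    using Jm[OF that] sel[OF that(1), of n] by simp
  show ?thesis
    by (rule that[of "\<lambda>n \<omega>. sel n (J n \<omega>)", OF meas inA agree prob])
qed

section \<open>Measurable choice of convergent subsequences\<close>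

text \<open>Bolzano--Weierstrass with a measurable choice of the subsequence. One coordinate is treated at a
  time: its upper limit is a measurable cluster point, and the least indices at which it is approximated
  within \<open>1 / (m + 1)\<close> are measurable. Passing to a subsequence keeps the coordinates
  already treated convergent.\<close>

lemma measurable_convergent_subsequence:
  fixes f :: "'i \<Rightarrow> nat \<Rightarrow> 'a \<Rightarrow> real"
  assumes "finite I"
    and "\<And>i n. i \<in> I \<Longrightarrow> f i n \<in> borel_measurable M"
    and "\<And>i n \<omega>. i \<in> I \<Longrightarrow> \<omega> \<in> space M \<Longrightarrow> \<bar>f i n \<omega>\<bar> \<le> B"
  shows "\<exists>N. (\<forall>j::nat. N j \<in> measurable M (count_space (UNIV :: nat set))) \<and>
    (\<forall>\<omega>\<in>space M. strict_mono (\<lambda>j. N j \<omega>)) \<and>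
    (\<forall>i\<in>I. \<forall>\<omega>\<in>space M. convergent (\<lambda>j. f i (N j \<omega>) \<omega>))" (is "?P I")
  using assms
proof (induction I rule: finite_induct)
  case empty
  show ?case by (rule exI[of _ "\<lambda>j \<omega>. j"]) (auto simp: strict_mono_def)
next
  case (insert i I)
  have "?P I" by (rule insert.IH) (use insert.prems in auto)
  then obtain N where N [measurable]: "\<And>j. N j \<in> measurable M (count_space (UNIV :: nat set))"
    and mono: "\<And>\<omega>. \<omega> \<in> space M \<Longrightarrow> strict_mono (\<lambda>j. N j \<omega>)"
    and conv: "\<And>i \<omega>. i \<in> I \<Longrightarrow> \<omega> \<in> space M \<Longrightarrow> convergent (\<lambda>j. f i (N j \<omega>) \<omega>)"
    by blast
  define g where "g j \<omega> = f i (N j \<omega>) \<omega>" for j \<omega>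
  have fi: "\<And>n. f i n \<in> borel_measurable M" using insert.prems(1) by simp
  have g [measurable]: "g j \<in> borel_measurable M" for j
    unfolding g_def by (rule measurable_compose_countable[OF fi N])
  have gB: "\<bar>g j \<omega>\<bar> \<le> B" if "\<omega> \<in> space M" for j \<omega>
    unfolding g_def using insert.prems(2)[of i] that by simp
  define L where "L \<omega> = real_of_ereal (limsup (\<lambda>j. ereal (g j \<omega>)))" for \<omega>
  have L [measurable]: "L \<in> borel_measurable M" unfolding L_def by measurable
  have ex: "\<exists>j>m. \<bar>g j \<omega> - L \<omega>\<bar> < e" if \<omega>: "\<omega> \<in> space M" and "e > 0" for \<omega> m e
  proof -
    obtain r where r: "strict_mono r"
      and lim: "((\<lambda>j. ereal (g j \<omega>)) \<circ> r) \<longlonglongrightarrow> limsup (\<lambda>j. ereal (g j \<omega>))"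
      using limsup_subseq_lim by blast
    have "limsup (\<lambda>j. ereal (g j \<omega>)) \<le> ereal B"
      using gB[OF \<omega>] by (intro Limsup_bounded) (auto simp: abs_le_iff)
    moreover have "ereal (- B) \<le> limsup (\<lambda>j. ereal (g j \<omega>))"
      using gB[OF \<omega>] by (intro le_Limsup) (auto simp: abs_le_iff minus_le_iff)
    ultimately have "limsup (\<lambda>j. ereal (g j \<omega>)) = ereal (L \<omega>)"
      unfolding L_def by (intro ereal_real'[symmetric]) auto
    with lim have "(\<lambda>j. g (r j) \<omega>) \<longlonglongrightarrow> L \<omega>"
      by (simp add: o_def)
    then have "\<forall>\<^sub>F j in sequentially. dist (g (r j) \<omega>) (L \<omega>) < e"
      using \<open>e > 0\<close> by (rule tendstoD)
    then obtain j0 where j0: "\<And>j. j \<ge> j0 \<Longrightarrow> \<bar>g (r j) \<omega> - L \<omega>\<bar> < e"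
      by (auto simp: eventually_sequentially dist_real_def)
    have "r (max j0 (Suc m)) > m"
      using seq_suble[OF r, of "max j0 (Suc m)"] by simp
    then show ?thesis using j0[of "max j0 (Suc m)"] by auto
  qed
  define p where "p = rec_nat (\<lambda>\<omega>. 0::nat)
     (\<lambda>m q \<omega>. LEAST j. j > q \<omega> \<and> \<bar>g j \<omega> - L \<omega>\<bar> < 1 / real (Suc m))"
  have p0: "p 0 = (\<lambda>\<omega>. 0)" by (simp add: p_def)
  have pS: "p (Suc m) = (\<lambda>\<omega>. LEAST j. j > p m \<omega> \<and> \<bar>g j \<omega> - L \<omega>\<bar> < 1 / real (Suc m))" for m
    by (simp add: p_def)
  have p [measurable]: "p m \<in> measurable M (count_space UNIV)" for m
  proof (induction m)
    case 0 then show ?case by (simp add: p0)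
  next
    case (Suc m)
    note Suc [measurable]
    show ?case unfolding pS by measurable
  qed
  have p1: "p m \<omega> < p (Suc m) \<omega> \<and> \<bar>g (p (Suc m) \<omega>) \<omega> - L \<omega>\<bar> < 1 / real (Suc m)" 
    if "\<omega> \<in> space M" for m \<omega>
  proof -
    have "\<exists>j. j > p m \<omega> \<and> \<bar>g j \<omega> - L \<omega>\<bar> < 1 / real (Suc m)" using ex[OF that, of "1 / real (Suc m)" "p m \<omega>"] by auto
    then show ?thesis unfolding pS by (rule LeastI_ex)
  qed
  have pmono: "strict_mono (\<lambda>j. p j \<omega>)" if "\<omega> \<in> space M" for \<omega>
    using p1[OF that] by (auto simp: strict_mono_Suc_iff)
  have pconv: "convergent (\<lambda>j. g (p j \<omega>) \<omega>)" if "\<omega> \<in> space M" for \<omega>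
  proof -
    have "(\<lambda>m. g (p (Suc m) \<omega>) \<omega>) \<longlonglongrightarrow> L \<omega>"
    proof (rule Lim_transform_bound[of _ "\<lambda>m. 1 / real (Suc m)", THEN LIM_zero_cancel])
      show "\<forall>\<^sub>F n in sequentially. norm (g (p (Suc n) \<omega>) \<omega> - L \<omega>) \<le> norm (1 / real (Suc n))"
        using p1[OF that] by (auto intro!: always_eventually simp: less_imp_le)
      show "(\<lambda>m. 1 / real (Suc m)) \<longlonglongrightarrow> 0" by (rule LIMSEQ_Suc[OF lim_1_over_n])
    qed
    then have "(\<lambda>m. g (p m \<omega>) \<omega>) \<longlonglongrightarrow> L \<omega>" by (rule LIMSEQ_imp_Suc)
    then show ?thesis by (rule convergentI)
  qed
  show ?case
  proof (intro exI[of _ "\<lambda>j \<omega>. N (p j \<omega>) \<omega>"] conjI allI ballI)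
    fix j show "(\<lambda>\<omega>. N (p j \<omega>) \<omega>) \<in> measurable M (count_space UNIV)"
      by (rule measurable_compose_countable[OF N p])
  next
    fix \<omega> assume \<omega>: "\<omega> \<in> space M"
    show "strict_mono (\<lambda>j. N (p j \<omega>) \<omega>)"
      using strict_mono_o[OF mono[OF \<omega>] pmono[OF \<omega>]] by (simp add: o_def)
  next
    fix i' \<omega> assume i': "i' \<in> insert i I" and \<omega>: "\<omega> \<in> space M"
    show "convergent (\<lambda>j. f i' (N (p j \<omega>) \<omega>) \<omega>)"
    proof (cases "i' = i")
      case True
      then show ?thesis using pconv[OF \<omega>] by (simp add: g_def)
    next
      case False
      with i' conv \<omega> have "convergent (\<lambda>j. f i' (N j \<omega>) \<omega>)" by simp
      from convergent_subseq_convergent[OF this pmono[OF \<omega>]] show ?thesis by (simp add: o_def)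
    qed
  qed
qed

section \<open>Subadditivity of Hausdorff premeasures\<close>

lemma diam_pow_empty [simp]: "diam_pow \<rho> s {} = 0"
  by (simp add: diam_pow_def)

lemma hausdorff_premeasure_mono:
  "A \<subseteq> B \<Longrightarrow> hausdorff_premeasure M \<rho> s \<delta> A \<le> hausdorff_premeasure M \<rho> s \<delta> B"
  unfolding hausdorff_premeasure_def by (rule INF_superset_mono) auto

lemma hausdorff_premeasure_le_diam_pow:
  assumes "S \<subseteq> M" "\<And>x y. x \<in> S \<Longrightarrow> y \<in> S \<Longrightarrow> \<rho> x y \<le> \<delta>"
  shows "hausdorff_premeasure M \<rho> s \<delta> S \<le> diam_pow \<rho> s S"
proof -
  define U :: "nat \<Rightarrow> 'a set" where "U i = (if i = 0 then S else {})" for i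
  have "hausdorff_premeasure M \<rho> s \<delta> S \<le> (\<Sum>i. diam_pow \<rho> s (U i))"
    unfolding hausdorff_premeasure_def
    by (rule INF_lower) (use assms in \<open>auto simp: U_def split: if_splits\<close>)
  also have "\<dots> = diam_pow \<rho> s S"
    by (subst suminf_finite[of "{0}"]) (auto simp: U_def)
  finally show ?thesis .
qed

lemma hausdorff_premeasure_empty [simp]: "hausdorff_premeasure M \<rho> s \<delta> {} = 0"
  using hausdorff_premeasure_le_diam_pow[of "{}" M \<rho> \<delta> s] by simp

text \<open>Near-optimal covers of the sets \<open>S n\<close>, with errors adding up to \<open>e\<close>, are merged into one cover by
  a pairing function.\<close>

lemma hausdorff_premeasure_UN_le:
  "hausdorff_premeasure M \<rho> s \<delta> (\<Union>n::nat. S n) \<le> (\<Sum>n. hausdorff_premeasure M \<rho> s \<delta> (S n))"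
proof (rule ennreal_le_epsilon)
  fix e :: real
  assume fin: "(\<Sum>n. hausdorff_premeasure M \<rho> s \<delta> (S n)) < top" and e: "0 < e"
  let ?H = "hausdorff_premeasure M \<rho> s \<delta>"
  have half: "(\<Sum>n. ennreal (e * (1 / 2) ^ Suc n)) = ennreal e"
    using e power_half_series sums_mult[OF power_half_series, of e]
    by (intro suminf_ennreal_eq) auto
  have "\<exists>U. (\<forall>i. U i \<subseteq> M \<and> (\<forall>x\<in>U i. \<forall>y\<in>U i. \<rho> x y \<le> \<delta>)) \<and> S n \<subseteq> (\<Union>i::nat. U i) \<and>
      (\<Sum>i. diam_pow \<rho> s (U i)) \<le> ?H (S n) + ennreal (e * (1 / 2) ^ Suc n)" for n
  proof -
    have "?H (S n) < top"
      using fin by (metis ennreal_suminf_lessD)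
    then have "?H (S n) < ?H (S n) + ennreal (e * (1 / 2) ^ Suc n)"
      using e by (cases "?H (S n)") (auto simp: ennreal_plus[symmetric] ennreal_less_iff simp del: ennreal_plus)
    then show ?thesis
      unfolding hausdorff_premeasure_def INF_less_iff by (auto intro: less_imp_le)
  qed
  then obtain U where U: "\<And>n i. U n i \<subseteq> M" "\<And>n i x y. x \<in> U n i \<Longrightarrow> y \<in> U n i \<Longrightarrow> \<rho> x y \<le> \<delta>"
    and cov: "\<And>n. S n \<subseteq> (\<Union>i::nat. U n i)"
    and sm: "\<And>n. (\<Sum>i. diam_pow \<rho> s (U n i)) \<le> ?H (S n) + ennreal (e * (1 / 2) ^ Suc n)"
    by metis
  define V where "V i = (case prod_decode i of (n, j) \<Rightarrow> U n j)" for i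
  have "(\<Union>n. S n) \<subseteq> (\<Union>i. V i)"
  proof safe
    fix x n assume "x \<in> S n"
    then obtain j where "x \<in> U n j" using cov by auto
    then have "x \<in> V (prod_encode (n, j))" by (simp add: V_def)
    then show "x \<in> (\<Union>i. V i)" by blast
  qed
  moreover have "V i \<subseteq> M \<and> (\<forall>x\<in>V i. \<forall>y\<in>V i. \<rho> x y \<le> \<delta>)" for i
    using U unfolding V_def by (auto split: prod.splits)
  ultimately have "?H (\<Union>n. S n) \<le> (\<Sum>i. diam_pow \<rho> s (V i))"
    unfolding hausdorff_premeasure_def by (intro INF_lower) auto
  also have "\<dots> = (\<Sum>i. (\<lambda>(n, j). diam_pow \<rho> s (U n j)) (prod_decode i))"
    by (simp add: V_def case_prod_beta)
  also have "\<dots> = (\<Sum>n. \<Sum>j. diam_pow \<rho> s (U n j))"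
    by (rule suminf_ennreal_2dimen) simp
  also have "\<dots> \<le> (\<Sum>n. ?H (S n) + ennreal (e * (1 / 2) ^ Suc n))"
    by (intro suminf_le sm) auto
  also have "\<dots> = (\<Sum>n. ?H (S n)) + ennreal e"
    by (subst suminf_add[symmetric]) (simp_all only: half summableI)
  finally show "?H (\<Union>n. S n) \<le> (\<Sum>n. ?H (S n)) + ennreal e" .
qed

lemma hausdorff_premeasure_finite_UN_le:
  assumes "S \<subseteq> (\<Union>c<b::nat. T c)"
  shows "hausdorff_premeasure M \<rho> s \<delta> S \<le> (\<Sum>c<b. hausdorff_premeasure M \<rho> s \<delta> (T c))"
proof -
  define T' where "T' c = (if c < b then T c else {})" for c
  have "S \<subseteq> (\<Union>c. T' c)" using assms by (fastforce simp: T'_def)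
  then have "hausdorff_premeasure M \<rho> s \<delta> S \<le> (\<Sum>c. hausdorff_premeasure M \<rho> s \<delta> (T' c))"
    by (rule order_trans[OF hausdorff_premeasure_mono hausdorff_premeasure_UN_le])
  also have "\<dots> = (\<Sum>c<b. hausdorff_premeasure M \<rho> s \<delta> (T' c))"
    by (rule suminf_finite) (auto simp: T'_def)
  finally show ?thesis by (simp add: T'_def)
qed

section \<open>Charts of the Grassmannian by graphs\<close>

text \<open>The vectors \<open>graph_vec I A i\<close> for \<open>i \<in> I\<close> span the graph of a linear map from the coordinate
  subspace of \<open>I\<close> to the complementary one; the entries of its matrix are \<open>A i l\<close> with
  \<open>i \<in> I\<close> and \<open>l \<notin> I\<close>.\<close>

definition graph_vec :: "'n set \<Rightarrow> ('n \<Rightarrow> 'n \<Rightarrow> real) \<Rightarrow> 'n \<Rightarrow> real ^ 'n" where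
  "graph_vec I A i = (\<chi> l. if l \<in> I then (if l = i then 1 else 0) else A i l)"

lemma sum_graph_vec_nth:
  fixes I :: "'n::finite set"
  assumes "l \<in> I"
  shows "(\<Sum>i\<in>I. c i *\<^sub>R graph_vec I A i) $ l = c l"
proof -
  have "(\<Sum>i\<in>I. c i *\<^sub>R graph_vec I A i) $ l = (\<Sum>i\<in>I. if i = l then c l else 0)"
    unfolding sum_component using assms by (intro sum.cong refl) (simp add: graph_vec_def)
  then show ?thesis using assms by simp
qed

lemma span_graph_vec_expand:
  fixes I :: "'n::finite set"
  assumes "a \<in> span (graph_vec I A ` I)"
  shows "a = (\<Sum>i\<in>I. a $ i *\<^sub>R graph_vec I A i)"
proof -
  have "\<exists>c. a = (\<Sum>i\<in>I. c i *\<^sub>R graph_vec I A i)"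
    using assms
  proof (induction rule: span_induct_alt)
    case base then show ?case by (intro exI[of _ "\<lambda>_. 0"]) simp
  next
    case (step c x y)
    then obtain i g where i: "i \<in> I" "x = graph_vec I A i" and g: "y = (\<Sum>i\<in>I. g i *\<^sub>R graph_vec I A i)" by auto
    have "c *\<^sub>R x = (\<Sum>j\<in>I. (if j = i then c else 0) *\<^sub>R graph_vec I A j)"
      using i by (simp add: if_distrib[of "\<lambda>c. c *\<^sub>R _"] cong: if_cong)
    then have "c *\<^sub>R x + y = (\<Sum>j\<in>I. ((if j = i then c else 0) + g j) *\<^sub>R graph_vec I A j)"
      unfolding g by (simp add: scaleR_add_left sum.distrib)
    then show ?case by (intro exI[of _ "\<lambda>j. (if j = i then c else 0) + g j"])
  qed
  then obtain c where c: "a = (\<Sum>i\<in>I. c i *\<^sub>R graph_vec I A i)" ..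
  have "a $ i = c i" if "i \<in> I" for i unfolding c by (rule sum_graph_vec_nth[OF that])
  then show ?thesis using c by simp
qed

lemma dim_span_graph_vec:
  fixes I :: "'n::finite set"
  shows "dim (span (graph_vec I A ` I)) = card I"
proof -
  have inj: "inj_on (graph_vec I A) I"
  proof (rule inj_onI)
    fix i j assume "i \<in> I" "j \<in> I" "graph_vec I A i = graph_vec I A j"
    then have "graph_vec I A i $ i = graph_vec I A j $ i" by simp
    then show "i = j" using \<open>i \<in> I\<close> by (simp add: graph_vec_def split: if_splits)
  qed
  have "independent (graph_vec I A ` I)"
  proof (rule independent_if_scalars_zero)
    fix f x assume 0: "(\<Sum>x\<in>graph_vec I A ` I. f x *\<^sub>R x) = 0" and x: "x \<in> graph_vec I A ` I"
    then obtain i where i: "i \<in> I" "x = graph_vec I A i" by auto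
    have "(\<Sum>i\<in>I. f (graph_vec I A i) *\<^sub>R graph_vec I A i) = 0"
      using 0 by (simp add: sum.reindex[OF inj])
    then have "(\<Sum>i\<in>I. f (graph_vec I A i) *\<^sub>R graph_vec I A i) $ i = 0" by simp
    then show "f x = 0" using sum_graph_vec_nth[OF i(1), of "\<lambda>i. f (graph_vec I A i)" A] i by simp
  qed simp
  then show ?thesis using inj by (simp add: dim_eq_card_independent card_image)
qed

text \<open>Steinitz exchange: a maximal coordinate subspace meeting \<open>s\<close> only in \<open>0\<close> is a complement of \<open>s\<close>,
  and \<open>s\<close> is a graph over the remaining coordinates.\<close>

lemma subspace_graph_chart:
  fixes s :: "(real ^ 'n) set"
  assumes s: "subspace s"
  shows "\<exists>I A. span (graph_vec I A ` I) = s"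
proof -
  define P where "P J \<longleftrightarrow> (\<forall>v\<in>s. (\<forall>l. l \<notin> J \<longrightarrow> v $ l = 0) \<longrightarrow> v = 0)" for J
  have "P {}" by (auto simp: P_def vec_eq_iff)
  then obtain J where PJ: "P J" and max: "\<And>J'. P J' \<Longrightarrow> card J' \<le> card J"
    using ex_has_greatest_nat[of P "{}" card "Suc CARD('n)"] by (auto simp: card_mono less_Suc_eq_le)
  define I where "I = - J"
  have "\<exists>w\<in>s. w $ i = 1 \<and> (\<forall>l. l \<in> I \<and> l \<noteq> i \<longrightarrow> w $ l = 0)" if i: "i \<in> I" for i
  proof -
    have "\<not> P (insert i J)" using max[of "insert i J"] i by (auto simp: I_def)
    then obtain v where v: "v \<in> s" "\<And>l. l \<notin> insert i J \<Longrightarrow> v $ l = 0" "v \<noteq> 0" by (auto simp: P_def)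
    have "v $ i \<noteq> 0" using PJ v unfolding P_def by (metis insert_iff)
    then show ?thesis using v s i
      by (intro bexI[of _ "(1 / v $ i) *\<^sub>R v"]) (auto simp: subspace_scale I_def)
  qed
  then obtain w where w: "\<And>i. i \<in> I \<Longrightarrow> w i \<in> s" "\<And>i. i \<in> I \<Longrightarrow> w i $ i = 1"
    "\<And>i l. i \<in> I \<Longrightarrow> l \<in> I \<Longrightarrow> l \<noteq> i \<Longrightarrow> w i $ l = 0" by metis
  define A where "A i l = w i $ l" for i l
  have gw: "graph_vec I A i = w i" if "i \<in> I" for i
    using w that by (auto simp: vec_eq_iff graph_vec_def A_def)
  have "span (graph_vec I A ` I) \<subseteq> s"
    using gw w s by (intro span_minimal) auto
  moreover have "a \<in> span (graph_vec I A ` I)" if a: "a \<in> s" for a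
  proof -
    let ?b = "(\<Sum>i\<in>I. a $ i *\<^sub>R graph_vec I A i)"
    have "a - ?b \<in> s" using a s gw w by (intro subspace_diff subspace_sum subspace_scale) auto
    moreover have "(a - ?b) $ l = 0" if "l \<notin> J" for l
      using sum_graph_vec_nth[of l I "\<lambda>i. a $ i" A] that by (simp add: I_def)
    ultimately have "a - ?b = 0" using PJ unfolding P_def by blast
    then have "a = ?b" by simp
    moreover have "?b \<in> span (graph_vec I A ` I)" by (intro span_sum span_scale span_base) auto
    ultimately show ?thesis by simp
  qed
  ultimately show ?thesis by blast
qed

text \<open>The vector of the second graph with the same \<open>I\<close>-coordinates as \<open>a\<close> is close to \<open>a\<close>, and
  normalising it at most doubles the distance.\<close>

lemma infdist_graph_sphere_le:
  fixes I :: "'n::finite set"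
  assumes AB: "\<And>i l. i \<in> I \<Longrightarrow> l \<notin> I \<Longrightarrow> \<bar>A i l - B i l\<bar> \<le> \<epsilon>" and \<epsilon>: "0 \<le> \<epsilon>"
    and a: "a \<in> span (graph_vec I A ` I)" "norm a = 1"
  shows "infdist a (span (graph_vec I B ` I) \<inter> sphere 0 1) \<le> 2 * real CARD('n) ^ 2 * \<epsilon>"
proof -
  define b where "b = (\<Sum>i\<in>I. a $ i *\<^sub>R graph_vec I B i)"
  have aeq: "a = (\<Sum>i\<in>I. a $ i *\<^sub>R graph_vec I A i)" by (rule span_graph_vec_expand[OF a(1)])
  have b: "b \<in> span (graph_vec I B ` I)" unfolding b_def by (intro span_sum span_scale span_base) auto
  have v: "norm (graph_vec I A i - graph_vec I B i) \<le> real CARD('n) * \<epsilon>" if "i \<in> I" for i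
  proof -
    have "norm (graph_vec I A i - graph_vec I B i) \<le> (\<Sum>l\<in>UNIV. \<bar>(graph_vec I A i - graph_vec I B i) $ l\<bar>)"
      by (rule norm_le_l1_cart)
    also have "\<dots> \<le> (\<Sum>l\<in>(UNIV::'n set). \<epsilon>)"
      using that AB \<epsilon> by (intro sum_mono) (auto simp: graph_vec_def)
    finally show ?thesis by simp
  qed
  have "norm (a - b) = norm (\<Sum>i\<in>I. a $ i *\<^sub>R (graph_vec I A i - graph_vec I B i))"
    by (subst aeq) (simp add: b_def sum_subtractf scaleR_diff_right)
  also have "\<dots> \<le> (\<Sum>i\<in>I. norm (a $ i *\<^sub>R (graph_vec I A i - graph_vec I B i)))" by (rule norm_sum)
  also have "\<dots> \<le> (\<Sum>i\<in>I. 1 * (real CARD('n) * \<epsilon>))"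
    unfolding norm_scaleR using v a(2) component_le_norm_cart[of a] by (intro sum_mono mult_mono) auto
  also have "\<dots> = real (card I) * (real CARD('n) * \<epsilon>)" by simp
  also have "\<dots> \<le> real CARD('n) * (real CARD('n) * \<epsilon>)"
    using \<epsilon> by (intro mult_right_mono) (auto intro: card_mono)
  finally have ab: "norm (a - b) \<le> real CARD('n) ^ 2 * \<epsilon>" by (simp add: power2_eq_square mult.assoc)
  have "b \<noteq> 0"
  proof
    assume "b = 0"
    then have "a $ i = 0" if "i \<in> I" for i
      using sum_graph_vec_nth[OF that, of "\<lambda>i. a $ i" B] by (simp add: b_def)
    then have "a = 0" using aeq by simp
    then show False using a by simp
  qed
  define b' where "b' = (1 / norm b) *\<^sub>R b"
  have b': "b' \<in> span (graph_vec I B ` I) \<inter> sphere 0 1"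
    using b \<open>b \<noteq> 0\<close> unfolding b'_def by (auto intro: span_scale)
  have "b - b' = (norm b - 1) *\<^sub>R b'" using \<open>b \<noteq> 0\<close> by (simp add: b'_def algebra_simps flip: scaleR_add_left add_divide_distrib)
  then have "norm (b - b') = \<bar>norm b - norm a\<bar>" using b' a by simp
  also have "\<dots> \<le> norm (a - b)" by (metis norm_minus_commute norm_triangle_ineq3)
  finally have "dist a b' \<le> 2 * norm (a - b)"
    using norm_triangle_ineq[of "a - b" "b - b'"] by (simp add: dist_norm)
  then have "dist a b' \<le> 2 * real CARD('n) ^ 2 * \<epsilon>" using ab by simp
  then show ?thesis using infdist_le2[OF b'] by blast
qed

lemma grassmannian_dist_graph_le:
  fixes I :: "'n::finite set"
  assumes AB: "\<And>i l. i \<in> I \<Longrightarrow> l \<notin> I \<Longrightarrow> \<bar>A i l - B i l\<bar> \<le> \<epsilon>" and \<epsilon>: "0 \<le> \<epsilon>" and I: "I \<noteq> {}"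
  shows "grassmannian_dist (span (graph_vec I A ` I)) (span (graph_vec I B ` I)) \<le> 2 * real CARD('n) ^ 2 * \<epsilon>"
proof -
  have ne: "span (graph_vec I C ` I) \<inter> sphere 0 1 \<noteq> {}" for C
  proof -
    obtain i where i: "i \<in> I" using I by auto
    let ?v = "graph_vec I C i"
    have "?v $ i = 1" using i by (simp add: graph_vec_def)
    then have "?v \<noteq> 0" by auto
    then have "(1 / norm ?v) *\<^sub>R ?v \<in> span (graph_vec I C ` I) \<inter> sphere 0 1"
      using i by (auto intro: span_scale span_base)
    then show ?thesis by blast
  qed
  have BA: "\<And>i l. i \<in> I \<Longrightarrow> l \<notin> I \<Longrightarrow> \<bar>B i l - A i l\<bar> \<le> \<epsilon>" using AB by (simp add: abs_minus_commute)
  show ?thesis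
    unfolding grassmannian_dist_def hausdorff_distance_def
    by (intro max.boundedI cSUP_least ne) 
       (auto intro: infdist_graph_sphere_le[OF AB \<epsilon>] infdist_graph_sphere_le[OF BA \<epsilon>])
qed

section \<open>Counting the cells of nearly orthogonal subspaces\<close>

lemma floor_double_eq_iff:
  fixes y y' :: real
  shows "\<lfloor>2 * y\<rfloor> = \<lfloor>2 * y'\<rfloor> \<longleftrightarrow> \<lfloor>y\<rfloor> = \<lfloor>y'\<rfloor> \<and> (odd \<lfloor>2 * y\<rfloor> \<longleftrightarrow> odd \<lfloor>2 * y'\<rfloor>)"
proof -
  have half: "\<lfloor>2 * z\<rfloor> div 2 = \<lfloor>z\<rfloor>" for z :: real
    using floor_divide_real_eq_div[of 2 "2 * z"] by simp
  show ?thesis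
  proof
    assume "\<lfloor>2 * y\<rfloor> = \<lfloor>2 * y'\<rfloor>"
    then show "\<lfloor>y\<rfloor> = \<lfloor>y'\<rfloor> \<and> (odd \<lfloor>2 * y\<rfloor> \<longleftrightarrow> odd \<lfloor>2 * y'\<rfloor>)"
      using half[of y] half[of y'] by simp
  next
    assume "\<lfloor>y\<rfloor> = \<lfloor>y'\<rfloor> \<and> (odd \<lfloor>2 * y\<rfloor> \<longleftrightarrow> odd \<lfloor>2 * y'\<rfloor>)"
    then show "\<lfloor>2 * y\<rfloor> = \<lfloor>2 * y'\<rfloor>"
      using half[of y] half[of y'] by (presburger)
  qed
qed

text \<open>The digit of level \<open>n\<close> records which of the coordinates have binary digit \<open>1\<close> at place
  \<open>n + 1\<close>, so the cells of level \<open>n\<close> become the dyadic cubes of side \<open>2\<^bsup>-n\<^esup>\<close>.\<close>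

lemma binary_digit_code:
  fixes y :: "'a \<Rightarrow> 'k \<Rightarrow> real"
  assumes "finite K"
  obtains b :: nat and D :: "nat \<Rightarrow> 'a \<Rightarrow> nat"
  where "\<And>n x. D n x < b"
    and "\<And>n x x'. (\<And>\<kappa>. \<kappa> \<in> K \<Longrightarrow> y x \<kappa> \<in> {0..<1} \<and> y x' \<kappa> \<in> {0..<1}) \<Longrightarrow>
       digit_code b D n x = digit_code b D n x' \<longleftrightarrow> (\<forall>\<kappa>\<in>K. \<lfloor>2 ^ n * y x \<kappa>\<rfloor> = \<lfloor>2 ^ n * y x' \<kappa>\<rfloor>)"
proof -
  define b where "b = card (Pow K)"
  obtain enc where enc: "bij_betw enc (Pow K) {0..<b}"
    using ex_bij_betw_finite_nat[of "Pow K"] assms by (auto simp: b_def)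
  define dig where "dig n x = {\<kappa>\<in>K. odd \<lfloor>2 ^ Suc n * y x \<kappa>\<rfloor>}" for n x
  define D where "D n x = enc (dig n x)" for n x
  have digP: "dig n x \<in> Pow K" for n x by (auto simp: dig_def)
  have D: "D n x < b" for n x
    using enc digP[of n x] unfolding D_def bij_betw_def by auto
  have Deq: "D n x = D n x' \<longleftrightarrow> dig n x = dig n x'" for n x x'
    using enc digP unfolding D_def bij_betw_def by (metis inj_on_eq_iff)
  show ?thesis
  proof (rule that[of D b])
    show "D n x < b" for n x by (rule D)
  next
    fix n x x'
    assume 01: "\<And>\<kappa>. \<kappa> \<in> K \<Longrightarrow> y x \<kappa> \<in> {0..<1} \<and> y x' \<kappa> \<in> {0..<1}"
    show "digit_code b D n x = digit_code b D n x' \<longleftrightarrow> (\<forall>\<kappa>\<in>K. \<lfloor>2 ^ n * y x \<kappa>\<rfloor> = \<lfloor>2 ^ n * y x' \<kappa>\<rfloor>)"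
    proof (induction n)
      case 0
      have "\<lfloor>y x \<kappa>\<rfloor> = 0 \<and> \<lfloor>y x' \<kappa>\<rfloor> = 0" if "\<kappa> \<in> K" for \<kappa>
        using 01[OF that] by (auto intro!: floor_unique)
      then show ?case by simp
    next
      case (Suc n)
      have "digit_code b D (Suc n) x = digit_code b D (Suc n) x' \<longleftrightarrow>
          digit_code b D n x = digit_code b D n x' \<and> D n x = D n x'"
      proof
        assume eq: "digit_code b D (Suc n) x = digit_code b D (Suc n) x'"
        then have "digit_code b D n x = digit_code b D n x'"
          by (metis digit_code_Suc_div[of D, OF D])
        with eq show "digit_code b D n x = digit_code b D n x' \<and> D n x = D n x'" by simp
      qed simp
      also have "\<dots> \<longleftrightarrow> (\<forall>\<kappa>\<in>K. \<lfloor>2 ^ n * y x \<kappa>\<rfloor> = \<lfloor>2 ^ n * y x' \<kappa>\<rfloor> \<and>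
          (odd \<lfloor>2 ^ Suc n * y x \<kappa>\<rfloor> \<longleftrightarrow> odd \<lfloor>2 ^ Suc n * y x' \<kappa>\<rfloor>))"
        unfolding Suc Deq by (auto simp only: dig_def)
      also have "\<dots> \<longleftrightarrow> (\<forall>\<kappa>\<in>K. \<lfloor>2 ^ Suc n * y x \<kappa>\<rfloor> = \<lfloor>2 ^ Suc n * y x' \<kappa>\<rfloor>)"
        unfolding power_Suc mult.assoc by (intro ball_cong refl) (rule floor_double_eq_iff[symmetric])
      finally show ?case .
    qed
  qed
qed

lemma card_le_fibres:
  assumes "finite Y" "finite Z" "r ` Z \<subseteq> Y" "\<And>z0. z0 \<in> Z \<Longrightarrow> card {z\<in>Z. r z = r z0} \<le> m"
  shows "card Z \<le> m * card Y"
proof -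
  have "Z = (\<Union>y\<in>Y. {z\<in>Z. r z = y})" using assms(3) by auto
  then have "card Z \<le> (\<Sum>y\<in>Y. card {z\<in>Z. r z = y})"
    using card_UN_le[OF assms(1), of "\<lambda>y. {z\<in>Z. r z = y}"] by simp
  also have "\<dots> \<le> (\<Sum>y\<in>Y. m)"
  proof (rule sum_mono)
    fix y assume "y \<in> Y"
    show "card {z\<in>Z. r z = y} \<le> m"
    proof (cases "{z\<in>Z. r z = y} = {}")
      case True
      then show ?thesis by (simp only: card.empty)
    next
      case False
      then obtain z0 where "z0 \<in> Z" "r z0 = y" by auto
      then show ?thesis using assms(4)[of z0] by simp
    qed
  qed
  finally show ?thesis by (simp add: mult.commute)
qed

text \<open>The dyadic cube of level \<open>n\<close> containing the matrix \<open>A\<close>, after the affine map that takes entries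
  in \<open>[-M, M]\<close> into \<open>[0, 1)\<close>; the denominator \<open>2 * M + 1\<close> rather than \<open>2 * M\<close> keeps the value
  \<open>1\<close> out.\<close>

definition grid_cell :: "'n set \<Rightarrow> real \<Rightarrow> nat \<Rightarrow> ('n \<Rightarrow> 'n \<Rightarrow> real) \<Rightarrow> 'n \<times> 'n \<Rightarrow> int" where
  "grid_cell I M n A = (\<lambda>\<kappa>\<in>I \<times> - I. \<lfloor>2 ^ n * ((A (fst \<kappa>) (snd \<kappa>) + M) / (2 * M + 1))\<rfloor>)"

lemma grid_coordinate_diff:
  fixes M u v :: real
  assumes "1 \<le> M"
  shows "\<bar>2 ^ n * ((u + M) / (2 * M + 1)) - 2 ^ n * ((v + M) / (2 * M + 1))\<bar> = 2 ^ n * \<bar>u - v\<bar> / (2 * M + 1)"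
proof -
  have "2 ^ n * ((u + M) / (2 * M + 1)) - 2 ^ n * ((v + M) / (2 * M + 1)) = 2 ^ n * (u - v) / (2 * M + 1)"
    by (simp add: algebra_simps flip: diff_divide_distrib)
  then show ?thesis using assms by (simp add: abs_divide abs_mult)
qed

lemma floor_grid_eq_imp_close:
  fixes M u v :: real
  assumes M: "1 \<le> M" and eq: "\<lfloor>2 ^ n * ((u + M) / (2 * M + 1))\<rfloor> = \<lfloor>2 ^ n * ((v + M) / (2 * M + 1))\<rfloor>"
  shows "\<bar>u - v\<bar> \<le> (2 * M + 1) / 2 ^ n"
proof -
  have "\<bar>2 ^ n * ((u + M) / (2 * M + 1)) - 2 ^ n * ((v + M) / (2 * M + 1))\<bar> \<le> 1" using eq by linarith
  then show ?thesis unfolding grid_coordinate_diff[OF M] using M by (simp add: field_simps)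
qed

lemma inner_graph_vec:
  fixes \<xi> :: "real ^ 'n"
  assumes "i \<in> I"
  shows "\<xi> \<bullet> graph_vec I A i = \<xi> $ i + (\<Sum>l\<in>- I. \<xi> $ l * A i l)"
proof -
  have "\<xi> \<bullet> graph_vec I A i = (\<Sum>l\<in>UNIV. \<xi> $ l * graph_vec I A i $ l)"
    by (simp add: inner_vec_def)
  also have "\<dots> = (\<Sum>l\<in>I. \<xi> $ l * graph_vec I A i $ l) + (\<Sum>l\<in>- I. \<xi> $ l * graph_vec I A i $ l)"
    by (subst sum.union_disjoint[symmetric]) (auto simp: Compl_partition)
  also have "(\<Sum>l\<in>I. \<xi> $ l * graph_vec I A i $ l) = (\<Sum>l\<in>I. if l = i then \<xi> $ i else 0)"
    by (intro sum.cong) (auto simp: graph_vec_def)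
  also have "\<dots> = \<xi> $ i" using assms by simp
  also have "(\<Sum>l\<in>- I. \<xi> $ l * graph_vec I A i $ l) = (\<Sum>l\<in>- I. \<xi> $ l * A i l)"
    by (intro sum.cong) (auto simp: graph_vec_def)
  finally show ?thesis .
qed

text \<open>The exponent \<open>k (d - 1 - k)\<close> of the theorem arises here. Near orthogonality of \<open>\<xi>\<close> to the graph
  of \<open>A\<close> says that each of the \<open>k\<close> rows of \<open>A\<close>, a vector with \<open>d - k\<close> entries, lies within
  \<open>O(2\<^bsup>-n\<^esup>)\<close> of a hyperplane. If some coordinate of \<open>\<xi>\<close> outside \<open>I\<close> is not small, the
  corresponding entry of a row is determined up to \<open>O(2\<^bsup>-n\<^esup>)\<close> by the other \<open>d - k - 1\<close>. Otherwise
  \<open>\<xi>\<close> is essentially supported in \<open>I\<close>, where the graph projects onto the whole coordinate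
  subspace, and the condition can only hold at boundedly many levels.\<close>

lemma card_slab_cells:
  fixes I :: "'n::finite set" and M C :: real
  assumes M: "1 \<le> M" and C: "0 \<le> C" and I: "I \<noteq> UNIV"
  defines "S \<equiv> \<lambda>n \<xi>. {A. (\<forall>i\<in>I. \<forall>l\<in>- I. \<bar>A i l\<bar> \<le> M) \<and>
     (\<forall>i\<in>I. \<bar>\<xi> \<bullet> graph_vec I A i\<bar> \<le> C * norm \<xi> / 2 ^ n)}"
  shows "\<exists>C'\<ge>0. \<forall>n. \<forall>\<xi> :: real ^ 'n. \<xi> \<noteq> 0 \<longrightarrow> finite (grid_cell I M n ` S n \<xi>) \<and>
     real (card (grid_cell I M n ` S n \<xi>)) \<le> C' * 2 ^ (n * (card I * (card (- I) - 1)))"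
proof -
  define d where "d = real CARD('n)"
  have d1: "d \<ge> 1" by (simp add: d_def Suc_le_eq)
  \<comment> \<open>coordinates of \<open>\<xi>\<close> outside \<open>I\<close> below \<open>c * norm \<xi>\<close> contribute at most half of \<open>norm \<xi> / d\<close>, a lower bound for the largest coordinate\<close>
  define c where "c = 1 / (2 * d\<^sup>2 * M)"
  have c0: "c > 0" using d1 M by (simp add: c_def)
  define H where "H = (2 * C + d * (2 * M + 1)) / c"
  have H0: "H \<ge> 0" using C d1 M c0 by (simp add: H_def)
  define L where "L = \<lceil>H\<rceil> + 1"
  \<comment> \<open>\<open>C1\<close> bounds the number of all cells at the levels with \<open>2 ^ n \<le> 2 * d * C\<close>; \<open>C2\<close> bounds the number of choices for the determined entries\<close>
  define C1 where "C1 = (2 * d * C) ^ card (I \<times> - I)"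
  define C2 where "C2 = real (card {-L..L} ^ card I)"
  have "finite (grid_cell I M n ` S n \<xi>) \<and>
     real (card (grid_cell I M n ` S n \<xi>)) \<le> (C1 + C2) * 2 ^ (n * (card I * (card (- I) - 1)))"
    if \<xi>: "\<xi> \<noteq> 0" for n and \<xi> :: "real ^ 'n"
  proof -
    let ?b = "2 ^ (n * (card I * (card (- I) - 1))) :: real"
    let ?Z = "grid_cell I M n ` S n \<xi>"
    have val: "\<lfloor>2 ^ n * ((A i l + M) / (2 * M + 1))\<rfloor> \<in> {0..<2 ^ n}"
      if "A \<in> S n \<xi>" "i \<in> I" "l \<notin> I" for A i l
    proof -
      have "\<bar>A i l\<bar> \<le> M" using that by (auto simp: S_def)
      then have "0 \<le> (A i l + M) / (2 * M + 1)" "(A i l + M) / (2 * M + 1) < 1" using M by (auto simp: field_simps)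
      then have "0 \<le> 2 ^ n * ((A i l + M) / (2 * M + 1))" "2 ^ n * ((A i l + M) / (2 * M + 1)) < 2 ^ n * 1"
        by (intro mult_nonneg_nonneg mult_strict_left_mono; simp)+
      then show ?thesis by (auto simp: floor_less_iff le_floor_iff)
    qed
    have ZPi: "?Z \<subseteq> PiE (I \<times> - I) (\<lambda>_. {0..<2 ^ n})"
    proof (rule image_subsetI)
      fix A assume "A \<in> S n \<xi>"
      then have "\<lfloor>2 ^ n * ((A (fst \<kappa>) (snd \<kappa>) + M) / (2 * M + 1))\<rfloor> \<in> {0..<2 ^ n}" if "\<kappa> \<in> I \<times> - I" for \<kappa>
        by (rule val) (use that \<open>A \<in> S n \<xi>\<close> in \<open>simp_all only: mem_Times_iff Compl_iff not_False_eq_True\<close>)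
      then show "grid_cell I M n A \<in> PiE (I \<times> - I) (\<lambda>_. {0..<2 ^ n})"
        unfolding grid_cell_def restrict_PiE_iff by blast
    qed
    then have finZ: "finite ?Z" by (rule finite_subset) (auto intro!: finite_PiE)
    have cardle: "card ?Z \<le> (2 ^ n) ^ card (I \<times> - I)"
      using card_mono[OF _ ZPi] by (simp add: finite_PiE card_PiE nat_power_eq)
    have "\<exists>i. \<bar>\<xi> $ i\<bar> \<ge> norm \<xi> / d"
    proof (rule ccontr)
      assume "\<not> (\<exists>i. \<bar>\<xi> $ i\<bar> \<ge> norm \<xi> / d)"
      then have "(\<Sum>i\<in>UNIV. \<bar>\<xi> $ i\<bar>) < (\<Sum>i\<in>(UNIV :: 'n set). norm \<xi> / d)"
        by (intro sum_strict_mono) (auto simp: not_le)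
      also have "\<dots> = norm \<xi>" by (simp add: d_def)
      finally show False using norm_le_l1_cart[of \<xi>] by simp
    qed
    then obtain im where im: "\<bar>\<xi> $ im\<bar> \<ge> norm \<xi> / d" ..
    have "real (card ?Z) \<le> C1 * ?b \<or>
          real (card ?Z) \<le> C2 * ?b"
    proof (cases "\<forall>l\<in>- I. \<bar>\<xi> $ l\<bar> < c * norm \<xi>")
      case small: True
      have "im \<in> I"
      proof (rule ccontr)
        assume "im \<notin> I"
        then have "norm \<xi> / d < c * norm \<xi>" using small im by force
        then have "norm \<xi> * (1 / d) < norm \<xi> * c" by (simp add: mult.commute)
        moreover have "0 < norm \<xi>" using \<xi> by simp
        ultimately have "1 / d < c" by (rule mult_left_less_imp_less[OF _ less_imp_le])
        moreover have "c \<le> 1 / d"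
        proof -
          have "d \<le> 2 * d\<^sup>2 * M"
          proof -
            have "d * 1 \<le> (2 * d * d) * M" using d1 M by (intro mult_mono) auto
            then show ?thesis by (simp add: power2_eq_square mult.assoc)
          qed
          then show ?thesis unfolding c_def using d1 M by (intro divide_left_mono) auto
        qed
        ultimately show False by simp
      qed
      show ?thesis
      proof (cases "S n \<xi> = {}")
        case True
        then show ?thesis using d1 C by (simp add: C1_def)
      next
        case False
        then obtain A where A: "A \<in> S n \<xi>" by auto
        have "\<bar>\<Sum>l\<in>- I. \<xi> $ l * A im l\<bar> \<le> (\<Sum>l\<in>- I. \<bar>\<xi> $ l * A im l\<bar>)" by (rule sum_abs)
        also have "\<dots> \<le> (\<Sum>l\<in>- I. (c * norm \<xi>) * M)"
          unfolding abs_mult using small A \<open>im \<in> I\<close>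
          by (intro sum_mono mult_mono) (auto simp: S_def less_imp_le c0[THEN less_imp_le])
        also have "\<dots> = real (card (- I)) * ((c * norm \<xi>) * M)" by simp
        also have "\<dots> \<le> d * ((c * norm \<xi>) * M)"
          unfolding d_def using c0 M by (intro mult_right_mono) (auto intro: card_mono)
        also have "\<dots> = norm \<xi> / (2 * d)"
          using d1 M by (simp add: c_def power2_eq_square field_simps)
        finally have "norm \<xi> / d - norm \<xi> / (2 * d) \<le> \<bar>\<xi> $ im + (\<Sum>l\<in>- I. \<xi> $ l * A im l)\<bar>"
          using im by linarith
        also have "\<dots> \<le> C * norm \<xi> / 2 ^ n"
          using A \<open>im \<in> I\<close> inner_graph_vec[of im I \<xi> A] by (auto simp: S_def)
        finally have "2 ^ n \<le> 2 * d * C" using \<xi> d1 by (simp add: field_simps)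
        have "real (card ?Z) \<le> (2 ^ n) ^ card (I \<times> - I)"
          using cardle by (metis of_nat_le_iff of_nat_power of_nat_numeral)
        also have "\<dots> \<le> C1" unfolding C1_def using \<open>2 ^ n \<le> 2 * d * C\<close> by (intro power_mono) auto
        also have "\<dots> \<le> C1 * ?b"
        proof -
          have "0 \<le> C1" using d1 C unfolding C1_def by (intro zero_le_power mult_nonneg_nonneg) auto
          then have "C1 * 1 \<le> C1 * ?b"
            by (rule mult_left_mono[rotated]) simp
          then show ?thesis by simp
        qed
        finally show ?thesis by simp
      qed
    next
      case False
      then obtain l0 where l0: "l0 \<notin> I" "\<bar>\<xi> $ l0\<bar> \<ge> c * norm \<xi>" by (auto simp: not_less)
      define K0 where "K0 = I \<times> (- I - {l0})"
      have close: "\<bar>z (i, l0) - z' (i, l0)\<bar> \<le> L"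
        if z: "z \<in> ?Z" "z' \<in> ?Z" and eq: "\<And>\<kappa>. \<kappa> \<in> K0 \<Longrightarrow> z \<kappa> = z' \<kappa>" and i: "i \<in> I" for z z' i
      proof -
        obtain A A' where A: "A \<in> S n \<xi>" "z = grid_cell I M n A" "A' \<in> S n \<xi>" "z' = grid_cell I M n A'"
          using z by auto
        let ?q = "(2 * M + 1) / 2 ^ n"
        have d1': "\<bar>A i l - A' i l\<bar> \<le> ?q" if "l \<in> - I - {l0}" for l
        proof -
          have "z (i, l) = z' (i, l)" using eq[of "(i, l)"] that i by (simp add: K0_def)
          then show ?thesis
            using that i A by (intro floor_grid_eq_imp_close[OF M]) (simp add: grid_cell_def)
        qed
        have split: "(\<Sum>l\<in>- I. \<xi> $ l * B l) = \<xi> $ l0 * B l0 + (\<Sum>l\<in>- I - {l0}. \<xi> $ l * B l)" for B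
          using l0 by (subst sum.remove[of _ l0]) auto
        have "\<xi> $ l0 * (A i l0 - A' i l0) = \<xi> \<bullet> graph_vec I A i - \<xi> \<bullet> graph_vec I A' i
            - (\<Sum>l\<in>- I - {l0}. \<xi> $ l * (A i l - A' i l))"
          unfolding inner_graph_vec[OF i] split by (simp add: right_diff_distrib sum_subtractf)
        also have "\<bar>\<dots>\<bar> \<le> \<bar>\<xi> \<bullet> graph_vec I A i\<bar> + \<bar>\<xi> \<bullet> graph_vec I A' i\<bar> + \<bar>\<Sum>l\<in>- I - {l0}. \<xi> $ l * (A i l - A' i l)\<bar>"
          by linarith
        also have "\<dots> \<le> C * norm \<xi> / 2 ^ n + C * norm \<xi> / 2 ^ n + d * (norm \<xi> * ?q)"
        proof (intro add_mono)
          show "\<bar>\<xi> \<bullet> graph_vec I A i\<bar> \<le> C * norm \<xi> / 2 ^ n" "\<bar>\<xi> \<bullet> graph_vec I A' i\<bar> \<le> C * norm \<xi> / 2 ^ n"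
            using A i by (auto simp: S_def)
          have "\<bar>\<Sum>l\<in>- I - {l0}. \<xi> $ l * (A i l - A' i l)\<bar> \<le> (\<Sum>l\<in>- I - {l0}. \<bar>\<xi> $ l * (A i l - A' i l)\<bar>)"
            by (rule sum_abs)
          also have "\<dots> \<le> (\<Sum>l\<in>- I - {l0}. norm \<xi> * ?q)"
            unfolding abs_mult using d1' component_le_norm_cart[of \<xi>] by (intro sum_mono mult_mono) auto
          also have "\<dots> = real (card (- I - {l0})) * (norm \<xi> * ?q)" by simp
          also have "\<dots> \<le> d * (norm \<xi> * ?q)"
            unfolding d_def using M by (intro mult_right_mono) (auto intro: card_mono)
          finally show "\<bar>\<Sum>l\<in>- I - {l0}. \<xi> $ l * (A i l - A' i l)\<bar> \<le> d * (norm \<xi> * ?q)" .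
        qed
        also have "\<dots> = (c * norm \<xi>) * (H / 2 ^ n)"
          using c0 by (simp add: H_def field_simps)
        finally have "\<bar>\<xi> $ l0\<bar> * \<bar>A i l0 - A' i l0\<bar> \<le> (c * norm \<xi>) * (H / 2 ^ n)" by (simp add: abs_mult)
        moreover have "(c * norm \<xi>) * \<bar>A i l0 - A' i l0\<bar> \<le> \<bar>\<xi> $ l0\<bar> * \<bar>A i l0 - A' i l0\<bar>"
          using l0 by (intro mult_right_mono) auto
        ultimately have "(c * norm \<xi>) * \<bar>A i l0 - A' i l0\<bar> \<le> (c * norm \<xi>) * (H / 2 ^ n)" by linarith
        moreover have "0 < c * norm \<xi>" using c0 \<xi> by simp
        ultimately have AH: "\<bar>A i l0 - A' i l0\<bar> \<le> H / 2 ^ n" by (rule mult_left_le_imp_le)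
        let ?u = "2 ^ n * ((A i l0 + M) / (2 * M + 1))" and ?v = "2 ^ n * ((A' i l0 + M) / (2 * M + 1))"
        have "\<bar>?u - ?v\<bar> = 2 ^ n * \<bar>A i l0 - A' i l0\<bar> / (2 * M + 1)" by (rule grid_coordinate_diff[OF M])
        also have "\<dots> \<le> H / (2 * M + 1)"
          using AH M by (intro divide_right_mono) (auto simp: abs_mult field_simps)
        also have "\<dots> \<le> H / 1" using M H0 by (intro divide_left_mono) auto
        finally have "\<bar>?u - ?v\<bar> \<le> H" by simp
        then have "\<bar>\<lfloor>?u\<rfloor> - \<lfloor>?v\<rfloor>\<bar> \<le> L" unfolding L_def by linarith
        then show ?thesis using A i l0 by (simp add: grid_cell_def)
      qed
      have "card ?Z \<le> card {-L..L} ^ card I * card (PiE K0 (\<lambda>_. {0..<2 ^ n :: int}))"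
      proof (rule card_le_fibres[where r = "\<lambda>z. restrict z K0"])
        show "finite (PiE K0 (\<lambda>_. {0..<2 ^ n :: int}))" by (auto intro!: finite_PiE)
        show "finite ?Z" by (rule finZ)
        show "(\<lambda>z. restrict z K0) ` ?Z \<subseteq> PiE K0 (\<lambda>_. {0..<2 ^ n :: int})"
          using ZPi by (fastforce simp: K0_def)
        fix z0 assume z0: "z0 \<in> ?Z"
        let ?F = "{z \<in> ?Z. restrict z K0 = restrict z0 K0}"
        let ?\<phi> = "\<lambda>z. \<lambda>i\<in>I. z (i, l0) - z0 (i, l0)"
        have eqK: "z \<kappa> = z0 \<kappa>" if "z \<in> ?F" "\<kappa> \<in> K0" for z \<kappa>
        proof -
          have "restrict z K0 \<kappa> = restrict z0 K0 \<kappa>" using that(1) by simp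
          then show ?thesis using that(2) by simp
        qed
        have "card ?F \<le> card (PiE I (\<lambda>_. {-L..L}))"
        proof (rule card_inj_on_le)
          show "inj_on ?\<phi> ?F"
          proof (rule inj_onI)
            fix z z' assume z: "z \<in> ?F" "z' \<in> ?F" and e: "?\<phi> z = ?\<phi> z'"
            have "z (i, l) = z' (i, l)" if "i \<in> I" "l \<in> - I" for i l
            proof (cases "l = l0")
              case True
              have "?\<phi> z i = ?\<phi> z' i" by (simp only: e)
              then show ?thesis using True that by simp
            next
              case False
              then show ?thesis using eqK[OF z(1), of "(i, l)"] eqK[OF z(2), of "(i, l)"] that by (simp add: K0_def)
            qed
            moreover have "z \<in> extensional (I \<times> - I)" "z' \<in> extensional (I \<times> - I)"
              using z by (auto simp: grid_cell_def)
            ultimately show "z = z'" by (intro extensionalityI) auto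
          qed
          show "?\<phi> ` ?F \<subseteq> PiE I (\<lambda>_. {-L..L})"
          proof (rule image_subsetI)
            fix z assume z: "z \<in> ?F"
            have "\<bar>z (i, l0) - z0 (i, l0)\<bar> \<le> L" if "i \<in> I" for i
              using close[of z z0 i] z z0 eqK[OF z] that by blast
            then show "?\<phi> z \<in> PiE I (\<lambda>_. {-L..L})" by (fastforce simp: abs_le_iff)
          qed
          show "finite (PiE I (\<lambda>_. {-L..L}))" by (auto intro!: finite_PiE)
        qed
        also have "\<dots> = card {-L..L} ^ card I" by (simp add: card_PiE)
        finally show "card ?F \<le> card {-L..L} ^ card I" .
      qed
      also have "card (PiE K0 (\<lambda>_. {0..<2 ^ n :: int})) = 2 ^ (n * (card I * (card (- I) - 1)))"
        using l0 by (simp add: card_PiE K0_def card_cartesian_product nat_power_eq power_mult)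
      finally have "real (card ?Z) \<le> real (card {-L..L} ^ card I * 2 ^ (n * (card I * (card (- I) - 1))))"
        by (rule of_nat_mono)
      then show ?thesis by (simp add: C2_def)
    qed
    moreover have "C1 \<ge> 0" "C2 \<ge> 0" using d1 C by (auto simp: C1_def C2_def)
    ultimately have "real (card ?Z) \<le> (C1 + C2) * ?b"
      by (auto simp: distrib_right elim!: order_trans)
    with finZ show ?thesis by simp
  qed
  moreover have "C1 + C2 \<ge> 0" using d1 C by (auto simp: C1_def C2_def)
  ultimately show ?thesis by blast
qed

section \<open>A Frostman measure on the Grassmannian\<close>

lemma restrict_eq_iff: "restrict f K = restrict g K \<longleftrightarrow> (\<forall>\<kappa>\<in>K. f \<kappa> = g \<kappa>)"
  by (auto simp: restrict_def fun_eq_iff)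

lemma diam_pow_le:
  assumes "0 < s" and "\<And>x y. x \<in> S \<Longrightarrow> y \<in> S \<Longrightarrow> \<rho> x y \<le> q" and "\<And>x. x \<in> S \<Longrightarrow> \<rho> x x = 0"
  shows "diam_pow \<rho> s S \<le> ennreal (q powr s)"
proof (cases "S = {}")
  case False
  then obtain x where x: "x \<in> S" by auto
  have "diam_on \<rho> S \<le> q"
    unfolding diam_on_def using False assms(2) by (intro cSUP_least) auto
  moreover have "0 \<le> diam_on \<rho> S"
  proof -
    have "\<rho> (fst (x, x)) (snd (x, x)) \<le> diam_on \<rho> S"
      unfolding diam_on_def using x assms(2) by (intro cSUP_upper bdd_aboveI2[where M = q]) auto
    then show ?thesis using assms(3)[OF x] by simp
  qed
  ultimately show ?thesis
    using False \<open>0 < s\<close> by (auto simp: diam_pow_def intro!: ennreal_leI powr_mono2)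
qed simp

lemma grassmannian_dist_self:
  fixes s :: "(real ^ 'n) set"
  assumes "s \<in> grassmannian k" "1 \<le> k"
  shows "grassmannian_dist s s = 0"
proof -
  have "s \<noteq> {0}" using assms by (auto simp: grassmannian_def)
  moreover have "subspace s" using assms by (simp add: grassmannian_def)
  ultimately obtain v where v: "v \<in> s" "v \<noteq> 0" using subspace_0 by blast
  then have "(1 / norm v) *\<^sub>R v \<in> s \<inter> sphere 0 1"
    using \<open>subspace s\<close> by (auto simp: subspace_scale)
  then have "s \<inter> sphere 0 1 \<noteq> {}" by blast
  then show ?thesis
    by (simp add: grassmannian_dist_def hausdorff_distance_def cong: SUP_cong_simp)
qed

text \<open>The charts, cut off at integer bounds for the matrix entries, form a countable cover of the
  Grassmannian, so by countable subadditivity one of them carries part of the premeasure. Allowing arbitrary integer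
  bounds avoids the selection of a maximal minor.\<close>

lemma chart_of_positive_premeasure:
  fixes \<Gamma> :: "(real ^ 'n) set set"
  assumes \<Gamma>: "\<Gamma> \<subseteq> grassmannian k" and pos: "hausdorff_premeasure \<M> \<rho> \<alpha> \<delta> \<Gamma> \<noteq> 0"
  obtains I :: "'n set" and A M \<Gamma>'
  where "card I = k" "1 \<le> M" "\<Gamma>' \<subseteq> \<Gamma>" "hausdorff_premeasure \<M> \<rho> \<alpha> \<delta> \<Gamma>' \<noteq> 0"
    and "\<And>s. s \<in> \<Gamma>' \<Longrightarrow> span (graph_vec I (A s) ` I) = s"
    and "\<And>s i l. s \<in> \<Gamma>' \<Longrightarrow> i \<in> I \<Longrightarrow> l \<notin> I \<Longrightarrow> \<bar>A s i l\<bar> \<le> M"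
proof -
  have "\<exists>I A. span (graph_vec I A ` I) = s" if "s \<in> \<Gamma>" for s
    using subspace_graph_chart[of s] \<Gamma> that by (auto simp: grassmannian_def)
  then obtain I A where IA: "\<And>s. s \<in> \<Gamma> \<Longrightarrow> span (graph_vec (I s) (A s) ` I s) = s" by metis
  define P where "P Im = {s\<in>\<Gamma>. I s = fst Im \<and> (\<forall>i l. \<bar>A s i l\<bar> \<le> real (snd Im) + 1)}" for Im :: "'n set \<times> nat"
  have "\<Gamma> \<subseteq> (\<Union>n. P (from_nat n))"
  proof
    fix s assume s: "s \<in> \<Gamma>"
    define B where "B = (\<Sum>i\<in>UNIV. \<Sum>l\<in>UNIV. \<bar>A s i l\<bar>)"
    have AB: "\<bar>A s i l\<bar> \<le> B" for i l
    proof -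
      have "\<bar>A s i l\<bar> \<le> (\<Sum>l\<in>UNIV. \<bar>A s i l\<bar>)" by (rule member_le_sum) auto
      also have "\<dots> \<le> B" unfolding B_def by (rule member_le_sum[of i UNIV "\<lambda>i. \<Sum>l\<in>UNIV. \<bar>A s i l\<bar>"]) (auto intro: sum_nonneg)
      finally show ?thesis .
    qed
    obtain m :: nat where "B \<le> real m" using real_arch_simple by blast
    then have "\<bar>A s i l\<bar> \<le> real m + 1" for i l using AB[of i l] by linarith
    then have "s \<in> P (I s, m)" using s by (auto simp: P_def)
    then have "s \<in> P (from_nat (to_nat (I s, m)))" by simp
    then show "s \<in> (\<Union>n. P (from_nat n))" by blast
  qed
  then have le: "hausdorff_premeasure \<M> \<rho> \<alpha> \<delta> \<Gamma> \<le> (\<Sum>n. hausdorff_premeasure \<M> \<rho> \<alpha> \<delta> (P (from_nat n)))"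
    by (rule order_trans[OF hausdorff_premeasure_mono hausdorff_premeasure_UN_le])
  have "\<exists>n. hausdorff_premeasure \<M> \<rho> \<alpha> \<delta> (P (from_nat n)) \<noteq> 0"
  proof (rule ccontr)
    assume "\<not> ?thesis"
    then have "(\<Sum>n. hausdorff_premeasure \<M> \<rho> \<alpha> \<delta> (P (from_nat n))) = 0" by simp
    with le pos show False by simp
  qed
  then obtain n where n: "hausdorff_premeasure \<M> \<rho> \<alpha> \<delta> (P (from_nat n)) \<noteq> 0" ..
  define I0 where "I0 = fst (from_nat n :: 'n set \<times> nat)"
  have "P (from_nat n) \<noteq> {}" using n by (metis hausdorff_premeasure_empty)
  then obtain s0 where s0: "s0 \<in> P (from_nat n)" by auto
  have PI: "s \<in> P (from_nat n) \<Longrightarrow> s \<in> \<Gamma> \<and> I s = I0" for s by (auto simp: P_def I0_def)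
  have "dim s0 = card I0" using dim_span_graph_vec[of I0 "A s0"] IA[of s0] PI[OF s0] by (simp del: dim_span)
  moreover have "dim s0 = k" using PI[OF s0] \<Gamma> by (auto simp: grassmannian_def)
  ultimately have "card I0 = k" by simp
  have sp: "span (graph_vec I0 (A s) ` I0) = s" if "s \<in> P (from_nat n)" for s
    using IA[of s] PI[OF that] by (simp only: simp_thms)
  have bd: "\<bar>A s i l\<bar> \<le> real (snd (from_nat n :: 'n set \<times> nat)) + 1" if "s \<in> P (from_nat n)" for s i l
    using that by (simp only: P_def mem_Collect_eq)
  have sub: "P (from_nat n) \<subseteq> \<Gamma>" using PI by blast
  show ?thesis
    by (rule that[of I0 "real (snd (from_nat n :: 'n set \<times> nat)) + 1" "P (from_nat n)" A, OF \<open>card I0 = k\<close> _ sub n sp bd]) simp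
qed

lemma inverse_power_two_powr: "(1 / 2 ^ n) powr \<alpha> = 2 powr (- real n * \<alpha>)"
proof -
  have "1 / 2 ^ n = (2::real) powr (- real n)" by (simp add: powr_minus powr_realpow divide_inverse)
  then show ?thesis by (simp only: powr_powr)
qed

text \<open>Applies \<open>tree_random_path\<close> with the dyadic cells of a chart and with the Hausdorff premeasure at a
  single scale \<open>\<delta>\<close> in the role of \<open>h\<close>. A cell of level \<open>n\<close> has diameter \<open>O(2\<^bsup>-n\<^esup>)\<close> in the
  Grassmannian and, covering itself, premeasure \<open>O(2\<^bsup>-n \<alpha>\<^esup>)\<close>.\<close>

lemma frostman_in_chart:
  fixes \<Gamma> :: "(real ^ 'n) set set" and A :: "(real ^ 'n) set \<Rightarrow> 'n \<Rightarrow> 'n \<Rightarrow> real"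
  assumes \<Gamma>: "\<Gamma> \<subseteq> grassmannian k" and k: "1 \<le> k" and \<alpha>: "0 < \<alpha>" and \<delta>: "0 < \<delta>"
    and pos: "hausdorff_premeasure (grassmannian k) grassmannian_dist \<alpha> \<delta> \<Gamma> \<noteq> 0"
    and I: "card I = k" and M: "1 \<le> M"
    and A: "\<And>s. s \<in> \<Gamma> \<Longrightarrow> span (graph_vec I (A s) ` I) = s"
    and AM: "\<And>s i l. s \<in> \<Gamma> \<Longrightarrow> i \<in> I \<Longrightarrow> l \<notin> I \<Longrightarrow> \<bar>A s i l\<bar> \<le> M"
  obtains C :: real and code :: "nat \<Rightarrow> (real ^ 'n) set \<Rightarrow> nat" and a :: "nat \<Rightarrow> real \<Rightarrow> (real ^ 'n) set"
  where "0 < C"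
    and "\<And>n. a n \<in> measurable unit_space (count_space UNIV)"
    and "\<And>n \<omega>. \<omega> \<in> {0..<1} \<Longrightarrow> a n \<omega> \<in> \<Gamma>"
    and "\<And>n m \<omega>. \<omega> \<in> {0..<1} \<Longrightarrow> n \<le> m \<Longrightarrow> code n (a m \<omega>) = code n (a n \<omega>)"
    and "\<And>n j. measure unit_space {\<omega>\<in>{0..<1}. code n (a n \<omega>) = j} \<le> C * 2 powr (- real n * \<alpha>)"
    and "\<And>n s t. s \<in> \<Gamma> \<Longrightarrow> t \<in> \<Gamma> \<Longrightarrow> code n s = code n t \<longleftrightarrow> grid_cell I M n (A s) = grid_cell I M n (A t)"
proof -
  let ?H = "hausdorff_premeasure (grassmannian k) grassmannian_dist \<alpha> \<delta>"
  define y where "y s \<kappa> = (A s (fst \<kappa>) (snd \<kappa>) + M) / (2 * M + 1)" for s \<kappa>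
  obtain b D where D: "\<And>n x. D n x < b"
    and codeD: "\<And>n s t. (\<And>\<kappa>. \<kappa> \<in> I \<times> - I \<Longrightarrow> y s \<kappa> \<in> {0..<1} \<and> y t \<kappa> \<in> {0..<1}) \<Longrightarrow>
       digit_code b D n s = digit_code b D n t \<longleftrightarrow> (\<forall>\<kappa>\<in>I \<times> - I. \<lfloor>2 ^ n * y s \<kappa>\<rfloor> = \<lfloor>2 ^ n * y t \<kappa>\<rfloor>)"
    by (rule binary_digit_code[of "I \<times> - I" y, OF finite]) blast
  define code where "code = digit_code b D"
  have y01: "y s \<kappa> \<in> {0..<1}" if "s \<in> \<Gamma>" "\<kappa> \<in> I \<times> - I" for s \<kappa>
    using AM[of s "fst \<kappa>" "snd \<kappa>"] that M by (auto simp: y_def field_simps abs_le_iff)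
  have code: "code n s = code n t \<longleftrightarrow> grid_cell I M n (A s) = grid_cell I M n (A t)"
    if "s \<in> \<Gamma>" "t \<in> \<Gamma>" for n s t
  proof -
    have "code n s = code n t \<longleftrightarrow> (\<forall>\<kappa>\<in>I \<times> - I. \<lfloor>2 ^ n * y s \<kappa>\<rfloor> = \<lfloor>2 ^ n * y t \<kappa>\<rfloor>)"
      unfolding code_def by (rule codeD) (use that y01 in blast)
    also have "\<dots> \<longleftrightarrow> grid_cell I M n (A s) = grid_cell I M n (A t)"
      unfolding grid_cell_def y_def restrict_eq_iff ..
    finally show ?thesis .
  qed
  have Ine: "I \<noteq> {}" using I k by auto
  define Q where "Q = 2 * real CARD('n) ^ 2 * (2 * M + 1)"
  have Q0: "Q > 0" using M by (simp add: Q_def)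
  have dist: "grassmannian_dist s t \<le> Q / 2 ^ n" if "s \<in> \<Gamma>" "t \<in> \<Gamma>" "code n s = code n t" for n s t
  proof -
    have "\<bar>A s i l - A t i l\<bar> \<le> (2 * M + 1) / 2 ^ n" if il: "i \<in> I" "l \<notin> I" for i l
    proof -
      have fe: "\<lfloor>2 ^ n * y s (i, l)\<rfloor> = \<lfloor>2 ^ n * y t (i, l)\<rfloor>"
        using codeD[of s t n] y01 that \<open>s \<in> \<Gamma>\<close> \<open>t \<in> \<Gamma>\<close> \<open>code n s = code n t\<close> unfolding code_def by blast
      then show ?thesis using floor_grid_eq_imp_close[OF M] by (simp add: y_def)
    qed
    then have "grassmannian_dist (span (graph_vec I (A s) ` I)) (span (graph_vec I (A t) ` I))
        \<le> 2 * real CARD('n) ^ 2 * ((2 * M + 1) / 2 ^ n)"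
      using M Ine by (intro grassmannian_dist_graph_le) auto
    then show ?thesis using A that by (simp add: Q_def)
  qed
  \<comment> \<open>cells of levels less than \<open>n0\<close> may be larger than \<open>\<delta>\<close>; they are estimated by the whole premeasure, which the second summand of \<open>C\<close> pays for\<close>
  obtain n0 where "Q / \<delta> < 2 ^ n0" using real_arch_pow[of 2 "Q / \<delta>"] by auto
  then have n0: "Q / 2 ^ n \<le> \<delta>" if "n0 \<le> n" for n
  proof -
    have "(2::real) ^ n0 \<le> 2 ^ n" using that by simp
    with \<open>Q / \<delta> < 2 ^ n0\<close> have "Q / \<delta> \<le> 2 ^ n" by linarith
    then show ?thesis using \<delta> by (simp add: field_simps)
  qed
  let ?Q = "\<lambda>n j. {s\<in>\<Gamma>. code n s = j}"
  have cell_dist: "grassmannian_dist s t \<le> Q / 2 ^ n" if "s \<in> (?Q n j)" "t \<in> (?Q n j)" for s t n j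
    using that by (intro dist) simp_all
  have self: "grassmannian_dist s s = 0" if "s \<in> \<Gamma>" for s
    using grassmannian_dist_self[OF _ k] that \<Gamma> by blast
  have cellH: "?H (?Q n j) \<le> ennreal ((Q / 2 ^ n) powr \<alpha>)" if "n0 \<le> n" for n j
  proof -
    have "?H (?Q n j) \<le> diam_pow grassmannian_dist \<alpha> (?Q n j)"
    proof (rule hausdorff_premeasure_le_diam_pow)
      show "(?Q n j) \<subseteq> grassmannian k" using \<Gamma> by blast
      show "grassmannian_dist s t \<le> \<delta>" if "s \<in> (?Q n j)" "t \<in> (?Q n j)" for s t
        using cell_dist[OF that] n0[OF \<open>n0 \<le> n\<close>] by linarith
    qed
    also have "\<dots> \<le> ennreal ((Q / 2 ^ n) powr \<alpha>)"
      by (rule diam_pow_le[OF \<alpha> cell_dist]) (simp_all add: self)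
    finally show ?thesis .
  qed
  have "?H \<Gamma> < top"
  proof -
    have "\<Gamma> \<subseteq> (\<Union>j<b ^ n0. (?Q n0 j))"
      using digit_code_less[of D b n0, OF D] by (auto simp: code_def)
    then have "?H \<Gamma> \<le> (\<Sum>j<b ^ n0. ?H (?Q n0 j))" by (rule hausdorff_premeasure_finite_UN_le)
    also have "\<dots> < top"
    proof -
      have "(\<Sum>j<b ^ n0. ?H (?Q n0 j)) \<le> (\<Sum>j<b ^ n0. ennreal ((Q / 2 ^ n0) powr \<alpha>))"
        by (intro sum_mono cellH) simp
      also have "\<dots> < top" by (subst sum_ennreal) simp_all
      finally show ?thesis .
    qed
    finally show ?thesis .
  qed
  then have fin: "?H S < top" if "S \<subseteq> \<Gamma>" for S
    using hausdorff_premeasure_mono[OF that] by (rule le_less_trans[rotated])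
  define h where "h S = enn2real (?H (S \<inter> \<Gamma>))" for S
  have h0: "0 \<le> h S" for S by (simp add: h_def)
  have hH: "ennreal (h S) = ?H S" if "S \<subseteq> \<Gamma>" for S
    using fin[OF that] that by (simp add: h_def Int_absorb2)
  have h\<Gamma>: "0 < h \<Gamma>"
    using pos hH[of \<Gamma>] h0[of \<Gamma>] by (metis ennreal_0 order_less_le order_refl)
  have hsub: "h S \<le> (\<Sum>c<b. h {x\<in>S. D n x = c})" if "S \<subseteq> \<Gamma>" for S n
  proof -
    have "S \<subseteq> (\<Union>c<b. {x\<in>S. D n x = c})" using D by auto
    then have "?H S \<le> (\<Sum>c<b. ?H {x\<in>S. D n x = c})" by (rule hausdorff_premeasure_finite_UN_le)
    also have "\<dots> = (\<Sum>c<b. ennreal (h {x\<in>S. D n x = c}))"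
      using that by (intro sum.cong refl hH[symmetric]) auto
    also have "\<dots> = ennreal (\<Sum>c<b. h {x\<in>S. D n x = c})" using h0 by simp
    finally have "ennreal (h S) \<le> ennreal (\<Sum>c<b. h {x\<in>S. D n x = c})" using hH[OF that] by simp
    then show ?thesis using h0 by (simp add: sum_nonneg)
  qed
  have hempty: "h {} = 0" by (simp add: h_def)
  obtain a where a: "\<And>n. a n \<in> measurable unit_space (count_space UNIV)"
    "\<And>n \<omega>. \<omega> \<in> {0..<1} \<Longrightarrow> a n \<omega> \<in> \<Gamma>"
    "\<And>n m \<omega>. \<omega> \<in> {0..<1} \<Longrightarrow> n \<le> m \<Longrightarrow> code n (a m \<omega>) = code n (a n \<omega>)"
    and prob: "\<And>n j. measure unit_space {\<omega>\<in>{0..<1}. code n (a n \<omega>) = j} \<le> h (?Q n j) / h \<Gamma>"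
    unfolding code_def
    by (rule tree_random_path[where D = D and b = b and h = h and A = \<Gamma>, OF D h0 hempty h\<Gamma> hsub]) blast+
  define C where "C = Q powr \<alpha> / h \<Gamma> + 2 powr (real n0 * \<alpha>)"
  have C0: "0 < C" using h\<Gamma> by (simp add: C_def add_nonneg_pos)
  have cell: "h (?Q n j) / h \<Gamma> \<le> C * 2 powr (- real n * \<alpha>)" for n j
  proof (cases "n0 \<le> n")
    case True
    have "ennreal (h (?Q n j)) \<le> ennreal ((Q / 2 ^ n) powr \<alpha>)"
      using cellH[OF True, of j] by (subst hH) auto
    then have "h (?Q n j) \<le> (Q / 2 ^ n) powr \<alpha>" by simp
    also have "\<dots> = Q powr \<alpha> * 2 powr (- real n * \<alpha>)"
      using powr_mult[of Q "1 / 2 ^ n" \<alpha>] Q0 unfolding inverse_power_two_powr by simp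
    finally have "h (?Q n j) / h \<Gamma> \<le> (Q powr \<alpha> * 2 powr (- real n * \<alpha>)) / h \<Gamma>"
      using h\<Gamma> by (intro divide_right_mono) auto
    also have "\<dots> \<le> C * 2 powr (- real n * \<alpha>)" by (simp add: C_def algebra_simps)
    finally show ?thesis .
  next
    case False
    have "ennreal (h (?Q n j)) \<le> ennreal (h \<Gamma>)"
      using hausdorff_premeasure_mono[of "(?Q n j)" \<Gamma>] by (simp add: hH)
    then have "h (?Q n j) / h \<Gamma> \<le> 1" using h\<Gamma> by (simp add: divide_le_eq)
    also have "1 \<le> 2 powr (real n0 * \<alpha>) * 2 powr (- real n * \<alpha>)"
      using False \<alpha> by (simp add: powr_add[symmetric] left_diff_distrib[symmetric] ge_one_powr_ge_zero)
    also have "\<dots> \<le> C * 2 powr (- real n * \<alpha>)"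
      using h\<Gamma> by (intro mult_right_mono) (auto simp: C_def)
    finally show ?thesis .
  qed
  show ?thesis
    by (rule that[of C a code, OF C0 a order_trans[OF prob cell] code])
qed

lemma dyadic_scale:
  fixes q :: real
  assumes "0 < q" "q \<le> 1"
  shows "\<exists>n::nat. q \<le> 1 / 2 ^ n \<and> 1 / 2 ^ n < 2 * q"
proof -
  obtain n0 :: nat where n0: "1 / (2 * q) < 2 ^ n0" using real_arch_pow[of 2 "1 / (2 * q)"] by auto
  define n where "n = (LEAST n. 1 / (2 * q) < 2 ^ n)"
  have n: "1 / (2 * q) < 2 ^ n" unfolding n_def using n0 by (rule LeastI)
  have "q \<le> 1 / 2 ^ n"
  proof (cases n)
    case (Suc m)
    then have "\<not> 1 / (2 * q) < 2 ^ m" unfolding n_def by (metis lessI not_less_Least)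
    then show ?thesis using Suc assms by (simp add: field_simps)
  qed (use assms in simp)
  moreover have "1 / 2 ^ n < 2 * q" using n assms by (simp add: field_simps)
  ultimately show ?thesis by blast
qed

text \<open>Transfers near orthogonality from the given orthonormal basis of \<open>s\<close> to the graph vectors, for which
  the cells have been counted.\<close>

lemma inner_le_orthonormal_basis:
  fixes \<xi> v :: "real ^ 'n"
  assumes on: "orthonormal_basis_of k x s" and v: "v \<in> s" and \<xi>: "\<And>j. j \<in> {1..k} \<Longrightarrow> \<bar>\<xi> \<bullet> x j\<bar> \<le> \<eta>"
  shows "\<bar>\<xi> \<bullet> v\<bar> \<le> real k * (norm v * \<eta>)"
proof -
  have o: "\<And>i j. i \<in> {1..k} \<Longrightarrow> j \<in> {1..k} \<Longrightarrow> x i \<bullet> x j = (if i = j then 1 else 0)" and sp: "span (x ` {1..k}) = s"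
    using on by (auto simp: orthonormal_basis_of_def)
  have inj: "inj_on x {1..k}"
    by (rule inj_onI) (metis o zero_neq_one)
  have n1: "norm (x i) = 1" if "i \<in> {1..k}" for i using o[OF that that] by (simp add: norm_eq_1)
  have "(\<Sum>b\<in>x ` {1..k}. (v \<bullet> b) *\<^sub>R b) = v"
  proof (rule orthonormal_basis_expand)
    show "pairwise orthogonal (x ` {1..k})"
      using o by (auto simp: pairwise_def orthogonal_def)
    show "v \<in> span (x ` {1..k})" using v sp by simp
  qed (use n1 in auto)
  then have ve: "v = (\<Sum>j\<in>{1..k}. (v \<bullet> x j) *\<^sub>R x j)"
    unfolding sum.reindex[OF inj] o_def by (rule sym)
  have "\<xi> \<bullet> v = (\<Sum>j\<in>{1..k}. (v \<bullet> x j) * (\<xi> \<bullet> x j))"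
    by (subst ve) (simp add: inner_sum_right)
  also have "\<bar>\<dots>\<bar> \<le> (\<Sum>j\<in>{1..k}. \<bar>(v \<bullet> x j) * (\<xi> \<bullet> x j)\<bar>)" by (rule sum_abs)
  also have "\<dots> \<le> (\<Sum>j\<in>{1..k}. norm v * \<eta>)"
  proof (rule sum_mono)
    fix j assume j: "j \<in> {1..k}"
    have "\<bar>v \<bullet> x j\<bar> \<le> norm v" using Cauchy_Schwarz_ineq2[of v "x j"] n1[OF j] by simp
    then show "\<bar>(v \<bullet> x j) * (\<xi> \<bullet> x j)\<bar> \<le> norm v * \<eta>"
      unfolding abs_mult using \<xi>[OF j] by (intro mult_mono) auto
  qed
  also have "\<dots> = real k * (norm v * \<eta>)" by simp
  finally show ?thesis .
qed

section \<open>Random limiting frames\<close>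

lemma borel_measurable_vec_lambda:
  fixes f :: "'n::finite \<Rightarrow> 'a \<Rightarrow> real"
  assumes "\<And>l. f l \<in> borel_measurable M"
  shows "(\<lambda>\<omega>. \<chi> l. f l \<omega>) \<in> borel_measurable M"
proof (rule borel_measurable_euclidean_space[THEN iffD2], rule ballI)
  fix i :: "real ^ 'n" assume "i \<in> Basis"
  then obtain l where i: "i = axis l 1" by (auto simp: Basis_vec_def)
  show "(\<lambda>\<omega>. (\<chi> l. f l \<omega>) \<bullet> i) \<in> borel_measurable M"
    unfolding i by (simp add: inner_axis assms)
qed

text \<open>\<open>Y 0\<close> is the translation and \<open>Y 1, \<dots>, Y k\<close> the edges of a random cube in \<open>E\<close>. They are limits along
  subsequences of the data attached to the random subspaces of \<open>frostman_in_chart\<close>. The probability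
  estimate passes to the limit without naming a limiting subspace: if the limiting edges are nearly
  orthogonal to \<open>\<xi>\<close>, so are those of an approximating subspace of high level, which lies in the same
  cell of level \<open>n\<close> as the \<open>n\<close>-th subspace. With \<open>2\<^bsup>-n\<^esup>\<close> comparable to \<open>\<eta> / \<bar>\<xi>\<bar>\<close>, counting these
  cells gives the exponent \<open>\<beta>\<close>.\<close>

lemma random_frame:
  fixes x :: "(real ^ 'n) set \<Rightarrow> nat \<Rightarrow> real ^ 'n" and \<Gamma> :: "(real ^ 'n) set set" and E :: "(real ^ 'n) set"
  assumes k: "1 \<le> k" "k < CARD('n)"
    and x: "\<And>s. s \<in> grassmannian k \<Longrightarrow> orthonormal_basis_of k (x s) s"
    and \<Gamma>: "\<Gamma> \<subseteq> grassmannian k" and E: "compact E" and dk: "dk_Gamma_set x k \<Gamma> E"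
    and \<beta>: "0 < \<beta>" and \<delta>: "0 < \<delta>"
    and pos: "hausdorff_premeasure (grassmannian k) grassmannian_dist
        (\<beta> + real k * (real CARD('n) - 1 - real k)) \<delta> \<Gamma> \<noteq> 0"
  obtains K :: real and Y :: "nat \<Rightarrow> real \<Rightarrow> real ^ 'n"
  where "0 < K"
    and "\<And>i. Y i \<in> borel_measurable unit_space"
    and "\<And>\<omega> r. \<omega> \<in> {0..<1} \<Longrightarrow> (\<And>i. i \<in> {1..k} \<Longrightarrow> r i \<in> {0..1}) \<Longrightarrow> Y 0 \<omega> + (\<Sum>i = 1..k. r i *\<^sub>R Y i \<omega>) \<in> E"
    and "\<And>\<xi> \<eta>. \<xi> \<noteq> 0 \<Longrightarrow> 0 < \<eta> \<Longrightarrow>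
      measure unit_space {\<omega>\<in>{0..<1}. \<forall>i\<in>{1..k}. \<bar>\<xi> \<bullet> Y i \<omega>\<bar> \<le> \<eta>} \<le> K * (\<eta> / norm \<xi>) powr \<beta>"
proof -
  interpret prob_space unit_space by (rule prob_space_unit_space)
  define \<alpha> where "\<alpha> = \<beta> + real k * (real CARD('n) - 1 - real k)"
  have \<alpha>: "0 < \<alpha>" unfolding \<alpha>_def using \<beta> k by (intro add_pos_nonneg mult_nonneg_nonneg) auto
  obtain I A M \<Gamma>' where I: "card I = k" and M: "1 \<le> M" and \<Gamma>': "\<Gamma>' \<subseteq> \<Gamma>"
    and pos': "hausdorff_premeasure (grassmannian k) grassmannian_dist \<alpha> \<delta> \<Gamma>' \<noteq> 0"
    and A: "\<And>s. s \<in> \<Gamma>' \<Longrightarrow> span (graph_vec I (A s) ` I) = s"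
    and AM: "\<And>s i l. s \<in> \<Gamma>' \<Longrightarrow> i \<in> I \<Longrightarrow> l \<notin> I \<Longrightarrow> \<bar>A s i l\<bar> \<le> M"
    by (rule chart_of_positive_premeasure[OF \<Gamma> pos[folded \<alpha>_def]]) blast
  have \<Gamma>'g: "\<Gamma>' \<subseteq> grassmannian k" using \<Gamma> \<Gamma>' by auto
  obtain C :: real and code a where C: "0 < C"
    and a_meas: "\<And>n. a n \<in> measurable unit_space (count_space UNIV)"
    and a_in: "\<And>n \<omega>. \<omega> \<in> {0..<1} \<Longrightarrow> a n \<omega> \<in> \<Gamma>'"
    and a_code: "\<And>n m \<omega>. \<omega> \<in> {0..<1} \<Longrightarrow> n \<le> m \<Longrightarrow> code n (a m \<omega>) = code n (a n \<omega>)"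
    and a_prob: "\<And>n j. measure unit_space {\<omega>\<in>{0..<1}. code n (a n \<omega>) = j} \<le> C * 2 powr (- real n * \<alpha>)"
    and code: "\<And>n s t. s \<in> \<Gamma>' \<Longrightarrow> t \<in> \<Gamma>' \<Longrightarrow> (code n s :: nat) = code n t \<longleftrightarrow> grid_cell I M n (A s) = grid_cell I M n (A t)"
    by (rule frostman_in_chart[OF \<Gamma>'g k(1) \<alpha> \<delta> pos' I M A AM]) blast+
  obtain T where T: "\<And>s r. s \<in> \<Gamma> \<Longrightarrow> (\<And>i. i \<in> {1..k} \<Longrightarrow> r i \<in> {0..1}) \<Longrightarrow> T s + (\<Sum>i = 1..k. r i *\<^sub>R x s i) \<in> E"
    using dk unfolding dk_Gamma_set_def by metis
  obtain B where B: "\<And>v. v \<in> E \<Longrightarrow> norm v \<le> B"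
    using compact_imp_bounded[OF E] unfolding bounded_iff by blast
  \<comment> \<open>translation and basis vectors are treated alike, with the translation at index \<open>0\<close>\<close>
  define V where "V s i = (if i = 0 then T s else x s i)" for s and i :: nat
  have Vb: "norm (V s i) \<le> max B 1" if "s \<in> \<Gamma>" "i \<le> k" for s i
  proof (cases "i = 0")
    case True
    have "T s \<in> E" using T[OF that(1), of "\<lambda>_. 0"] by simp
    then show ?thesis using True B by (simp add: V_def le_max_iff_disj)
  next
    case False
    have "x s i \<bullet> x s i = 1" using x[of s] \<Gamma> that False by (auto simp: orthonormal_basis_of_def)
    then show ?thesis using False by (simp add: V_def norm_eq_sqrt_inner)
  qed
  define f where "f p n \<omega> = V (a n \<omega>) (fst p) $ snd p" for p :: "nat \<times> 'n" and n \<omega>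
  have f_meas: "f p n \<in> borel_measurable unit_space" for p n
    unfolding f_def by (rule measurable_compose[OF a_meas]) simp
  have f_b: "\<bar>f p n \<omega>\<bar> \<le> max B 1" if "p \<in> {..k} \<times> UNIV" "\<omega> \<in> space unit_space" for p n \<omega>
  proof -
    have "\<bar>f p n \<omega>\<bar> \<le> norm (V (a n \<omega>) (fst p))" unfolding f_def by (rule component_le_norm_cart)
    also have "\<dots> \<le> max B 1" using Vb[of "a n \<omega>" "fst p"] a_in[of \<omega> n] \<Gamma>' that by auto
    finally show ?thesis .
  qed
  obtain N where N_meas: "\<And>j::nat. N j \<in> measurable unit_space (count_space (UNIV :: nat set))"
    and N_mono: "\<And>\<omega>. \<omega> \<in> {0..<1} \<Longrightarrow> strict_mono (\<lambda>j. N j \<omega>)"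
    and N_conv: "\<And>p \<omega>. p \<in> {..k} \<times> UNIV \<Longrightarrow> \<omega> \<in> {0..<1} \<Longrightarrow> convergent (\<lambda>j. f p (N j \<omega>) \<omega>)"
  proof -
    have "\<exists>N. (\<forall>j::nat. N j \<in> measurable unit_space (count_space (UNIV :: nat set))) \<and>
      (\<forall>\<omega>\<in>space unit_space. strict_mono (\<lambda>j. N j \<omega>)) \<and>
      (\<forall>p\<in>{..k} \<times> UNIV. \<forall>\<omega>\<in>space unit_space. convergent (\<lambda>j. f p (N j \<omega>) \<omega>))"
      by (rule measurable_convergent_subsequence[where B = "max B 1"]) (simp, rule f_meas, rule f_b)
    then show thesis unfolding space_unit_space using that by blast
  qed
  define Y where "Y i \<omega> = (\<chi> l. lim (\<lambda>j. f (i, l) (N j \<omega>) \<omega>))" for i \<omega>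
  have Y_meas: "Y i \<in> borel_measurable unit_space" for i
    unfolding Y_def
    by (intro borel_measurable_vec_lambda borel_measurable_lim_metric measurable_compose_countable[OF f_meas N_meas])
  have Y_lim: "(\<lambda>j. V (a (N j \<omega>) \<omega>) i) \<longlonglongrightarrow> Y i \<omega>" if "\<omega> \<in> {0..<1}" "i \<le> k" for i \<omega>
  proof (rule vec_tendstoI)
    fix l
    have "(\<lambda>j. f (i, l) (N j \<omega>) \<omega>) \<longlonglongrightarrow> lim (\<lambda>j. f (i, l) (N j \<omega>) \<omega>)"
      using N_conv[of "(i, l)" \<omega>] that by (simp add: convergent_LIMSEQ_iff)
    then show "(\<lambda>j. V (a (N j \<omega>) \<omega>) i $ l) \<longlonglongrightarrow> Y i \<omega> $ l" by (simp add: f_def Y_def)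
  qed
  have Y_E: "Y 0 \<omega> + (\<Sum>i = 1..k. r i *\<^sub>R Y i \<omega>) \<in> E"
    if \<omega>: "\<omega> \<in> {0..<1}" and r: "\<And>i. i \<in> {1..k} \<Longrightarrow> r i \<in> {0..1}" for \<omega> and r :: "nat \<Rightarrow> real"
  proof (rule closed_sequentially[OF compact_imp_closed[OF E]])
    show "(\<lambda>j. V (a (N j \<omega>) \<omega>) 0 + (\<Sum>i = 1..k. r i *\<^sub>R V (a (N j \<omega>) \<omega>) i)) \<longlonglongrightarrow> Y 0 \<omega> + (\<Sum>i = 1..k. r i *\<^sub>R Y i \<omega>)"
      by (intro tendsto_intros Y_lim[OF \<omega>]) auto
    fix j
    have "(\<Sum>i = 1..k. r i *\<^sub>R V (a (N j \<omega>) \<omega>) i) = (\<Sum>i = 1..k. r i *\<^sub>R x (a (N j \<omega>) \<omega>) i)"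
      by (intro sum.cong) (auto simp: V_def)
    then show "V (a (N j \<omega>) \<omega>) 0 + (\<Sum>i = 1..k. r i *\<^sub>R V (a (N j \<omega>) \<omega>) i) \<in> E"
      using T[of "a (N j \<omega>) \<omega>" r] a_in[OF \<omega>, of "N j \<omega>"] \<Gamma>' r by (auto simp: V_def)
  qed
  define d where "d = real CARD('n)"
  \<comment> \<open>\<open>d * M\<close> bounds the norms of the graph vectors, \<open>k\<close> comes from expanding them in the basis, and \<open>2\<close> from replacing the limiting edges by approximating ones\<close>
  define C1 where "C1 = 2 * real k * d * M"
  have C1: "0 \<le> C1" using M by (simp add: C1_def d_def)
  have Iu: "I \<noteq> UNIV" using I k by auto
  have cI: "card (- I) = CARD('n) - k" by (simp add: Compl_eq_Diff_UNIV card_Diff_subset I)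
  define S where "S n \<xi> = {A. (\<forall>i\<in>I. \<forall>l\<in>- I. \<bar>A i l\<bar> \<le> M) \<and>
     (\<forall>i\<in>I. \<bar>\<xi> \<bullet> graph_vec I A i\<bar> \<le> C1 * norm \<xi> / 2 ^ n)}" for n and \<xi> :: "real ^ 'n"
  obtain C' where C': "0 \<le> C'" and count: "\<And>n \<xi>. \<xi> \<noteq> 0 \<Longrightarrow> finite (grid_cell I M n ` S n \<xi>) \<and>
     real (card (grid_cell I M n ` S n \<xi>)) \<le> C' * 2 ^ (n * (k * (CARD('n) - k - 1)))"
    using card_slab_cells[OF M C1 Iu] unfolding S_def[symmetric] I cI by blast
  define K where "K = C' * C * 2 powr \<beta> + 1"
  have K: "0 < K" using C' C by (simp add: K_def add_nonneg_pos)
  have prob: "measure unit_space {\<omega>\<in>{0..<1}. \<forall>i\<in>{1..k}. \<bar>\<xi> \<bullet> Y i \<omega>\<bar> \<le> \<eta>} \<le> K * (\<eta> / norm \<xi>) powr \<beta>"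
    if \<xi>: "\<xi> \<noteq> 0" and \<eta>: "0 < \<eta>" for \<xi> \<eta>
  proof (cases "\<eta> \<le> norm \<xi>")
    case False
    then have "1 \<le> (\<eta> / norm \<xi>) powr \<beta>" using \<xi> \<beta> by (intro ge_one_powr_ge_zero) auto
    moreover have "1 \<le> K" using C' C by (simp add: K_def)
    ultimately have "1 * 1 \<le> K * (\<eta> / norm \<xi>) powr \<beta>" by (intro mult_mono) auto
    then show ?thesis using prob_le_1 by (smt (verit))
  next
    case True
    let ?q = "\<eta> / norm \<xi>"
    have q: "0 < ?q" "?q \<le> 1" using True \<xi> \<eta> by auto
    obtain n :: nat where n: "?q \<le> 1 / 2 ^ n" "1 / 2 ^ n < 2 * ?q" using dyadic_scale[OF q] by auto
    let ?ev = "{\<omega>\<in>{0..<1}. \<forall>i\<in>{1..k}. \<bar>\<xi> \<bullet> Y i \<omega>\<bar> \<le> \<eta>}" and ?cell = "\<lambda>j. {\<omega>\<in>{0..<1}. code n (a n \<omega>) = j}"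
    define Bad where "Bad = {s\<in>\<Gamma>'. A s \<in> S n \<xi>}"
    have codeBad: "finite (code n ` Bad) \<and> card (code n ` Bad) \<le> card (grid_cell I M n ` S n \<xi>)"
    proof -
      let ?g = "\<lambda>s. grid_cell I M n (A s)"
      have sub: "?g ` Bad \<subseteq> grid_cell I M n ` S n \<xi>" by (auto simp: Bad_def)
      then have fin: "finite (?g ` Bad)" using count[OF \<xi>] finite_subset by blast
      define \<phi> where "\<phi> z = code n (SOME s. s \<in> Bad \<and> ?g s = z)" for z
      have "code n s = \<phi> (?g s)" if "s \<in> Bad" for s
      proof -
        have "(SOME s'. s' \<in> Bad \<and> ?g s' = ?g s) \<in> Bad \<and> ?g (SOME s'. s' \<in> Bad \<and> ?g s' = ?g s) = ?g s"
          by (rule someI[of _ s]) (use that in simp)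
        then show ?thesis unfolding \<phi>_def using code[of s] that by (auto simp: Bad_def)
      qed
      then have eq: "code n ` Bad = \<phi> ` (?g ` Bad)" by (auto simp: image_image)
      then have "card (code n ` Bad) \<le> card (?g ` Bad)" using card_image_le[OF fin] by simp
      also have "\<dots> \<le> card (grid_cell I M n ` S n \<xi>)" using sub count[OF \<xi>] card_mono by blast
      finally show ?thesis using fin eq by simp
    qed
    have sub: "?ev \<subseteq> (\<Union>j\<in>code n ` Bad. ?cell j)"
    proof
      fix \<omega> assume "\<omega> \<in> ?ev"
      then have \<omega>: "\<omega> \<in> {0..<1}" and le: "\<And>i. i \<in> {1..k} \<Longrightarrow> \<bar>\<xi> \<bullet> Y i \<omega>\<bar> \<le> \<eta>" by auto
      have "\<forall>\<^sub>F j in sequentially. \<bar>\<xi> \<bullet> V (a (N j \<omega>) \<omega>) i\<bar> < 2 * \<eta>" if "i \<in> {1..k}" for i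
      proof (rule order_tendstoD(2))
        show "(\<lambda>j. \<bar>\<xi> \<bullet> V (a (N j \<omega>) \<omega>) i\<bar>) \<longlonglongrightarrow> \<bar>\<xi> \<bullet> Y i \<omega>\<bar>"
          using that by (intro tendsto_intros Y_lim[OF \<omega>]) auto
        show "\<bar>\<xi> \<bullet> Y i \<omega>\<bar> < 2 * \<eta>" using le[OF that] \<eta> by simp
      qed
      then have "\<forall>\<^sub>F j in sequentially. \<forall>i\<in>{1..k}. \<bar>\<xi> \<bullet> V (a (N j \<omega>) \<omega>) i\<bar> < 2 * \<eta>"
        by (intro eventually_ball_finite) auto
      then obtain j0 where j0: "\<And>j. j \<ge> j0 \<Longrightarrow> \<forall>i\<in>{1..k}. \<bar>\<xi> \<bullet> V (a (N j \<omega>) \<omega>) i\<bar> < 2 * \<eta>"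
        by (auto simp: eventually_sequentially)
      define m where "m = N (max j0 n) \<omega>"
      have mn: "n \<le> m" using seq_suble[OF N_mono[OF \<omega>], of "max j0 n"] by (simp add: m_def)
      define s where "s = a m \<omega>"
      have s: "s \<in> \<Gamma>'" unfolding s_def by (rule a_in[OF \<omega>])
      have sx: "\<bar>\<xi> \<bullet> x s i\<bar> \<le> 2 * \<eta>" if "i \<in> {1..k}" for i
        using j0[of "max j0 n"] that by (auto simp: s_def m_def V_def less_imp_le)
      have "\<bar>\<xi> \<bullet> graph_vec I (A s) i\<bar> \<le> C1 * norm \<xi> / 2 ^ n" if i: "i \<in> I" for i
      proof -
        let ?v = "graph_vec I (A s) i"
        have "norm ?v \<le> (\<Sum>l\<in>UNIV. \<bar>?v $ l\<bar>)" by (rule norm_le_l1_cart)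
        also have "\<dots> \<le> (\<Sum>l\<in>(UNIV::'n set). M)"
          using AM[OF s i] M by (intro sum_mono) (auto simp: graph_vec_def)
        finally have nv: "norm ?v \<le> d * M" by (simp add: d_def)
        have "?v \<in> s" using A[OF s] i span_base[of ?v "graph_vec I (A s) ` I"] by auto
        then have "\<bar>\<xi> \<bullet> ?v\<bar> \<le> real k * (norm ?v * (2 * \<eta>))"
          using x[of s] s \<Gamma>'g sx by (intro inner_le_orthonormal_basis[of k "x s" s]) auto
        also have "\<dots> \<le> real k * ((d * M) * (2 * \<eta>))"
          using nv \<eta> by (intro mult_left_mono mult_right_mono) auto
        also have "\<dots> = C1 * \<eta>" by (simp add: C1_def)
        also have "\<dots> \<le> C1 * (norm \<xi> / 2 ^ n)"
          using n(1) \<xi> C1 by (intro mult_left_mono) (auto simp: field_simps)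
        finally show ?thesis by simp
      qed
      then have "s \<in> Bad" using s AM[OF s] by (auto simp: Bad_def S_def)
      moreover have "code n (a n \<omega>) = code n s" unfolding s_def using a_code[OF \<omega> mn] by simp
      ultimately show "\<omega> \<in> (\<Union>j\<in>code n ` Bad. ?cell j)" using \<omega> by (auto intro!: bexI[of _ s])
    qed
    have sets: "?cell j \<in> sets unit_space" for j
    proof -
      have "(\<lambda>\<omega>. code n (a n \<omega>)) \<in> measurable unit_space (count_space UNIV)"
        by (rule measurable_compose[OF a_meas]) simp
      from measurable_sets[OF this, of "{j}"] show ?thesis
        by (simp add: vimage_def Int_def conj_commute)
    qed
    have "measure unit_space ?ev
        \<le> measure unit_space (\<Union>j\<in>code n ` Bad. ?cell j)"
      using codeBad sets by (intro finite_measure_mono sub sets.finite_UN) auto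
    also have "\<dots> \<le> (\<Sum>j\<in>code n ` Bad. measure unit_space (?cell j))"
      using codeBad sets by (intro measure_UNION_le) auto
    also have "\<dots> \<le> (\<Sum>j\<in>code n ` Bad. C * 2 powr (- real n * \<alpha>))" by (intro sum_mono a_prob)
    also have "\<dots> = real (card (code n ` Bad)) * (C * 2 powr (- real n * \<alpha>))" by simp
    also have "\<dots> \<le> (C' * 2 ^ (n * (k * (CARD('n) - k - 1)))) * (C * 2 powr (- real n * \<alpha>))"
    proof (rule mult_right_mono)
      have "real (card (code n ` Bad)) \<le> real (card (grid_cell I M n ` S n \<xi>))" using codeBad by simp
      then show "real (card (code n ` Bad)) \<le> C' * 2 ^ (n * (k * (CARD('n) - k - 1)))"
        using count[OF \<xi>, of n] by linarith
    qed (use C in simp)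
    also have "\<dots> = C' * C * (1 / 2 ^ n) powr \<beta>"
    proof -
      have e: "real (n * (k * (CARD('n) - k - 1))) = real n * (real k * (real CARD('n) - 1 - real k))"
        using k by (simp add: of_nat_diff)
      have "2 ^ (n * (k * (CARD('n) - k - 1))) * 2 powr (- real n * \<alpha>)
          = 2 powr (real (n * (k * (CARD('n) - k - 1)))) * 2 powr (- real n * \<alpha>)"
        by (simp only: powr_realpow[of 2, simplified])
      also have "\<dots> = 2 powr (- real n * \<beta>)"
        unfolding powr_add[symmetric] e \<alpha>_def by (simp add: algebra_simps)
      also have "\<dots> = (1 / 2 ^ n) powr \<beta>"
        by (rule inverse_power_two_powr[symmetric])
      finally show ?thesis by (simp add: mult.commute mult.left_commute)
    qed
    also have "\<dots> \<le> C' * C * (2 * ?q) powr \<beta>"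
      using C' C n(2) \<beta> by (intro mult_left_mono powr_mono2) auto
    also have "\<dots> = (C' * C * 2 powr \<beta>) * ?q powr \<beta>"
      using powr_mult[of 2 ?q \<beta>] q by simp
    also have "\<dots> \<le> K * ?q powr \<beta>" by (intro mult_right_mono) (auto simp: K_def)
    finally show ?thesis .
  qed
  show ?thesis
    by (rule that[of K Y, OF K Y_meas Y_E prob])
qed

section \<open>Fourier transforms of probability measures\<close>

abbreviation phase :: "real \<Rightarrow> complex" where
  "phase t \<equiv> exp (- 2 * of_real pi * \<i> * of_real t)"

text \<open>The Fourier transform of the uniform distribution on the unit interval.\<close>

definition unit_phase_mean :: "real \<Rightarrow> complex" where
  "unit_phase_mean \<tau> = (\<integral>r. phase (\<tau> * r) \<partial>uniform_measure lborel {0..1})"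

lemma prob_uniform01: "prob_space (uniform_measure lborel {0..1::real})"
  by (rule prob_space_uniform_measure) auto

lemma uniform01_integral:
  fixes f :: "real \<Rightarrow> complex"
  assumes "continuous_on UNIV f"
  shows "(\<integral>r. f r \<partial>uniform_measure lborel {0..1}) = (LBINT r:{0..1}. f r)"
proof -
  have [measurable]: "f \<in> borel_measurable borel" using assms by (rule borel_measurable_continuous_onI)
  show ?thesis
    unfolding uniform_measure_def set_lebesgue_integral_def
    by (subst integral_density[of f lborel "indicator {0..1::real}", symmetric]) (auto simp: ennreal_indicator divide_ennreal_def)
qed

lemma unit_phase_mean_eq:
  assumes "\<tau> \<noteq> 0"
  shows "unit_phase_mean \<tau> = (1 - phase \<tau>) / (2 * of_real pi * \<i> * of_real \<tau>)"
proof -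
  define c :: complex where "c = - 2 * of_real pi * \<i> * of_real \<tau>"
  have c: "c \<noteq> 0" using assms by (simp add: c_def)
  have cont: "continuous_on S (\<lambda>r::real. exp (c * of_real r))" for S
    by (intro continuous_intros)
  have "unit_phase_mean \<tau> = (\<integral>r. exp (c * of_real r) \<partial>uniform_measure lborel {0..1})"
    unfolding unit_phase_mean_def c_def by (simp only: of_real_mult mult.assoc)
  also have "\<dots> = (LBINT r:{0..1}. exp (c * of_real r))"
    by (rule uniform01_integral[OF cont])
  also have "\<dots> = integral {0..1} (\<lambda>r. exp (c * of_real r))"
    by (intro set_borel_integral_eq_integral borel_integrable_atLeastAtMost' cont)
  also have "\<dots> = exp (c * of_real 1) / c - exp (c * of_real 0) / c"
  proof (rule integral_unique, rule fundamental_theorem_of_calculus)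
    fix r :: real
    have "((\<lambda>z. exp (c * z) / c) has_field_derivative exp (c * of_real r)) (at (of_real r))"
      using c by (auto intro!: derivative_eq_intros)
    then show "((\<lambda>r. exp (c * of_real r) / c) has_vector_derivative exp (c * of_real r)) (at r within {0..1})"
      by (rule has_vector_derivative_real_field)
  qed simp
  also have "\<dots> = (1 - exp c) / (- c)"
    using c by (simp add: field_simps)
  finally show ?thesis unfolding c_def by simp
qed

lemma norm_phase [simp]: "norm (phase t) = 1"
  by (simp add: norm_exp_eq_Re)

lemma norm_unit_phase_mean_le_1: "norm (unit_phase_mean \<tau>) \<le> 1"
proof -
  interpret prob_space "uniform_measure lborel {0..1::real}" by (rule prob_uniform01)
  have "norm (unit_phase_mean \<tau>) \<le> (\<integral>r. norm (phase (\<tau> * r)) \<partial>uniform_measure lborel {0..1})"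
    unfolding unit_phase_mean_def by (rule integral_norm_bound)
  also have "\<dots> = 1" unfolding norm_phase using prob_space by simp
  finally show ?thesis .
qed

lemma norm_unit_phase_mean_decay:
  assumes "\<tau> \<noteq> 0"
  shows "norm (unit_phase_mean \<tau>) \<le> 1 / \<bar>\<tau>\<bar>"
proof -
  have "norm (unit_phase_mean \<tau>) = norm (1 - phase \<tau>) / (2 * pi * \<bar>\<tau>\<bar>)"
    unfolding unit_phase_mean_eq[OF assms] by (simp add: norm_divide norm_mult)
  also have "\<dots> \<le> 2 / (2 * pi * \<bar>\<tau>\<bar>)"
    using norm_triangle_ineq4[of 1 "phase \<tau>"]
    by (intro divide_right_mono) (auto simp del: )
  also have "\<dots> = (1 / pi) * (1 / \<bar>\<tau>\<bar>)" by simp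
  also have "\<dots> \<le> 1 * (1 / \<bar>\<tau>\<bar>)"
    using pi_gt3 by (intro mult_right_mono) auto
  finally show ?thesis by simp
qed

lemma unit_phase_mean_near_1:
  assumes "\<bar>\<tau>\<bar> \<le> 1 / 16"
  shows "norm (unit_phase_mean \<tau>) \<ge> 1 / 2"
proof -
  interpret prob_space "uniform_measure lborel {0..1::real}" by (rule prob_uniform01)
  let ?f = "\<lambda>r. phase (\<tau> * r) :: complex"
  have m [measurable]: "?f \<in> borel_measurable borel"
    by (intro borel_measurable_continuous_onI continuous_intros)
  have int: "integrable (uniform_measure lborel {0..1}) ?f"
  proof (rule integrable_const_bound[of _ 1])
    show "AE x in uniform_measure lborel {0..1}. norm (?f x) \<le> 1" unfolding norm_phase by simp
    show "?f \<in> borel_measurable (uniform_measure lborel {0..1})" by measurable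
  qed
  have int1: "integrable (uniform_measure lborel {0..1}) (\<lambda>r. norm (1 - ?f r))"
    by (intro Bochner_Integration.integrable_norm Bochner_Integration.integrable_diff int integrable_const)
  have "1 - unit_phase_mean \<tau> = (\<integral>r. 1 - ?f r \<partial>uniform_measure lborel {0..1})"
    unfolding unit_phase_mean_def using int prob_space by (subst Bochner_Integration.integral_diff) auto
  also have "norm \<dots> \<le> (\<integral>r. norm (1 - ?f r) \<partial>uniform_measure lborel {0..1})"
    by (rule integral_norm_bound)
  also have "(\<integral>r. norm (1 - ?f r) \<partial>uniform_measure lborel {0..1}) \<le> (\<integral>r. 1 / 2 \<partial>uniform_measure lborel {0..1::real})"
  proof (rule integral_mono_AE)
    show "AE r in uniform_measure lborel {0..1}. norm (1 - ?f r) \<le> 1 / 2"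
    proof (rule AE_uniform_measureI)
      show "AE r in lborel. r \<in> {0..1} \<longrightarrow> norm (1 - ?f r) \<le> 1 / 2"
      proof (intro AE_I2 impI)
        fix r :: real assume r: "r \<in> {0..1}"
        have "norm (1 - ?f r) = norm (iexp (- 2 * pi * (\<tau> * r)) - (\<Sum>k\<le>0. (\<i> * of_real (- 2 * pi * (\<tau> * r))) ^ k / fact k))"
          by (simp add: norm_minus_commute mult_ac)
        also have "\<dots> \<le> \<bar>- 2 * pi * (\<tau> * r)\<bar> ^ Suc 0 / fact (Suc 0)"
          by (rule iexp_approx1)
        also have "\<dots> = 2 * (pi * (\<bar>\<tau>\<bar> * r))" using r by (simp add: abs_mult)
        also have "\<dots> \<le> 2 * (4 * (1 / 16 * 1))" using r assms pi_less_4 by (intro mult_mono) auto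
        finally show "norm (1 - ?f r) \<le> 1 / 2" by simp
      qed
    qed simp
  qed (rule int1, rule integrable_const)
  also have "\<dots> = 1 / 2" using prob_space by simp
  finally have "norm (1 - unit_phase_mean \<tau>) \<le> 1 / 2" .
  then show ?thesis using norm_triangle_ineq2[of 1 "1 - unit_phase_mean \<tau>"] by simp
qed

lemma phase_add: "phase (s + t) = phase s * phase t"
  by (simp add: exp_add[symmetric] algebra_simps)

lemma phase_sum: "finite A \<Longrightarrow> phase (\<Sum>i\<in>A. f i) = (\<Prod>i\<in>A. phase (f i))"
proof (induction A rule: finite_induct)
  case (insert a A) then show ?case by (simp only: sum.insert prod.insert phase_add simp_thms)
qed simp

lemma phase_uminus: "phase (- t) = cnj (phase t)"
  by (simp add: exp_cnj)

lemma borel_measurable_phase [measurable]: "phase \<in> borel_measurable borel"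
  by (intro borel_measurable_continuous_onI continuous_intros)

lemma (in finite_measure) integrable_phase:
  assumes "f \<in> borel_measurable M"
  shows "integrable M (\<lambda>x. phase (f x))"
proof (rule integrable_const_bound[of _ 1])
  show "AE x in M. norm (phase (f x)) \<le> 1" unfolding norm_phase by simp
  show "(\<lambda>x. phase (f x)) \<in> borel_measurable M"
    using measurable_compose[OF assms borel_measurable_phase] by simp
qed

lemma fourier_transform_phase: "fourier_transform \<mu> \<xi> = (\<integral>x. phase (\<xi> \<bullet> x) \<partial>\<mu>)"
  by (simp add: fourier_transform_def)

lemma borel_measurable_inner_const [measurable]:
  fixes \<xi> :: "'a::euclidean_space"
  shows "(\<lambda>x. \<xi> \<bullet> x) \<in> borel_measurable borel"
  by (intro borel_measurable_continuous_onI continuous_intros)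

lemma norm_fourier_transform_le_1:
  fixes \<mu> :: "(real ^ 'n) measure"
  assumes "prob_space \<mu>"
  shows "norm (fourier_transform \<mu> \<xi>) \<le> 1"
proof -
  interpret prob_space \<mu> by fact
  have "norm (fourier_transform \<mu> \<xi>) \<le> (\<integral>x. norm (phase (\<xi> \<bullet> x)) \<partial>\<mu>)"
    unfolding fourier_transform_phase by (rule integral_norm_bound)
  also have "\<dots> = 1" unfolding norm_phase using prob_space by simp
  finally show ?thesis .
qed

lemma phase_pair_measurable:
  assumes [measurable_cong]: "sets \<mu> = sets (borel :: (real ^ 'n) measure)" "sets \<nu> = sets (borel :: (real ^ 'n) measure)"
  shows "(\<lambda>(x, y). phase (x \<bullet> y)) \<in> borel_measurable (\<mu> \<Otimes>\<^sub>M \<nu>)"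
proof -
  have "(\<lambda>p. fst p \<bullet> snd p) \<in> borel_measurable (\<mu> \<Otimes>\<^sub>M \<nu>)" by measurable
  from measurable_compose[OF this borel_measurable_phase] show ?thesis by (simp add: case_prod_beta)
qed

lemma fourier_transform_measurable:
  fixes \<mu> :: "(real ^ 'n) measure"
  assumes \<mu>: "prob_space \<mu>" "sets \<mu> = sets borel"
  shows "fourier_transform \<mu> \<in> borel_measurable borel"
proof -
  interpret prob_space \<mu> by fact
  have "case_prod (\<lambda>\<xi> x. phase (\<xi> \<bullet> x)) \<in> borel_measurable (borel \<Otimes>\<^sub>M \<mu>)"
    using phase_pair_measurable[of borel \<mu>, OF refl \<mu>(2)] .
  from borel_measurable_lebesgue_integral[OF this] show ?thesis
    unfolding fourier_transform_phase[abs_def] .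
qed

text \<open>Fubini's theorem for the symmetric kernel \<open>phase (x \<bullet> y)\<close>. It takes the place of Plancherel's theorem
  below.\<close>

lemma fourier_transform_duality:
  fixes \<mu> \<nu> :: "(real ^ 'n) measure"
  assumes \<mu>: "prob_space \<mu>" "sets \<mu> = sets borel" and \<nu>: "prob_space \<nu>" "sets \<nu> = sets borel"
  shows "(\<integral>\<xi>. fourier_transform \<mu> \<xi> \<partial>\<nu>) = (\<integral>x. fourier_transform \<nu> x \<partial>\<mu>)"
proof -
  interpret \<mu>: prob_space \<mu> by fact
  interpret \<nu>: prob_space \<nu> by fact
  interpret P: pair_prob_space \<nu> \<mu> by standard
  have "integrable (\<nu> \<Otimes>\<^sub>M \<mu>) (\<lambda>(\<xi>, x). phase (\<xi> \<bullet> x))"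
  proof (rule P.integrable_const_bound[of _ 1])
    show "AE z in \<nu> \<Otimes>\<^sub>M \<mu>. norm (case z of (\<xi>, x) \<Rightarrow> phase (\<xi> \<bullet> x)) \<le> 1"
      unfolding case_prod_beta norm_phase by simp
    show "(\<lambda>(\<xi>, x). phase (\<xi> \<bullet> x)) \<in> borel_measurable (\<nu> \<Otimes>\<^sub>M \<mu>)"
      by (rule phase_pair_measurable[OF \<nu>(2) \<mu>(2)])
  qed
  from P.Fubini_integral[OF this] show ?thesis
    unfolding fourier_transform_phase by (simp add: inner_commute)
qed

definition difference_law :: "(real ^ 'n) measure \<Rightarrow> (real ^ 'n) measure" where
  "difference_law \<mu> = distr (\<mu> \<Otimes>\<^sub>M \<mu>) borel (\<lambda>(x, y). x - y)"

lemma difference_measurable: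
  assumes [measurable_cong]: "sets \<mu> = sets (borel :: (real ^ 'n) measure)"
  shows "(\<lambda>(x, y). x - y) \<in> measurable (\<mu> \<Otimes>\<^sub>M \<mu>) (borel :: (real ^ 'n) measure)"
  by measurable

lemma difference_law_prob:
  assumes "prob_space \<mu>" "sets \<mu> = sets (borel :: (real ^ 'n) measure)"
  shows "prob_space (difference_law \<mu>)" "sets (difference_law \<mu>) = sets borel"
proof -
  interpret prob_space \<mu> by fact
  interpret P: pair_prob_space \<mu> \<mu> by standard
  show "prob_space (difference_law \<mu>)"
    unfolding difference_law_def by (rule P.prob_space_distr[OF difference_measurable[OF assms(2)]])
qed (simp add: difference_law_def)

lemma fourier_transform_difference_law:
  fixes \<mu> :: "(real ^ 'n) measure"
  assumes \<mu>: "prob_space \<mu>" "sets \<mu> = sets borel"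
  shows "fourier_transform (difference_law \<mu>) \<xi> = of_real ((norm (fourier_transform \<mu> \<xi>))\<^sup>2)"
proof -
  interpret prob_space \<mu> by fact
  interpret P: pair_prob_space \<mu> \<mu> by standard
  note [measurable_cong] = \<mu>(2)
  have m: "(\<lambda>p. \<xi> \<bullet> (case p of (x, y) \<Rightarrow> x - y)) \<in> borel_measurable (\<mu> \<Otimes>\<^sub>M \<mu>)"
    using measurable_compose[OF difference_measurable[OF \<mu>(2)] borel_measurable_inner_const[of \<xi>]] .
  have "fourier_transform (difference_law \<mu>) \<xi> = (\<integral>p. phase (\<xi> \<bullet> (case p of (x, y) \<Rightarrow> x - y)) \<partial>(\<mu> \<Otimes>\<^sub>M \<mu>))"
    unfolding fourier_transform_phase difference_law_def
    by (subst integral_distr[OF difference_measurable[OF \<mu>(2)]])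
       (auto intro: measurable_compose[OF borel_measurable_inner_const borel_measurable_phase])
  also have "\<dots> = (\<integral>x. \<integral>y. phase (\<xi> \<bullet> (x - y)) \<partial>\<mu> \<partial>\<mu>)"
    using P.integral_fst'[OF P.integrable_phase[OF m]] by simp
  also have "\<dots> = (\<integral>x. phase (\<xi> \<bullet> x) * (\<integral>y. phase (- (\<xi> \<bullet> y)) \<partial>\<mu>) \<partial>\<mu>)"
  proof (rule Bochner_Integration.integral_cong[OF refl])
    fix x
    have "(\<integral>y. phase (\<xi> \<bullet> (x - y)) \<partial>\<mu>) = (\<integral>y. phase (\<xi> \<bullet> x) * phase (- (\<xi> \<bullet> y)) \<partial>\<mu>)"
    proof -
      have "\<xi> \<bullet> (x - y) = \<xi> \<bullet> x + (- (\<xi> \<bullet> y))" for y by (simp add: inner_diff_right)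
      then show ?thesis by (simp only: phase_add)
    qed
    then show "(\<integral>y. phase (\<xi> \<bullet> (x - y)) \<partial>\<mu>) = phase (\<xi> \<bullet> x) * (\<integral>y. phase (- (\<xi> \<bullet> y)) \<partial>\<mu>)" by (simp only: integral_mult_right_zero)
  qed
  also have "\<dots> = fourier_transform \<mu> \<xi> * (\<integral>y. phase (- (\<xi> \<bullet> y)) \<partial>\<mu>)"
    unfolding fourier_transform_phase by (simp only: integral_mult_left_zero)
  also have "(\<integral>y. phase (- (\<xi> \<bullet> y)) \<partial>\<mu>) = cnj (fourier_transform \<mu> \<xi>)"
    unfolding fourier_transform_phase phase_uminus by (rule Bochner_Integration.integral_cnj)
  finally show ?thesis by (simp only: complex_norm_square)
qed

text \<open>The uniform distribution on the unit cube, with the indicator written as a product so that integrals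
  factor over the coordinates.\<close>

definition cube_law :: "(real ^ 'n) measure" where
  "cube_law = density lborel (\<lambda>v. \<Prod>b\<in>Basis. indicator {0..1} (v \<bullet> b))"

lemma cube_density_measurable [measurable]:
  "(\<lambda>v :: real ^ 'n. \<Prod>b\<in>Basis. indicator {0..1} (v \<bullet> b) :: ennreal) \<in> borel_measurable borel"
  by measurable

lemma cube_law_prob: "prob_space cube_law" "sets cube_law = sets borel"
proof -
  show "prob_space (cube_law :: (real ^ 'n) measure)"
  proof (rule prob_spaceI)
    have "emeasure (cube_law :: (real ^ 'n) measure) (space cube_law) = (\<integral>\<^sup>+v. (\<Prod>b\<in>(Basis :: (real ^ 'n) set). indicator {0..1} (v \<bullet> b)) \<partial>lborel)"
      unfolding cube_law_def by (subst emeasure_density) auto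
    also have "\<dots> = (\<Prod>b\<in>(Basis :: (real ^ 'n) set). \<integral>\<^sup>+t. indicator {0..1::real} t \<partial>lborel)"
      by (rule nn_integral_lborel_prod) auto
    also have "\<dots> = 1" by simp
    finally show "emeasure (cube_law :: (real ^ 'n) measure) (space cube_law) = 1" .
  qed
qed (simp add: cube_law_def)

lemma fourier_transform_cube_law:
  fixes z :: "real ^ 'n"
  shows "fourier_transform cube_law z = (\<Prod>b\<in>Basis. unit_phase_mean (z \<bullet> b))"
proof -
  interpret product_sigma_finite "\<lambda>b::real ^ 'n. lborel :: real measure" by standard
  have m: "(\<lambda>t. indicator {0..1} t *\<^sub>R phase (c * t)) \<in> borel_measurable borel" for c :: real
  proof -
    have "(\<lambda>t. phase (c * t)) \<in> borel_measurable borel"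
      by (rule measurable_compose[OF _ borel_measurable_phase]) simp
    then show ?thesis by measurable
  qed
  have int: "integrable lborel (\<lambda>t. indicator {0..1} t *\<^sub>R phase (c * t))" for c :: real
  proof -
    have "set_integrable lborel {0..1} (\<lambda>t. phase (c * t))"
      by (intro borel_integrable_atLeastAtMost' continuous_intros)
    then show ?thesis by (simp only: set_integrable_def)
  qed
  have one: "(\<integral>t. indicator {0..1} t *\<^sub>R phase (c * t) \<partial>lborel) = unit_phase_mean c" for c :: real
  proof -
    have "unit_phase_mean c = (LBINT r:{0..1}. phase (c * r))"
      unfolding unit_phase_mean_def by (intro uniform01_integral continuous_intros)
    then show ?thesis by (simp only: set_lebesgue_integral_def)
  qed
  let ?f = "\<lambda>v :: real ^ 'n. \<Prod>b\<in>Basis. indicator {0..1} (v \<bullet> b) *\<^sub>R phase ((z \<bullet> b) * (v \<bullet> b))"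
  have fm: "?f \<in> borel_measurable borel"
    by (intro borel_measurable_prod measurable_compose[OF _ m]) auto
  have pm: "(\<lambda>v. phase (z \<bullet> v)) \<in> borel_measurable lborel"
    using measurable_compose[OF borel_measurable_inner_const[of z] borel_measurable_phase] by simp
  have dens: "cube_law = density lborel (\<lambda>v. ennreal (\<Prod>b\<in>(Basis :: (real ^ 'n) set). indicator {0..1} (v \<bullet> b)))"
    unfolding cube_law_def by (intro density_cong) (auto simp: prod_ennreal[symmetric] ennreal_indicator)
  have "fourier_transform cube_law z = (\<integral>v. (\<Prod>b\<in>(Basis :: (real ^ 'n) set). indicator {0..1} (v \<bullet> b)) *\<^sub>R phase (z \<bullet> v) \<partial>lborel)"
    unfolding fourier_transform_phase dens
    by (rule integral_density[OF pm]) (auto intro!: prod_nonneg)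
  also have "\<dots> = (\<integral>v. ?f v \<partial>lborel)"
  proof (rule Bochner_Integration.integral_cong[OF refl])
    fix v
    have "phase (z \<bullet> v) = (\<Prod>b\<in>Basis. phase ((z \<bullet> b) * (v \<bullet> b)))"
      unfolding euclidean_inner[of z v] by (rule phase_sum) simp
    then show "(\<Prod>b\<in>(Basis :: (real ^ 'n) set). indicator {0..1} (v \<bullet> b)) *\<^sub>R phase (z \<bullet> v) = ?f v"
      by (simp only: scaleR_conv_of_real of_real_prod prod.distrib)
  qed
  also have "\<dots> = (\<integral>g. ?f (\<Sum>b\<in>Basis. g b *\<^sub>R b) \<partial>Pi\<^sub>M Basis (\<lambda>_. lborel))"
    by (subst lborel_eq, subst integral_distr) (use fm in auto)
  also have "\<dots> = (\<integral>g. (\<Prod>b\<in>Basis. indicator {0..1} (g b) *\<^sub>R phase ((z \<bullet> b) * g b)) \<partial>Pi\<^sub>M (Basis :: (real ^ 'n) set) (\<lambda>_. lborel))"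
    by (intro Bochner_Integration.integral_cong refl prod.cong) (simp only: inner_sum_left_Basis)
  also have "\<dots> = (\<Prod>b\<in>Basis. \<integral>t. indicator {0..1} t *\<^sub>R phase ((z \<bullet> b) * t) \<partial>lborel)"
    by (rule product_integral_prod[OF finite_Basis int])
  finally show ?thesis by (simp only: one)
qed

section \<open>Fourier decay of random parallelepipeds\<close>

text \<open>Layer-cake estimate over the dyadic shells \<open>2\<^bsup>m-1\<^esup> < T \<le> 2\<^bsup>m\<^esup>\<close>: the decay of \<open>f\<close> beats the
  growth of the mass by the factor \<open>2\<^bsup>\<beta>-N\<^esup>\<close> per shell. It serves both to average the decay of a single
  cube over a random frame and to integrate a power of \<open>norm \<xi>\<close> over the whole space.\<close>

lemma dyadic_layer_bound:
  fixes T :: "'a \<Rightarrow> real" and f :: "'a \<Rightarrow> ennreal"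
  assumes [measurable]: "T \<in> borel_measurable M"
    and N: "\<beta> < N" "0 < N" and L: "0 \<le> L"
    and f: "\<And>x. x \<in> space M \<Longrightarrow> f x \<le> 1"
    and fT: "\<And>x. x \<in> space M \<Longrightarrow> T x > 0 \<Longrightarrow> f x \<le> ennreal (L * T x powr (- N))"
    and K: "0 \<le> K" and mass: "\<And>m::nat. emeasure M {x\<in>space M. T x \<le> 2 ^ m} \<le> ennreal (K * (2 ^ m) powr \<beta>)"
  shows "(\<integral>\<^sup>+x. f x \<partial>M) \<le> ennreal (K * ((1 + L) * 2 powr N / (1 - 2 powr (\<beta> - N))))"
proof -
  define c where "c m = (1 + L) * 2 powr N * (2 ^ m) powr (- N)" for m :: nat
  have c0: "c m \<ge> 0" for m using L by (simp add: c_def)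
  have pt: "f x \<le> (\<Sum>m. ennreal (c m) * indicator {x\<in>space M. T x \<le> 2 ^ m} x)" if x: "x \<in> space M" for x
  proof -
    have "\<exists>m. f x \<le> ennreal (c m) \<and> T x \<le> 2 ^ m"
    proof (cases "T x \<le> 1")
      case True
      have "1 * 1 \<le> (1 + L) * 2 powr N" using L N by (intro mult_mono) (auto simp: ge_one_powr_ge_zero)
      then have "1 \<le> ennreal (c 0)" unfolding c_def by (simp)
      then show ?thesis using f[OF x] True by (intro exI[of _ 0]) (auto intro: order_trans)
    next
      case False
      obtain m0 :: nat where "T x < 2 ^ m0" using real_arch_pow[of 2 "T x"] by auto
      define m where "m = (LEAST m. T x \<le> 2 ^ m)"
      have m1: "T x \<le> 2 ^ m" unfolding m_def by (rule LeastI[of _ m0]) (use \<open>T x < 2 ^ m0\<close> in simp)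
      have "m \<noteq> 0" using m1 False by (metis power_0)
      then obtain l where l: "m = Suc l" by (cases m) auto
      have "\<not> T x \<le> 2 ^ l" using not_less_Least[of l "\<lambda>m. T x \<le> 2 ^ m"] l m_def by simp
      then have "2 ^ m / 2 \<le> T x" using l by simp
      then have "T x powr (- N) \<le> (2 ^ m / 2) powr (- N)"
        using N by (intro powr_mono2') auto
      also have "(2 ^ m / 2) powr (- N) = 2 powr N * (2 ^ m) powr (- N)"
        by (simp add: powr_divide powr_minus field_simps)
      finally have "L * T x powr (- N) \<le> c m"
        unfolding c_def using L by (simp add: mult.assoc mult_mono)
      then show ?thesis using m1 fT[OF x] False
        by (intro exI[of _ m]) (auto intro: order_trans ennreal_leI)
    qed
    then obtain m where m: "f x \<le> ennreal (c m)" "T x \<le> 2 ^ m" by auto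
    then have "f x \<le> ennreal (c m) * indicator {x\<in>space M. T x \<le> 2 ^ m} x" using x by simp
    also have "\<dots> \<le> (\<Sum>m. ennreal (c m) * indicator {x\<in>space M. T x \<le> 2 ^ m} x)"
      using sum_le_suminf[OF summableI, of "{m}" "\<lambda>m. ennreal (c m) * indicator {x\<in>space M. T x \<le> 2 ^ m} x"]
      by (simp del: sum_mult_indicator)
    finally show ?thesis .
  qed
  define q where "q = 2 powr (\<beta> - N)"
  have q: "0 \<le> q" "q < 1" unfolding q_def using N by (auto simp: powr_less_one)
  have "(\<integral>\<^sup>+x. f x \<partial>M) \<le> (\<integral>\<^sup>+x. (\<Sum>m. ennreal (c m) * indicator {x\<in>space M. T x \<le> 2 ^ m} x) \<partial>M)"
    by (rule nn_integral_mono) (rule pt)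
  also have "\<dots> = (\<Sum>m. \<integral>\<^sup>+x. ennreal (c m) * indicator {x\<in>space M. T x \<le> 2 ^ m} x \<partial>M)"
    by (rule nn_integral_suminf) measurable
  also have "\<dots> = (\<Sum>m. ennreal (c m) * emeasure M {x\<in>space M. T x \<le> 2 ^ m})"
    by (simp add: nn_integral_cmult_indicator)
  also have "\<dots> \<le> (\<Sum>m. ennreal (K * ((1 + L) * 2 powr N) * q ^ m))"
  proof (rule suminf_le)
    fix m
    have "ennreal (c m) * emeasure M {x\<in>space M. T x \<le> 2 ^ m} \<le> ennreal (c m) * ennreal (K * (2 ^ m) powr \<beta>)"
      by (intro mult_left_mono mass) simp
    also have "\<dots> = ennreal (c m * (K * (2 ^ m) powr \<beta>))" using c0 K by (simp add: ennreal_mult)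
    also have "c m * (K * (2 ^ m) powr \<beta>) = K * ((1 + L) * 2 powr N) * q ^ m"
    proof -
      have "(2 ^ m) powr (- N) * (2 ^ m) powr \<beta> = (2 ^ m) powr (\<beta> - N)" by (simp add: powr_add[symmetric])
      also have "\<dots> = q ^ m" unfolding q_def by (simp add: powr_realpow[symmetric] powr_powr mult.commute)
      finally show ?thesis unfolding c_def by (simp add: algebra_simps)
    qed
    finally show "ennreal (c m) * emeasure M {x\<in>space M. T x \<le> 2 ^ m} \<le> ennreal (K * ((1 + L) * 2 powr N) * q ^ m)" .
  qed auto
  also have "\<dots> = ennreal (K * ((1 + L) * 2 powr N / (1 - q)))"
  proof -
    have "(\<lambda>m. K * ((1 + L) * 2 powr N) * q ^ m) sums (K * ((1 + L) * 2 powr N) * (1 / (1 - q)))"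
      using q by (intro sums_mult geometric_sums) auto
    then show ?thesis using K L q
      by (subst suminf_ennreal_eq[of _ "K * ((1 + L) * 2 powr N) * (1 / (1 - q))"]) auto
  qed
  finally show ?thesis unfolding q_def .
qed

lemma prod_norm_le_factor:
  fixes f :: "'i \<Rightarrow> complex"
  assumes "finite A" "i \<in> A" "\<And>j. j \<in> A \<Longrightarrow> norm (f j) \<le> 1"
  shows "(\<Prod>j\<in>A. norm (f j)) \<le> norm (f i)"
proof -
  have "(\<Prod>j\<in>A. norm (f j)) = norm (f i) * (\<Prod>j\<in>A - {i}. norm (f j))"
    using assms by (subst prod.remove) auto
  also have "\<dots> \<le> norm (f i) * 1"
    using assms by (intro mult_left_mono prod_le_1) auto
  finally show ?thesis by simp
qed

text \<open>The measure is the law of a random point of the random cube whose coordinates are averages of \<open>N\<close>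
  independent uniform variables. Their density is a spline supported in \<open>[0,1]\<close>, whose transform is
  the \<open>N\<close>-th power of a rescaled \<open>unit_phase_mean\<close> and hence
  decays to order \<open>N\<close>.\<close>

lemma random_parallelepiped_law:
  fixes Y :: "nat \<Rightarrow> real \<Rightarrow> real ^ 'n" and E :: "(real ^ 'n) set" and N :: nat
  assumes N: "0 < N" and Y: "\<And>i. Y i \<in> borel_measurable unit_space" and E: "closed E"
    and YE: "\<And>\<omega> r. \<omega> \<in> {0..<1} \<Longrightarrow> (\<And>i. i \<in> {1..k} \<Longrightarrow> r i \<in> {0..1}) \<Longrightarrow> Y 0 \<omega> + (\<Sum>i = 1..k. r i *\<^sub>R Y i \<omega>) \<in> E"
  obtains \<mu> :: "(real ^ 'n) measure"
  where "prob_space \<mu>" "sets \<mu> = sets borel" "emeasure \<mu> (- E) = 0"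
    and "\<And>\<xi>. norm (fourier_transform \<mu> \<xi>)
        \<le> (\<integral>\<omega>. (\<Prod>i\<in>{1..k}. norm (unit_phase_mean (\<xi> \<bullet> Y i \<omega> / N)) ^ N) \<partial>unit_space)"
proof -
  let ?U = "uniform_measure lborel {0..1::real}"
  define J where "J = {1..k} \<times> {..<N}"
  have J: "finite J" by (simp add: J_def)
  define R where "R = Pi\<^sub>M J (\<lambda>_. ?U)"
  interpret \<Omega>: prob_space unit_space by (rule prob_space_unit_space)
  interpret U: prob_space ?U by (rule prob_uniform01)
  interpret PP: product_prob_space "\<lambda>_. ?U" J by standard
  interpret PS: product_sigma_finite "\<lambda>_. ?U" by standard
  have Rp: "prob_space R" unfolding R_def by (rule PP.P.prob_space_axioms)
  interpret R: prob_space R by (rule Rp)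
  interpret Q: pair_prob_space unit_space R by standard
  have comp [measurable]: "(\<lambda>r. r p) \<in> borel_measurable R" if "p \<in> J" for p
    using measurable_component_singleton[OF that, of "\<lambda>_. ?U"] unfolding R_def
    by (simp add: measurable_cong_sets[OF refl sets_uniform_measure])
  have lin: "(\<lambda>t. c * t) \<in> borel_measurable ?U" for c :: real
    unfolding measurable_cong_sets[OF sets_uniform_measure refl] by simp
  define \<Psi> where "\<Psi> = (\<lambda>(\<omega>, r). Y 0 \<omega> + (\<Sum>p\<in>J. (r p / N) *\<^sub>R Y (fst p) \<omega>))"
  note Y [measurable]
  have \<Psi> [measurable]: "\<Psi> \<in> borel_measurable (unit_space \<Otimes>\<^sub>M R)"
    unfolding \<Psi>_def by measurable
  define \<mu> where "\<mu> = distr (unit_space \<Otimes>\<^sub>M R) borel \<Psi>"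
  have \<mu>: "prob_space \<mu>" unfolding \<mu>_def by (rule Q.prob_space_distr[OF \<Psi>])
  have sets: "sets \<mu> = sets borel" by (simp add: \<mu>_def)
  have inE: "\<Psi> (\<omega>, r) \<in> E" if \<omega>: "\<omega> \<in> {0..<1}" and r: "\<And>p. p \<in> J \<Longrightarrow> r p \<in> {0..1}" for \<omega> r
  proof -
    define \<rho> where "\<rho> i = (\<Sum>l<N. r (i, l)) / N" for i
    have "\<rho> i \<in> {0..1}" if i: "i \<in> {1..k}" for i
    proof -
      have r01: "r (i, l) \<in> {0..1}" if "l \<in> {..<N}" for l using r[of "(i, l)"] that i by (simp add: J_def)
      have "0 \<le> (\<Sum>l<N. r (i, l))" using r01 by (intro sum_nonneg) simp
      moreover have "(\<Sum>l<N. r (i, l)) \<le> (\<Sum>l<N. 1)" using r01 by (intro sum_mono) simp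
      ultimately show ?thesis using N by (simp add: \<rho>_def)
    qed
    moreover have "\<Psi> (\<omega>, r) = Y 0 \<omega> + (\<Sum>i = 1..k. \<rho> i *\<^sub>R Y i \<omega>)"
    proof -
      have "(\<Sum>p\<in>J. (r p / N) *\<^sub>R Y (fst p) \<omega>) = (\<Sum>i = 1..k. \<Sum>l<N. (r (i, l) / N) *\<^sub>R Y i \<omega>)"
        unfolding J_def by (subst sum.cartesian_product) (simp add: case_prod_beta)
      also have "\<dots> = (\<Sum>i = 1..k. \<rho> i *\<^sub>R Y i \<omega>)"
        by (simp only: \<rho>_def sum_divide_distrib scaleR_left.sum)
      finally show ?thesis by (simp add: \<Psi>_def)
    qed
    ultimately show ?thesis using YE[OF \<omega>, of \<rho>] by simp
  qed
  have "emeasure \<mu> (- E) = 0"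
  proof -
    have oE: "- E \<in> sets borel" using E by auto
    have AE_r: "AE r in R. \<forall>p\<in>J. r p \<in> {0..1}"
    proof (rule AE_finite_allI[OF J])
      fix p assume p: "p \<in> J"
      have "AE t in ?U. t \<in> {0..1}" by (rule AE_uniform_measureI) auto
      then show "AE r in R. r p \<in> {0..1}" unfolding R_def by (rule AE_PiM_component[OF U.prob_space_axioms p])
    qed
    have "AE q in unit_space \<Otimes>\<^sub>M R. \<Psi> q \<in> E"
    proof (rule Q.AE_pair_measure)
      show "{q \<in> space (unit_space \<Otimes>\<^sub>M R). \<Psi> q \<in> E} \<in> sets (unit_space \<Otimes>\<^sub>M R)"
        using measurable_sets[OF \<Psi> borel_closed[OF E]] by (simp only: vimage_def Int_def mem_Collect_eq conj_commute)
      show "AE \<omega> in unit_space. AE r in R. \<Psi> (\<omega>, r) \<in> E"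
      proof (rule AE_I2)
        fix \<omega> assume "\<omega> \<in> space unit_space"
        then have \<omega>: "\<omega> \<in> {0..<1}" by simp
        show "AE r in R. \<Psi> (\<omega>, r) \<in> E"
          using AE_r by (rule AE_mp) (rule AE_I2, use inE[OF \<omega>] in blast)
      qed
    qed
    then have ae: "AE v in \<mu>. v \<in> E" unfolding \<mu>_def using E by (subst AE_distr_iff) auto
    have co: "{v\<in>space \<mu>. \<not> v \<in> E} = - E" by (auto simp: \<mu>_def)
    have "- E \<in> sets \<mu>" using oE sets by simp
    from AE_iff_measurable[OF this co] ae show ?thesis by (rule iffD1)
  qed
  moreover have "norm (fourier_transform \<mu> \<xi>)
        \<le> (\<integral>\<omega>. (\<Prod>i\<in>{1..k}. norm (unit_phase_mean (\<xi> \<bullet> Y i \<omega> / N)) ^ N) \<partial>unit_space)" for \<xi>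
  proof -
    have m: "(\<lambda>q. \<xi> \<bullet> \<Psi> q) \<in> borel_measurable (unit_space \<Otimes>\<^sub>M R)"
      using measurable_compose[OF \<Psi> borel_measurable_inner_const[of \<xi>]] .
    have inner: "(\<integral>r. phase (\<xi> \<bullet> \<Psi> (\<omega>, r)) \<partial>R) = phase (\<xi> \<bullet> Y 0 \<omega>) * (\<Prod>p\<in>J. unit_phase_mean (\<xi> \<bullet> Y (fst p) \<omega> / N))" for \<omega>
    proof -
      have eq: "phase (\<xi> \<bullet> \<Psi> (\<omega>, r)) = phase (\<xi> \<bullet> Y 0 \<omega>) * (\<Prod>p\<in>J. phase ((\<xi> \<bullet> Y (fst p) \<omega> / N) * r p))" for r
      proof -
        have "\<xi> \<bullet> \<Psi> (\<omega>, r) = \<xi> \<bullet> Y 0 \<omega> + (\<Sum>p\<in>J. (\<xi> \<bullet> Y (fst p) \<omega> / N) * r p)"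
          by (simp add: \<Psi>_def inner_add_right inner_sum_right mult.commute)
        then show ?thesis by (simp only: phase_add phase_sum[OF J])
      qed
      have "(\<integral>r. phase (\<xi> \<bullet> \<Psi> (\<omega>, r)) \<partial>R) = phase (\<xi> \<bullet> Y 0 \<omega>) * (\<integral>r. (\<Prod>p\<in>J. phase ((\<xi> \<bullet> Y (fst p) \<omega> / N) * r p)) \<partial>R)"
        unfolding eq by (rule integral_mult_right_zero)
      also have "(\<integral>r. (\<Prod>p\<in>J. phase ((\<xi> \<bullet> Y (fst p) \<omega> / N) * r p)) \<partial>R) = (\<Prod>p\<in>J. \<integral>t. phase ((\<xi> \<bullet> Y (fst p) \<omega> / N) * t) \<partial>?U)"
        unfolding R_def by (rule PS.product_integral_prod[OF J U.integrable_phase[OF lin]])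
      finally show ?thesis unfolding unit_phase_mean_def .
    qed
    have prodJ: "norm (\<Prod>p\<in>J. unit_phase_mean (\<xi> \<bullet> Y (fst p) \<omega> / N)) = (\<Prod>i\<in>{1..k}. norm (unit_phase_mean (\<xi> \<bullet> Y i \<omega> / N)) ^ N)" for \<omega>
    proof -
      have "(\<Prod>p\<in>J. unit_phase_mean (\<xi> \<bullet> Y (fst p) \<omega> / N)) = (\<Prod>i\<in>{1..k}. \<Prod>l<N. unit_phase_mean (\<xi> \<bullet> Y i \<omega> / N))"
        unfolding J_def by (subst prod.cartesian_product) (simp add: case_prod_beta)
      then show ?thesis by (simp add: prod_norm[symmetric] norm_power)
    qed
    have "fourier_transform \<mu> \<xi> = (\<integral>q. phase (\<xi> \<bullet> \<Psi> q) \<partial>(unit_space \<Otimes>\<^sub>M R))"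
      unfolding fourier_transform_phase \<mu>_def
      by (rule integral_distr[OF \<Psi>]) (rule measurable_compose[OF borel_measurable_inner_const borel_measurable_phase])
    also have "\<dots> = (\<integral>\<omega>. \<integral>r. phase (\<xi> \<bullet> \<Psi> (\<omega>, r)) \<partial>R \<partial>unit_space)"
      by (rule Q.integral_fst'[symmetric]) (rule Q.integrable_phase[OF m])
    also have "norm \<dots> \<le> (\<integral>\<omega>. norm (\<integral>r. phase (\<xi> \<bullet> \<Psi> (\<omega>, r)) \<partial>R) \<partial>unit_space)"
      by (rule integral_norm_bound)
    also have "\<dots> = (\<integral>\<omega>. (\<Prod>i\<in>{1..k}. norm (unit_phase_mean (\<xi> \<bullet> Y i \<omega> / N)) ^ N) \<partial>unit_space)"
      unfolding inner norm_mult norm_phase prodJ by simp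
    finally show ?thesis .
  qed
  ultimately show ?thesis by (rule that[OF \<mu> sets])
qed

text \<open>The integrand of \<open>random_parallelepiped_law\<close> decays like \<open>T\<^bsup>-N\<^esup>\<close>, where \<open>T\<close> is the largest
  \<open>\<bar>\<xi> \<bullet> Y i\<bar>\<close>, while \<open>T \<le> \<eta>\<close> has probability \<open>O((\<eta> / \<bar>\<xi>\<bar>)\<^bsup>\<beta>\<^esup>)\<close>. Choosing \<open>N > \<beta>\<close>
  makes the dyadic sum converge.\<close>

lemma fourier_decay_of_random_frame:
  fixes Y :: "nat \<Rightarrow> real \<Rightarrow> real ^ 'n" and E :: "(real ^ 'n) set"
  assumes k: "1 \<le> k" and \<beta>: "0 < \<beta>" and Y: "\<And>i. Y i \<in> borel_measurable unit_space" and E: "closed E" and K: "0 < K"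
    and YE: "\<And>\<omega> r. \<omega> \<in> {0..<1} \<Longrightarrow> (\<And>i. i \<in> {1..k} \<Longrightarrow> r i \<in> {0..1}) \<Longrightarrow> Y 0 \<omega> + (\<Sum>i = 1..k. r i *\<^sub>R Y i \<omega>) \<in> E"
    and small: "\<And>\<xi> \<eta>. \<xi> \<noteq> 0 \<Longrightarrow> 0 < \<eta> \<Longrightarrow>
      measure unit_space {\<omega>\<in>{0..<1}. \<forall>i\<in>{1..k}. \<bar>\<xi> \<bullet> Y i \<omega>\<bar> \<le> \<eta>} \<le> K * (\<eta> / norm \<xi>) powr \<beta>"
  obtains \<mu> :: "(real ^ 'n) measure" and C :: real
  where "prob_space \<mu>" "sets \<mu> = sets borel" "emeasure \<mu> (- E) = 0" "0 < C"
    and "\<And>\<xi>. \<xi> \<noteq> 0 \<Longrightarrow> norm (fourier_transform \<mu> \<xi>) \<le> C * norm \<xi> powr (- \<beta>)"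
proof -
  interpret \<Omega>: prob_space unit_space by (rule prob_space_unit_space)
  obtain N :: nat where "\<beta> < real N" using reals_Archimedean2 by blast
  then have N: "0 < N" using \<beta> by (cases N) auto
  obtain \<mu> :: "(real ^ 'n) measure" where \<mu>: "prob_space \<mu>" "sets \<mu> = sets borel" "emeasure \<mu> (- E) = 0"
    and ft: "\<And>\<xi>. norm (fourier_transform \<mu> \<xi>)
        \<le> (\<integral>\<omega>. (\<Prod>i\<in>{1..k}. norm (unit_phase_mean (\<xi> \<bullet> Y i \<omega> / N)) ^ N) \<partial>unit_space)"
    by (rule random_parallelepiped_law[where Y = Y and k = k, OF N Y E YE]) blast+
  define L where "L = real N ^ N"
  define c where "c = (1 + L) * 2 powr N / (1 - 2 powr (\<beta> - N))"
  have c: "0 < c" using \<open>\<beta> < real N\<close> by (auto simp: c_def L_def powr_less_one intro!: divide_pos_pos mult_pos_pos add_pos_nonneg)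
  have decay: "norm (fourier_transform \<mu> \<xi>) \<le> (K * c) * norm \<xi> powr (- \<beta>)" if \<xi>: "\<xi> \<noteq> 0" for \<xi>
  proof -
    define f where "f \<omega> = (\<Prod>i\<in>{1..k}. norm (unit_phase_mean (\<xi> \<bullet> Y i \<omega> / N)) ^ N)" for \<omega>
    define T where "T \<omega> = Max ((\<lambda>i. \<bar>\<xi> \<bullet> Y i \<omega>\<bar>) ` {1..k})" for \<omega>
    note Y [measurable]
    have T_meas: "T \<in> borel_measurable unit_space"
      unfolding T_def using k by (intro borel_measurable_Max) (auto intro: measurable_compose[OF Y borel_measurable_inner_const] borel_measurable_abs)
    have f0: "0 \<le> f \<omega>" for \<omega> unfolding f_def by (intro prod_nonneg) simp
    have u1: "norm (unit_phase_mean t ^ N) \<le> 1" for t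
      using norm_unit_phase_mean_le_1[of t] by (simp add: norm_power power_le_one)
    have f1: "f \<omega> \<le> 1" for \<omega>
      unfolding f_def using u1 by (intro prod_le_1) (auto simp: norm_power)
    have fT: "f \<omega> \<le> L * T \<omega> powr (- real N)" if "0 < T \<omega>" for \<omega>
    proof -
      have "T \<omega> \<in> (\<lambda>i. \<bar>\<xi> \<bullet> Y i \<omega>\<bar>) ` {1..k}" unfolding T_def using k by (intro Max_in) auto
      then obtain i where i: "i \<in> {1..k}" "T \<omega> = \<bar>\<xi> \<bullet> Y i \<omega>\<bar>" by auto
      have "f \<omega> \<le> norm (unit_phase_mean (\<xi> \<bullet> Y i \<omega> / N) ^ N)"
        using prod_norm_le_factor[of "{1..k}" i "\<lambda>i. unit_phase_mean (\<xi> \<bullet> Y i \<omega> / N) ^ N"] i u1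
        by (simp add: f_def norm_power)
      also have "\<dots> \<le> (1 / \<bar>\<xi> \<bullet> Y i \<omega> / N\<bar>) ^ N"
        unfolding norm_power using i that N by (intro power_mono norm_unit_phase_mean_decay) auto
      also have "\<dots> = L * T \<omega> powr (- real N)"
      proof -
        have "1 / \<bar>\<xi> \<bullet> Y i \<omega> / N\<bar> = N * inverse (T \<omega>)" using i by (simp add: abs_mult divide_inverse)
        then show ?thesis
          using that by (simp add: L_def powr_minus powr_realpow power_mult_distrib power_inverse)
      qed
      finally show ?thesis .
    qed
    have "(\<integral>\<^sup>+\<omega>. ennreal (f \<omega>) \<partial>unit_space) \<le> ennreal ((K * norm \<xi> powr (- \<beta>)) * ((1 + L) * 2 powr N / (1 - 2 powr (\<beta> - N))))"
    proof (rule dyadic_layer_bound[OF T_meas \<open>\<beta> < real N\<close>])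
      show "0 < real N" using N by simp
      show "0 \<le> L" by (simp add: L_def)
      show "0 \<le> K * norm \<xi> powr (- \<beta>)" using K by simp
      fix m :: nat
      have "{\<omega>\<in>space unit_space. T \<omega> \<le> 2 ^ m} = {\<omega>\<in>{0..<1}. \<forall>i\<in>{1..k}. \<bar>\<xi> \<bullet> Y i \<omega>\<bar> \<le> 2 ^ m}"
        unfolding T_def using k by (simp add: Max_le_iff)
      then have "measure unit_space {\<omega>\<in>space unit_space. T \<omega> \<le> 2 ^ m} \<le> K * (2 ^ m / norm \<xi>) powr \<beta>"
        using small[OF \<xi>, of "2 ^ m"] by simp
      also have "\<dots> = K * norm \<xi> powr (- \<beta>) * (2 ^ m) powr \<beta>"
        using powr_divide[of "2 ^ m" "norm \<xi>" \<beta>] by (simp add: powr_minus_divide)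
      finally show "emeasure unit_space {\<omega>\<in>space unit_space. T \<omega> \<le> 2 ^ m} \<le> ennreal (K * norm \<xi> powr (- \<beta>) * (2 ^ m) powr \<beta>)"
        unfolding \<Omega>.emeasure_eq_measure by (rule ennreal_leI)
    qed (use f1 fT in \<open>auto intro: ennreal_leI simp: ennreal_le_1\<close>)
    then have le: "(\<integral>\<^sup>+\<omega>. ennreal (f \<omega>) \<partial>unit_space) \<le> ennreal ((K * c) * norm \<xi> powr (- \<beta>))"
      by (simp add: c_def mult_ac)
    have "norm (fourier_transform \<mu> \<xi>) \<le> (\<integral>\<omega>. f \<omega> \<partial>unit_space)" using ft[of \<xi>] unfolding f_def .
    also have "\<dots> \<le> (K * c) * norm \<xi> powr (- \<beta>)"
      by (rule integral_real_bounded) (use K c le f0 in auto)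
    finally show ?thesis .
  qed
  show ?thesis
    by (rule that[of \<mu> "K * c", OF \<mu> _ decay]) (use K c in auto)
qed

section \<open>Positive Lebesgue measure from a square-integrable Fourier transform\<close>

lemma square_integrable_of_decay:
  fixes \<mu> :: "(real ^ 'n) measure"
  assumes \<mu>: "prob_space \<mu>" and \<beta>: "real CARD('n) < 2 * \<beta>"
    and decay: "\<And>\<xi>. \<xi> \<noteq> 0 \<Longrightarrow> norm (fourier_transform \<mu> \<xi>) \<le> C * norm \<xi> powr (- \<beta>)"
  obtains B :: real where "0 < B" "(\<integral>\<^sup>+\<xi>. ennreal ((norm (fourier_transform \<mu> \<xi>))\<^sup>2) \<partial>lborel) \<le> ennreal B"
proof -
  define v where "v = unit_ball_vol (real CARD('n))"
  have v: "0 < v" by (simp add: v_def)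
  define B where "B = v * ((1 + C\<^sup>2) * 2 powr (2 * \<beta>) / (1 - 2 powr (real CARD('n) - 2 * \<beta>)))"
  have B: "0 < B" using v \<beta> by (auto simp: B_def powr_less_one intro!: divide_pos_pos mult_pos_pos add_pos_nonneg)
  have "(\<integral>\<^sup>+\<xi>. ennreal ((norm (fourier_transform \<mu> \<xi>))\<^sup>2) \<partial>lborel) \<le> ennreal B"
    unfolding B_def
  proof (rule dyadic_layer_bound[where T = norm])
    fix \<xi> :: "real ^ 'n"
    have n1: "norm (fourier_transform \<mu> \<xi>) \<le> 1" by (rule norm_fourier_transform_le_1[OF \<mu>])
    then show "ennreal ((norm (fourier_transform \<mu> \<xi>))\<^sup>2) \<le> 1"
      by (simp add: ennreal_le_1 power_le_one)
    assume "0 < norm \<xi>"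
    then have "(norm (fourier_transform \<mu> \<xi>))\<^sup>2 \<le> (C * norm \<xi> powr (- \<beta>))\<^sup>2"
      by (intro power_mono decay) auto
    also have "\<dots> = C\<^sup>2 * norm \<xi> powr (- (2 * \<beta>))"
      by (simp add: power_mult_distrib power2_eq_square powr_add[symmetric])
    finally show "ennreal ((norm (fourier_transform \<mu> \<xi>))\<^sup>2) \<le> ennreal (C\<^sup>2 * norm \<xi> powr (- (2 * \<beta>)))"
      by (rule ennreal_leI)
  next
    fix m :: nat
    have "{\<xi> \<in> space lborel. norm \<xi> \<le> 2 ^ m} = cball (0 :: real ^ 'n) (2 ^ m)" by auto
    then have "emeasure lborel {\<xi> \<in> space lborel. norm (\<xi> :: real ^ 'n) \<le> 2 ^ m} = ennreal (v * (2 ^ m) ^ CARD('n))"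
      by (simp add: emeasure_cball v_def)
    also have "(2 ^ m) ^ CARD('n) = (2 ^ m :: real) powr real CARD('n)" by (simp add: powr_realpow)
    finally show "emeasure lborel {\<xi> \<in> space lborel. norm (\<xi> :: real ^ 'n) \<le> 2 ^ m} \<le> ennreal (v * (2 ^ m) powr real CARD('n))" by simp
  qed (use \<beta> v in auto)
  then show ?thesis by (rule that[OF B])
qed

text \<open>Conditionally on the second point, the difference of two independent points of a cube of side \<open>R\<close> has
  density at most \<open>R\<^bsup>-d\<^esup>\<close>.\<close>

lemma dilated_cube_difference_density:
  fixes f :: "real ^ 'n \<Rightarrow> ennreal" and R :: real
  assumes R: "0 < R" and f [measurable]: "f \<in> borel_measurable borel"
  defines "\<nu> \<equiv> distr cube_law borel (\<lambda>v. R *\<^sub>R v)"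
  shows "(\<integral>\<^sup>+z. f z \<partial>difference_law \<nu>) \<le> ennreal ((1 / R) ^ CARD('n)) * (\<integral>\<^sup>+z. f z \<partial>lborel)"
proof -
  interpret c: prob_space "cube_law :: (real ^ 'n) measure" by (rule cube_law_prob)
  note [measurable_cong] = cube_law_prob(2)
  have sc: "(\<lambda>v :: real ^ 'n. R *\<^sub>R v) \<in> measurable cube_law borel" by measurable
  have \<nu>: "prob_space \<nu>" unfolding \<nu>_def by (rule c.prob_space_distr[OF sc])
  have s\<nu>: "sets \<nu> = sets borel" by (simp add: \<nu>_def)
  interpret \<nu>: prob_space \<nu> by fact
  interpret P: pair_prob_space \<nu> \<nu> by standard
  have one: "(\<integral>\<^sup>+w. f (w - w') \<partial>\<nu>) \<le> ennreal ((1 / R) ^ CARD('n)) * (\<integral>\<^sup>+z. f z \<partial>lborel)" for w'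
  proof -
    have "(\<integral>\<^sup>+w. f (w - w') \<partial>\<nu>) = (\<integral>\<^sup>+v. f (R *\<^sub>R v - w') \<partial>cube_law)"
      unfolding \<nu>_def by (rule nn_integral_distr[OF sc]) measurable
    also have "\<dots> = (\<integral>\<^sup>+v. (\<Prod>b\<in>Basis. indicator {0..1} (v \<bullet> b)) * f (R *\<^sub>R v - w') \<partial>lborel)"
      unfolding cube_law_def by (rule nn_integral_density) measurable
    also have "\<dots> \<le> (\<integral>\<^sup>+v. f (R *\<^sub>R v - w') \<partial>lborel)"
    proof (rule nn_integral_mono)
      fix v :: "real ^ 'n"
      have "(\<Prod>b\<in>Basis. indicator {0..1} (v \<bullet> b) :: ennreal) \<le> 1"
        by (intro prod_le_1) (auto simp: indicator_def)
      then show "(\<Prod>b\<in>Basis. indicator {0..1} (v \<bullet> b)) * f (R *\<^sub>R v - w') \<le> f (R *\<^sub>R v - w')"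
        using mult_right_mono[of "\<Prod>b\<in>Basis. indicator {0..1} (v \<bullet> b) :: ennreal" 1 "f (R *\<^sub>R v - w')"] by simp
    qed
    also have "\<dots> = ennreal ((1 / R) ^ CARD('n)) * (\<integral>\<^sup>+z. f z \<partial>lborel)"
    proof -
      have "(\<integral>\<^sup>+z. f z \<partial>lborel) = (\<integral>\<^sup>+z. f z \<partial>density (distr lborel borel (\<lambda>v. - w' + R *\<^sub>R v)) (\<lambda>_. ennreal (\<bar>R\<bar> ^ CARD('n))))"
        using lborel_affine[of R "- w'"] R by simp
      also have "\<dots> = (\<integral>\<^sup>+z. ennreal (\<bar>R\<bar> ^ CARD('n)) * f z \<partial>distr lborel borel (\<lambda>v. - w' + R *\<^sub>R v))"
        by (rule nn_integral_density) measurable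
      also have "\<dots> = ennreal (\<bar>R\<bar> ^ CARD('n)) * (\<integral>\<^sup>+z. f z \<partial>distr lborel borel (\<lambda>v. - w' + R *\<^sub>R v))"
        by (rule nn_integral_cmult) measurable
      also have "(\<integral>\<^sup>+z. f z \<partial>distr lborel borel (\<lambda>v. - w' + R *\<^sub>R v)) = (\<integral>\<^sup>+v. f (- w' + R *\<^sub>R v) \<partial>lborel)"
        by (rule nn_integral_distr) measurable
      finally have "ennreal ((1 / R) ^ CARD('n)) * (\<integral>\<^sup>+z. f z \<partial>lborel)
          = (ennreal ((1 / R) ^ CARD('n)) * ennreal (\<bar>R\<bar> ^ CARD('n))) * (\<integral>\<^sup>+v. f (R *\<^sub>R v - w') \<partial>lborel)"
        by (simp add: mult.assoc)
      also have "ennreal ((1 / R) ^ CARD('n)) * ennreal (\<bar>R\<bar> ^ CARD('n)) = 1"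
        using R by (simp add: ennreal_mult[symmetric] power_mult_distrib[symmetric])
      finally show ?thesis by simp
    qed
    finally show ?thesis .
  qed
  have fm: "(\<lambda>p. f (case p of (x, y) \<Rightarrow> x - y)) \<in> borel_measurable (\<nu> \<Otimes>\<^sub>M \<nu>)"
    by (rule measurable_compose[OF difference_measurable[OF s\<nu>] f])
  have "(\<integral>\<^sup>+z. f z \<partial>difference_law \<nu>) = (\<integral>\<^sup>+p. f (case p of (x, y) \<Rightarrow> x - y) \<partial>(\<nu> \<Otimes>\<^sub>M \<nu>))"
    unfolding difference_law_def by (rule nn_integral_distr[OF difference_measurable[OF s\<nu>]]) simp
  also have "\<dots> = (\<integral>\<^sup>+w'. \<integral>\<^sup>+w. f (w - w') \<partial>\<nu> \<partial>\<nu>)"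
    using P.nn_integral_snd[OF fm] by simp
  also have "\<dots> \<le> (\<integral>\<^sup>+w'. ennreal ((1 / R) ^ CARD('n)) * (\<integral>\<^sup>+z. f z \<partial>lborel) \<partial>\<nu>)"
    by (rule nn_integral_mono) (rule one)
  also have "\<dots> = ennreal ((1 / R) ^ CARD('n)) * (\<integral>\<^sup>+z. f z \<partial>lborel)"
    by (simp add: \<nu>.emeasure_space_1)
  finally show ?thesis .
qed

text \<open>Duality between \<open>difference_law \<mu>\<close> and \<open>difference_law \<nu>\<close>, where \<open>\<nu>\<close> is uniform on a cube of side
  \<open>R\<close> comparable to \<open>1 / \<rho>\<close>. The transform of \<open>difference_law \<nu>\<close> is nonnegative, being a squared
  modulus, and bounded below on the ball of radius \<open>\<rho>\<close>, while \<open>difference_law \<nu>\<close> has density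
  \<open>O(\<rho>\<^sup>d)\<close> against which the squared transform of \<open>\<mu>\<close> is integrated.\<close>

lemma difference_law_ball_le:
  fixes \<mu> :: "(real ^ 'n) measure"
  assumes \<mu>: "prob_space \<mu>" "sets \<mu> = sets borel" and B: "0 < B"
    and L2: "(\<integral>\<^sup>+\<xi>. ennreal ((norm (fourier_transform \<mu> \<xi>))\<^sup>2) \<partial>lborel) \<le> ennreal B"
    and \<rho>: "0 < \<rho>"
  shows "measure (difference_law \<mu>) (cball 0 \<rho>) \<le> 64 ^ CARD('n) * B * \<rho> ^ CARD('n)"
proof -
  \<comment> \<open>for \<open>z\<close> in the ball all coordinates of \<open>R *\<^sub>R z\<close> are at most \<open>1 / 16\<close>, the range of \<open>unit_phase_mean_near_1\<close>\<close>
  define R where "R = 1 / (16 * \<rho>)"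
  have R: "0 < R" using \<rho> by (simp add: R_def)
  interpret c: prob_space "cube_law :: (real ^ 'n) measure" by (rule cube_law_prob)
  note [measurable_cong] = cube_law_prob(2)
  define \<nu> where "\<nu> = distr (cube_law :: (real ^ 'n) measure) borel (\<lambda>v. R *\<^sub>R v)"
  have sc: "(\<lambda>v :: real ^ 'n. R *\<^sub>R v) \<in> measurable cube_law borel" by measurable
  have \<nu>: "prob_space \<nu>" "sets \<nu> = sets borel" unfolding \<nu>_def by (rule c.prob_space_distr[OF sc]) simp
  note d\<mu> = difference_law_prob[OF \<mu>] and d\<nu> = difference_law_prob[OF \<nu>]
  interpret d\<mu>: prob_space "difference_law \<mu>" by (rule d\<mu>)
  note ft\<mu> = fourier_transform_measurable[OF \<mu>] and ft\<nu> = fourier_transform_measurable[OF \<nu>]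
  have m\<mu>: "(\<lambda>\<xi>. (norm (fourier_transform \<mu> \<xi>))\<^sup>2) \<in> borel_measurable borel"
    using ft\<mu> by measurable
  have m\<nu>: "(\<lambda>\<xi>. (norm (fourier_transform \<nu> \<xi>))\<^sup>2) \<in> borel_measurable borel"
    using ft\<nu> by measurable
  let ?m = "\<lambda>\<xi>. (norm (fourier_transform \<mu> \<xi>))\<^sup>2" and ?n = "\<lambda>z. (norm (fourier_transform \<nu> z))\<^sup>2"
  have dual: "(\<integral>z. ?n z \<partial>difference_law \<mu>) = (\<integral>\<xi>. ?m \<xi> \<partial>difference_law \<nu>)"
  proof -
    have "complex_of_real (\<integral>z. ?n z \<partial>difference_law \<mu>)
        = (\<integral>z. fourier_transform (difference_law \<nu>) z \<partial>difference_law \<mu>)"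
      unfolding fourier_transform_difference_law[OF \<nu>] by (rule integral_complex_of_real[symmetric])
    also have "\<dots> = (\<integral>\<xi>. fourier_transform (difference_law \<mu>) \<xi> \<partial>difference_law \<nu>)"
      by (rule fourier_transform_duality[OF d\<nu> d\<mu>])
    also have "\<dots> = complex_of_real (\<integral>\<xi>. ?m \<xi> \<partial>difference_law \<nu>)"
      unfolding fourier_transform_difference_law[OF \<mu>] by (rule integral_complex_of_real)
    finally show ?thesis by (simp only: of_real_eq_iff)
  qed
  have upper: "(\<integral>\<xi>. ?m \<xi> \<partial>difference_law \<nu>) \<le> (1 / R) ^ CARD('n) * B"
  proof (rule integral_real_bounded)
    show "0 \<le> (1 / R) ^ CARD('n) * B" using R B by simp
    have "(\<integral>\<^sup>+\<xi>. ennreal (?m \<xi>) \<partial>difference_law \<nu>)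
        \<le> ennreal ((1 / R) ^ CARD('n)) * (\<integral>\<^sup>+\<xi>. ennreal (?m \<xi>) \<partial>lborel)"
      unfolding \<nu>_def by (rule dilated_cube_difference_density[OF R]) (use m\<mu> in measurable)
    also have "\<dots> \<le> ennreal ((1 / R) ^ CARD('n)) * ennreal B" by (intro mult_left_mono L2) simp
    also have "\<dots> = ennreal ((1 / R) ^ CARD('n) * B)" using R B by (simp add: ennreal_mult)
    finally show "(\<integral>\<^sup>+\<xi>. ennreal (?m \<xi>) \<partial>difference_law \<nu>) \<le> ennreal ((1 / R) ^ CARD('n) * B)" .
  qed
  have ge: "(1 / 4) ^ CARD('n) \<le> ?n z" if z: "z \<in> cball 0 \<rho>" for z
  proof -
    have "fourier_transform \<nu> z = (\<integral>v. phase (z \<bullet> R *\<^sub>R v) \<partial>cube_law)"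
      unfolding fourier_transform_phase \<nu>_def
      by (rule integral_distr[OF sc]) (rule measurable_compose[OF borel_measurable_inner_const borel_measurable_phase])
    also have "\<dots> = fourier_transform cube_law (R *\<^sub>R z)"
      by (simp only: fourier_transform_phase inner_scaleR_left inner_scaleR_right)
    also have "\<dots> = (\<Prod>b\<in>Basis. unit_phase_mean ((R *\<^sub>R z) \<bullet> b))" by (rule fourier_transform_cube_law)
    finally have "norm (fourier_transform \<nu> z) = (\<Prod>b\<in>Basis. norm (unit_phase_mean ((R *\<^sub>R z) \<bullet> b)))"
      by (simp only: prod_norm)
    moreover have "(\<Prod>b\<in>(Basis :: (real ^ 'n) set). 1 / 2) \<le> (\<Prod>b\<in>Basis. norm (unit_phase_mean ((R *\<^sub>R z) \<bullet> b)))"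
    proof (rule prod_mono, rule conjI)
      fix b :: "real ^ 'n" assume b: "b \<in> Basis"
      have "\<bar>(R *\<^sub>R z) \<bullet> b\<bar> = R * \<bar>z \<bullet> b\<bar>" using R by (simp add: abs_mult)
      also have "\<dots> \<le> R * \<rho>" using Basis_le_norm[OF b, of z] z R by (intro mult_left_mono) auto
      also have "\<dots> = 1 / 16" using \<rho> by (simp add: R_def)
      finally show "1 / 2 \<le> norm (unit_phase_mean ((R *\<^sub>R z) \<bullet> b))" by (rule unit_phase_mean_near_1)
    qed simp
    ultimately have "(1 / 2) ^ CARD('n) \<le> norm (fourier_transform \<nu> z)" by simp
    then have "((1 / 2) ^ CARD('n))\<^sup>2 \<le> ?n z" by (intro power_mono) auto
    moreover have "((1 / 2 :: real) ^ CARD('n))\<^sup>2 = ((1 / 2)\<^sup>2) ^ CARD('n)"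
      by (simp only: power_mult[symmetric] mult.commute)
    moreover have "(1 / 2 :: real)\<^sup>2 = 1 / 4" by (simp add: power2_eq_square)
    ultimately show ?thesis by (simp only:)
  qed
  have intb: "integrable (difference_law \<mu>) (\<lambda>z. ?n z)"
  proof (rule d\<mu>.integrable_const_bound[of _ 1])
    show "AE z in difference_law \<mu>. norm (?n z) \<le> 1"
      using norm_fourier_transform_le_1[OF \<nu>(1)] by (auto simp: power_le_one)
    show "(\<lambda>z. ?n z) \<in> borel_measurable (difference_law \<mu>)"
      using m\<nu> measurable_cong_sets[OF d\<mu>(2) refl] by blast
  qed
  have cb: "cball 0 \<rho> \<in> sets (difference_law \<mu>)" using d\<mu>(2) by simp
  have "(1 / 4) ^ CARD('n) * measure (difference_law \<mu>) (cball 0 \<rho>) = (\<integral>z. (1 / 4) ^ CARD('n) * indicator (cball 0 \<rho>) z \<partial>difference_law \<mu>)"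
    using cb by simp
  also have "\<dots> \<le> (\<integral>z. ?n z \<partial>difference_law \<mu>)"
  proof (rule integral_mono[OF _ intb])
    show "integrable (difference_law \<mu>) (\<lambda>z. (1 / 4) ^ CARD('n) * indicator (cball 0 \<rho>) z :: real)"
      using cb by (intro integrable_mult_right integrable_real_indicator) (auto simp: d\<mu>.emeasure_eq_measure)
    show "(1 / 4) ^ CARD('n) * indicator (cball 0 \<rho>) z \<le> ?n z" for z
      using ge[of z] by (cases "z \<in> cball 0 \<rho>") simp_all
  qed
  also have "\<dots> \<le> (1 / R) ^ CARD('n) * B" using dual upper by simp
  also have "(1 / R) ^ CARD('n) = (16 * \<rho>) ^ CARD('n)" by (simp add: R_def)
  finally have "4 ^ CARD('n) * ((1 / 4) ^ CARD('n) * measure (difference_law \<mu>) (cball 0 \<rho>)) \<le> 4 ^ CARD('n) * ((16 * \<rho>) ^ CARD('n) * B)"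
    by (rule mult_left_mono) simp
  also have "4 ^ CARD('n) * ((16 * \<rho>) ^ CARD('n) * B) = (4 * (16 * \<rho>)) ^ CARD('n) * B"
    unfolding power_mult_distrib[of 4] by (rule mult.assoc[symmetric])
  also have "\<dots> = 64 ^ CARD('n) * B * \<rho> ^ CARD('n)" by (simp add: power_mult_distrib)
  also have "4 ^ CARD('n) * ((1 / 4) ^ CARD('n) * measure (difference_law \<mu>) (cball 0 \<rho>))
      = (4 * (1 / 4)) ^ CARD('n) * measure (difference_law \<mu>) (cball 0 \<rho>)"
    unfolding power_mult_distrib[of 4] by (rule mult.assoc[symmetric])
  also have "\<dots> = measure (difference_law \<mu>) (cball 0 \<rho>)" by simp
  finally show ?thesis .
qed

text \<open>Let \<open>F z\<close> be the \<open>\<mu>\<close>-measure of the ball of radius \<open>\<epsilon>\<close> about \<open>z\<close>. It is supported in the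
  thickening of \<open>E\<close>; its integral is the volume of a ball, and its square integrates to at most that
  volume times the probability that two independent points are \<open>2 \<epsilon>\<close>-close. Cauchy--Schwarz, in
  the form \<open>2 \<theta> F \<le> \<theta>\<^sup>2 + F\<^sup>2\<close>, bounds the measure of the support below, uniformly in
  \<open>\<epsilon>\<close>.\<close>

lemma thickening_measure_ge:
  fixes \<mu> :: "(real ^ 'n) measure" and E :: "(real ^ 'n) set"
  assumes \<mu>: "prob_space \<mu>" "sets \<mu> = sets borel" and E: "E \<in> sets borel" and null: "emeasure \<mu> (- E) = 0"
    and K: "0 < K" and \<epsilon>: "0 < \<epsilon>" and fin: "emeasure lborel {z. infdist z E \<le> \<epsilon>} < \<infinity>"
    and ball: "\<And>\<rho>. 0 < \<rho> \<Longrightarrow> measure (difference_law \<mu>) (cball 0 \<rho>) \<le> K * \<rho> ^ CARD('n)"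
  shows "unit_ball_vol (real CARD('n)) / (K * 2 ^ CARD('n)) \<le> measure lborel {z. infdist z E \<le> \<epsilon>}"
proof -
  define d where "d = CARD('n)"
  define v where "v = unit_ball_vol (real d)"
  define \<kappa> where "\<kappa> = K * 2 ^ d"
  define G where "G = {z. infdist z E \<le> \<epsilon>}"
  have v: "0 < v" by (simp add: v_def)
  have \<kappa>: "0 < \<kappa>" using K by (simp add: \<kappa>_def)
  note [measurable_cong] = \<mu>(2)
  interpret \<mu>: prob_space \<mu> by fact
  interpret W: pair_prob_space \<mu> \<mu> by standard
  interpret Z: pair_sigma_finite lborel \<mu> by standard
  interpret ZW: pair_sigma_finite lborel "\<mu> \<Otimes>\<^sub>M \<mu>" by standard
  have vol: "emeasure lborel (cball x \<epsilon>) = ennreal (v * \<epsilon> ^ d)" for x :: "real ^ 'n"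
    using \<epsilon> by (simp add: emeasure_cball v_def d_def)
  have closed: "closed G"
    unfolding G_def by (intro closed_Collect_le continuous_intros)
  have Gm: "G \<in> sets lborel" using closed by simp
  define F where "F z = measure \<mu> (cball z \<epsilon>)" for z
  have F_int: "ennreal (F z) = (\<integral>\<^sup>+x. indicator {x. dist z x \<le> \<epsilon>} x \<partial>\<mu>)" for z
  proof -
    have "{x. dist z x \<le> \<epsilon>} = cball z \<epsilon>" by auto
    moreover have "cball z \<epsilon> \<in> sets \<mu>" using \<mu>(2) by simp
    ultimately show ?thesis by (simp add: F_def \<mu>.emeasure_eq_measure)
  qed
  have F_sq: "ennreal ((F z)\<^sup>2) = (\<integral>\<^sup>+w. indicator {w. dist z (fst w) \<le> \<epsilon> \<and> dist z (snd w) \<le> \<epsilon>} w \<partial>(\<mu> \<Otimes>\<^sub>M \<mu>))" for z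
  proof -
    have s: "cball z \<epsilon> \<in> sets \<mu>" using \<mu>(2) by simp
    have e: "{w. dist z (fst w) \<le> \<epsilon> \<and> dist z (snd w) \<le> \<epsilon>} = cball z \<epsilon> \<times> cball z \<epsilon>" by auto
    have "emeasure (\<mu> \<Otimes>\<^sub>M \<mu>) (cball z \<epsilon> \<times> cball z \<epsilon>) = ennreal (F z) * ennreal (F z)"
      unfolding \<mu>.emeasure_pair_measure_Times[OF s s] by (simp add: F_def \<mu>.emeasure_eq_measure)
    also have "\<dots> = ennreal ((F z)\<^sup>2)" by (simp add: F_def ennreal_mult power2_eq_square)
    finally show ?thesis unfolding e using s by simp
  qed
  have null': "measure \<mu> S = 0" if "S \<subseteq> - E" "S \<in> sets borel" for S
  proof -
    have "emeasure \<mu> S \<le> emeasure \<mu> (- E)"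
      using that E \<mu>(2) by (intro emeasure_mono) auto
    then show ?thesis using null by (simp add: measure_def)
  qed
  have F0: "F z = 0" if "z \<notin> G" for z
    unfolding F_def
  proof (rule null')
    show "cball z \<epsilon> \<subseteq> - E" using that infdist_le2[of _ E z \<epsilon>] by (auto simp: G_def)
  qed simp
  have ksets: "{p. dist (fst p) (snd p) \<le> \<epsilon>} \<in> sets (lborel \<Otimes>\<^sub>M \<mu>)"
  proof -
    have "{p \<in> space (lborel \<Otimes>\<^sub>M \<mu>). dist (fst p) (snd p) \<le> \<epsilon>} \<in> sets (lborel \<Otimes>\<^sub>M \<mu>)" by measurable
    then show ?thesis using sets_eq_imp_space_eq[OF \<mu>(2)] by (simp add: space_pair_measure)
  qed
  have total: "(\<integral>\<^sup>+z. ennreal (F z) \<partial>lborel) = ennreal (v * \<epsilon> ^ d)"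
  proof -
    have "(\<integral>\<^sup>+z. ennreal (F z) \<partial>lborel) = (\<integral>\<^sup>+z. \<integral>\<^sup>+x. indicator {p. dist (fst p) (snd p) \<le> \<epsilon>} (z, x) \<partial>\<mu> \<partial>lborel)"
      unfolding F_int by (intro nn_integral_cong) (simp add: indicator_def)
    also have "\<dots> = (\<integral>\<^sup>+x. \<integral>\<^sup>+z. indicator {p. dist (fst p) (snd p) \<le> \<epsilon>} (z, x) \<partial>lborel \<partial>\<mu>)"
      by (rule Z.Fubini[symmetric]) (use ksets in measurable)
    also have "\<dots> = (\<integral>\<^sup>+x. emeasure lborel (cball x \<epsilon>) \<partial>\<mu>)"
    proof (rule nn_integral_cong)
      fix x
      have "(\<integral>\<^sup>+z. indicator {p. dist (fst p) (snd p) \<le> \<epsilon>} (z, x) \<partial>lborel) = (\<integral>\<^sup>+z. indicator (cball x \<epsilon>) z \<partial>lborel)"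
        by (intro nn_integral_cong) (simp add: indicator_def dist_commute)
      then show "(\<integral>\<^sup>+z. indicator {p. dist (fst p) (snd p) \<le> \<epsilon>} (z, x) \<partial>lborel) = emeasure lborel (cball x \<epsilon>)" by simp
    qed
    also have "\<dots> = ennreal (v * \<epsilon> ^ d)" unfolding vol by (simp add: \<mu>.emeasure_space_1)
    finally show ?thesis .
  qed
  let ?T = "{p. dist (fst p) (fst (snd p)) \<le> \<epsilon> \<and> dist (fst p) (snd (snd p)) \<le> \<epsilon>}"
  have sp: "space \<mu> = UNIV" using sets_eq_imp_space_eq[OF \<mu>(2)] by simp
  have Ts: "?T \<in> sets (lborel \<Otimes>\<^sub>M (\<mu> \<Otimes>\<^sub>M \<mu>))"
  proof -
    have "{p \<in> space (lborel \<Otimes>\<^sub>M (\<mu> \<Otimes>\<^sub>M \<mu>)). dist (fst p) (fst (snd p)) \<le> \<epsilon> \<and> dist (fst p) (snd (snd p)) \<le> \<epsilon>}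
        \<in> sets (lborel \<Otimes>\<^sub>M (\<mu> \<Otimes>\<^sub>M \<mu>))" by measurable
    then show ?thesis using sp by (simp add: space_pair_measure)
  qed
  have square: "(\<integral>\<^sup>+z. ennreal ((F z)\<^sup>2) \<partial>lborel) \<le> ennreal (v * \<epsilon> ^ d * (\<kappa> * \<epsilon> ^ d))"
  proof -
    let ?D = "{w. dist (fst w) (snd w) \<le> 2 * \<epsilon>}"
    have Ds: "?D \<in> sets (\<mu> \<Otimes>\<^sub>M \<mu>)"
    proof -
      have "{w \<in> space (\<mu> \<Otimes>\<^sub>M \<mu>). dist (fst w) (snd w) \<le> 2 * \<epsilon>} \<in> sets (\<mu> \<Otimes>\<^sub>M \<mu>)" by measurable
      then show ?thesis using sp by (simp add: space_pair_measure)
    qed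
    have "(\<integral>\<^sup>+z. ennreal ((F z)\<^sup>2) \<partial>lborel) = (\<integral>\<^sup>+z. \<integral>\<^sup>+w. indicator ?T (z, w) \<partial>(\<mu> \<Otimes>\<^sub>M \<mu>) \<partial>lborel)"
      unfolding F_sq by (intro nn_integral_cong) (simp add: indicator_def)
    also have "\<dots> = (\<integral>\<^sup>+w. \<integral>\<^sup>+z. indicator ?T (z, w) \<partial>lborel \<partial>(\<mu> \<Otimes>\<^sub>M \<mu>))"
      by (rule ZW.Fubini[symmetric]) (use Ts in measurable)
    also have "\<dots> \<le> (\<integral>\<^sup>+w. ennreal (v * \<epsilon> ^ d) * indicator ?D w \<partial>(\<mu> \<Otimes>\<^sub>M \<mu>))"
    proof (rule nn_integral_mono)
      fix w :: "(real ^ 'n) \<times> (real ^ 'n)"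
      have le: "indicator ?T (z, w) \<le> (indicator ?D w * indicator (cball (fst w) \<epsilon>) z :: ennreal)" for z
        using dist_triangle_le[of "fst w" z "snd w" "2 * \<epsilon>"] by (auto simp: indicator_def dist_commute)
      have "(\<integral>\<^sup>+z. indicator ?T (z, w) \<partial>lborel) \<le> (\<integral>\<^sup>+z. indicator ?D w * indicator (cball (fst w) \<epsilon>) z \<partial>lborel)"
        by (rule nn_integral_mono) (rule le)
      also have "\<dots> = indicator ?D w * emeasure lborel (cball (fst w) \<epsilon>)"
        by (rule nn_integral_cmult_indicator) simp
      finally show "(\<integral>\<^sup>+z. indicator ?T (z, w) \<partial>lborel) \<le> ennreal (v * \<epsilon> ^ d) * indicator ?D w"
        unfolding vol by (simp only: mult.commute)
    qed
    also have "\<dots> = ennreal (v * \<epsilon> ^ d) * emeasure (\<mu> \<Otimes>\<^sub>M \<mu>) ?D"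
      by (rule nn_integral_cmult_indicator[OF Ds])
    also have "emeasure (\<mu> \<Otimes>\<^sub>M \<mu>) ?D = emeasure (difference_law \<mu>) (cball 0 (2 * \<epsilon>))"
    proof -
      have "(\<lambda>(x, y). x - y) -` cball 0 (2 * \<epsilon>) \<inter> space (\<mu> \<Otimes>\<^sub>M \<mu>) = ?D"
        using sp by (auto simp: space_pair_measure dist_norm norm_minus_commute)
      then show ?thesis
        unfolding difference_law_def by (subst emeasure_distr[OF difference_measurable[OF \<mu>(2)]]) simp_all
    qed
    also have "\<dots> \<le> ennreal (\<kappa> * \<epsilon> ^ d)"
    proof -
      interpret dl: prob_space "difference_law \<mu>" by (rule difference_law_prob[OF \<mu>])
      have "measure (difference_law \<mu>) (cball 0 (2 * \<epsilon>)) \<le> K * (2 * \<epsilon>) ^ CARD('n)" using \<epsilon> by (intro ball) simp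
      also have "\<dots> = \<kappa> * \<epsilon> ^ d" by (simp add: \<kappa>_def d_def power_mult_distrib)
      finally show ?thesis unfolding dl.emeasure_eq_measure by (rule ennreal_leI)
    qed
    finally show ?thesis using v \<epsilon> \<kappa> by (simp add: ennreal_mult mult_left_mono)
  qed
  \<comment> \<open>the weight at which the bound for the integral of \<open>F\<^sup>2\<close> becomes half of the left-hand side\<close>
  define \<theta> where "\<theta> = \<kappa> * \<epsilon> ^ d"
  have \<theta>: "0 < \<theta>" using \<kappa> \<epsilon> by (simp add: \<theta>_def)
  define m where "m = measure lborel G"
  have Gm': "emeasure lborel G = ennreal m" unfolding m_def using fin by (intro emeasure_eq_ennreal_measure) (simp add: G_def)
  have F_meas: "(\<lambda>z. ennreal ((F z)\<^sup>2)) \<in> borel_measurable lborel"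
  proof -
    have "(\<lambda>z. \<integral>\<^sup>+w. indicator ?T (z, w) \<partial>(\<mu> \<Otimes>\<^sub>M \<mu>)) \<in> borel_measurable lborel"
      by (rule W.borel_measurable_nn_integral_fst) (use Ts in measurable)
    then show ?thesis unfolding F_sq by (simp add: indicator_def)
  qed
  have "ennreal (2 * \<theta> * (v * \<epsilon> ^ d)) = (\<integral>\<^sup>+z. ennreal (2 * \<theta>) * ennreal (F z) \<partial>lborel)"
  proof -
    have "(\<lambda>z. \<integral>\<^sup>+x. indicator {p. dist (fst p) (snd p) \<le> \<epsilon>} (z, x) \<partial>\<mu>) \<in> borel_measurable lborel"
      by (rule \<mu>.borel_measurable_nn_integral_fst) (use ksets in measurable)
    moreover have "ennreal (F z) = (\<integral>\<^sup>+x. indicator {p. dist (fst p) (snd p) \<le> \<epsilon>} (z, x) \<partial>\<mu>)" for z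
      unfolding F_int by (intro nn_integral_cong) (simp add: indicator_def)
    ultimately have "(\<lambda>z. ennreal (F z)) \<in> borel_measurable lborel" by (simp only:)
    then have "(\<integral>\<^sup>+z. ennreal (2 * \<theta>) * ennreal (F z) \<partial>lborel) = ennreal (2 * \<theta>) * (\<integral>\<^sup>+z. ennreal (F z) \<partial>lborel)"
      by (rule nn_integral_cmult)
    then show ?thesis unfolding total using \<theta> v \<epsilon> by (simp add: ennreal_mult)
  qed
  also have "\<dots> \<le> (\<integral>\<^sup>+z. ennreal (\<theta>\<^sup>2) * indicator G z + ennreal ((F z)\<^sup>2) \<partial>lborel)"
  proof (rule nn_integral_mono)
    fix z
    show "ennreal (2 * \<theta>) * ennreal (F z) \<le> ennreal (\<theta>\<^sup>2) * indicator G z + ennreal ((F z)\<^sup>2)"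
    proof (cases "z \<in> G")
      case True
      have "2 * \<theta> * F z \<le> \<theta>\<^sup>2 + (F z)\<^sup>2" using sum_squares_bound[of \<theta> "F z"] by simp
      then have "ennreal (2 * \<theta> * F z) \<le> ennreal (\<theta>\<^sup>2 + (F z)\<^sup>2)" by (rule ennreal_leI)
      then show ?thesis using True \<theta> by (simp add: ennreal_mult F_def)
    qed (simp add: F0)
  qed
  also have "\<dots> = ennreal (\<theta>\<^sup>2) * ennreal m + (\<integral>\<^sup>+z. ennreal ((F z)\<^sup>2) \<partial>lborel)"
    using Gm F_meas by (subst nn_integral_add) (simp_all add: nn_integral_cmult_indicator Gm')
  also have "\<dots> \<le> ennreal (\<theta>\<^sup>2) * ennreal m + ennreal (v * \<epsilon> ^ d * (\<kappa> * \<epsilon> ^ d))"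
    by (rule add_left_mono[OF square])
  also have "\<dots> = ennreal (\<theta>\<^sup>2 * m + v * \<epsilon> ^ d * \<theta>)"
    using v \<epsilon> \<theta> by (simp add: \<theta>_def[symmetric] ennreal_mult m_def)
  finally have "2 * \<theta> * (v * \<epsilon> ^ d) \<le> \<theta>\<^sup>2 * m + v * \<epsilon> ^ d * \<theta>"
    using v \<epsilon> \<theta> by (subst (asm) ennreal_le_iff) (simp_all add: m_def)
  then have "\<theta> * (v * \<epsilon> ^ d) \<le> \<theta> * (\<theta> * m)" by (simp add: power2_eq_square algebra_simps)
  then have "v * \<epsilon> ^ d \<le> \<theta> * m" using \<theta> by (rule mult_left_le_imp_le)
  then have "\<epsilon> ^ d * v \<le> \<epsilon> ^ d * (\<kappa> * m)" by (simp only: \<theta>_def mult_ac)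
  then have "v \<le> \<kappa> * m" using \<epsilon> by simp
  then show ?thesis using \<kappa> by (simp add: v_def \<kappa>_def m_def d_def G_def pos_divide_le_eq mult.commute)
qed

lemma positive_measure_of_difference_law_bound:
  fixes \<mu> :: "(real ^ 'n) measure" and E :: "(real ^ 'n) set"
  assumes \<mu>: "prob_space \<mu>" "sets \<mu> = sets borel" and E: "compact E" and null: "emeasure \<mu> (- E) = 0"
    and K: "0 < K"
    and ball: "\<And>\<rho>. 0 < \<rho> \<Longrightarrow> measure (difference_law \<mu>) (cball 0 \<rho>) \<le> K * \<rho> ^ CARD('n)"
  shows "0 < emeasure lebesgue E"
proof -
  interpret \<mu>: prob_space \<mu> by fact
  define c where "c = unit_ball_vol (real CARD('n)) / (K * 2 ^ CARD('n))"
  have c: "0 < c" using K by (simp add: c_def)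
  have "E \<noteq> {}"
  proof
    assume "E = {}"
    then have "emeasure \<mu> (space \<mu>) = 0" using null sets_eq_imp_space_eq[OF \<mu>(2)] by simp
    then show False using \<mu>.emeasure_space_1 by simp
  qed
  define G where "G i = {z. infdist z E \<le> 1 / real (Suc i)}" for i
  have cpt: "compact (G i)" for i
  proof -
    have "closed (G i)" unfolding G_def by (intro closed_Collect_le continuous_intros)
    moreover have "bounded (G i)"
    proof -
      obtain B where B: "\<And>x. x \<in> E \<Longrightarrow> norm x \<le> B" using compact_imp_bounded[OF E] unfolding bounded_iff by blast
      have "norm z \<le> B + 1" if "z \<in> G i" for z
      proof -
        obtain x where x: "x \<in> E" "infdist z E = dist z x" using infdist_attains_inf[OF compact_imp_closed[OF E] \<open>E \<noteq> {}\<close>] by blast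
        have "dist z x \<le> 1 / real (Suc i)" using that x by (simp add: G_def)
        also have "\<dots> \<le> 1" by simp
        finally have "norm (z - x) \<le> 1" by (simp only: dist_norm)
        then show ?thesis using norm_triangle_sub[of z x] B[OF x(1)] by linarith
      qed
      then show ?thesis unfolding bounded_iff by blast
    qed
    ultimately show ?thesis by (simp add: compact_eq_bounded_closed)
  qed
  have finG: "emeasure lborel (G i) < \<infinity>" for i
    by (rule emeasure_bounded_finite[OF compact_imp_bounded[OF cpt]])
  have ge: "ennreal c \<le> emeasure lborel (G i)" for i
  proof -
    have "c \<le> measure lborel (G i)"
      unfolding c_def G_def
      by (rule thickening_measure_ge[OF \<mu> borel_closed[OF compact_imp_closed[OF E]] null K _ finG[unfolded G_def] ball]) simp_all
    then show ?thesis using finG[of i] by (simp add: emeasure_eq_ennreal_measure ennreal_leI)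
  qed
  have "(\<lambda>i. emeasure lborel (G i)) \<longlonglongrightarrow> emeasure lborel (\<Inter>i. G i)"
  proof (rule Lim_emeasure_decseq)
    show "range G \<subseteq> sets lborel" using cpt by (auto intro: borel_closed compact_imp_closed)
    show "decseq G"
    proof (rule decseq_SucI)
      fix i
      have "1 / real (Suc (Suc i)) \<le> 1 / real (Suc i)" by (intro divide_left_mono) auto
      then show "G (Suc i) \<subseteq> G i" unfolding G_def by (intro Collect_mono) (meson order_trans)
    qed
    show "emeasure lborel (G i) \<noteq> \<infinity>" for i using finG[of i] by simp
  qed
  then have "ennreal c \<le> emeasure lborel (\<Inter>i. G i)"
    by (rule LIMSEQ_le_const) (use ge in auto)
  also have "(\<Inter>i. G i) = E"
  proof (intro set_eqI iffI)
    fix z assume z: "z \<in> (\<Inter>i. G i)"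
    have "infdist z E \<le> 0"
    proof (rule LIMSEQ_le_const)
      show "(\<lambda>i. 1 / real (Suc i)) \<longlonglongrightarrow> 0" by (rule LIMSEQ_Suc[OF lim_1_over_n])
      show "\<exists>N. \<forall>n\<ge>N. infdist z E \<le> 1 / real (Suc n)" using z by (auto simp: G_def)
    qed
    then have "infdist z E = 0" using infdist_nonneg[of z E] by simp
    then show "z \<in> E" using in_closed_iff_infdist_zero[OF compact_imp_closed[OF E] \<open>E \<noteq> {}\<close>] by simp
  qed (simp add: G_def)
  finally have "0 < emeasure lborel E" using c by (metis ennreal_less_zero_iff order_less_le_trans)
  then show ?thesis using borel_closed[OF compact_imp_closed[OF E]] by (simp add: emeasure_completion)
qed

section \<open>Fourier dimension\<close>

lemma premeasure_pos_below_hausdorff_dim: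
  assumes \<alpha>: "0 \<le> \<alpha>" and lt: "ereal \<alpha> < hausdorff_dim M \<rho> A"
  shows "\<exists>\<delta>>0. hausdorff_premeasure M \<rho> \<alpha> \<delta> A \<noteq> 0"
proof (rule ccontr)
  assume "\<not> ?thesis"
  then have "hausdorff_premeasure M \<rho> \<alpha> \<delta> A = 0" if "\<delta> \<in> {0<..}" for \<delta> using that by auto
  then have "hausdorff_measure M \<rho> \<alpha> A \<le> 0"
    unfolding hausdorff_measure_def by (intro SUP_least) simp
  then have "hausdorff_dim M \<rho> A \<le> ereal \<alpha>"
    unfolding hausdorff_dim_def using \<alpha> by (intro INF_lower) simp
  with lt show False by simp
qed

text \<open>For \<open>0 < s \<le> CARD('n)\<close> and \<open>\<beta> = s / 2\<close> this exhibits \<open>s\<close> as a Fourier decay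
  exponent of \<open>E\<close>. With \<open>\<beta> > CARD('n) / 2\<close> it supplies the square-integrable transform.\<close>

lemma fourier_decay_measure_on_Gamma_set:
  fixes x :: "(real ^ 'n) set \<Rightarrow> nat \<Rightarrow> real ^ 'n" and \<Gamma> :: "(real ^ 'n) set set" and E :: "(real ^ 'n) set"
  assumes k: "1 \<le> k" "k < CARD('n)"
    and x: "\<And>s. s \<in> grassmannian k \<Longrightarrow> orthonormal_basis_of k (x s) s"
    and \<Gamma>: "\<Gamma> \<subseteq> grassmannian k" and E: "compact E" and dk: "dk_Gamma_set x k \<Gamma> E"
    and \<beta>: "0 < \<beta>"
    and dim: "ereal (\<beta> + real k * (real CARD('n) - 1 - real k)) < hausdorff_dim (grassmannian k) grassmannian_dist \<Gamma>"
  obtains \<mu> :: "(real ^ 'n) measure" and C :: real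
  where "prob_space \<mu>" "sets \<mu> = sets borel" "emeasure \<mu> (- E) = 0" "0 < C"
    and "\<And>\<xi>. \<xi> \<noteq> 0 \<Longrightarrow> norm (fourier_transform \<mu> \<xi>) \<le> C * norm \<xi> powr (- \<beta>)"
proof -
  have "0 \<le> \<beta> + real k * (real CARD('n) - 1 - real k)"
    using \<beta> k by (intro add_nonneg_nonneg mult_nonneg_nonneg) auto
  then obtain \<delta> where \<delta>: "0 < \<delta>"
    and pos: "hausdorff_premeasure (grassmannian k) grassmannian_dist (\<beta> + real k * (real CARD('n) - 1 - real k)) \<delta> \<Gamma> \<noteq> 0"
    using premeasure_pos_below_hausdorff_dim[OF _ dim] by blast
  obtain K :: real and Y :: "nat \<Rightarrow> real \<Rightarrow> real ^ 'n"
    where K: "0 < K" and Y: "\<And>i. Y i \<in> borel_measurable unit_space"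
    and YE: "\<And>\<omega> r. \<omega> \<in> {0..<1} \<Longrightarrow> (\<And>i. i \<in> {1..k} \<Longrightarrow> r i \<in> {0..1}) \<Longrightarrow> Y 0 \<omega> + (\<Sum>i = 1..k. r i *\<^sub>R Y i \<omega>) \<in> E"
    and small: "\<And>\<xi> \<eta>. \<xi> \<noteq> 0 \<Longrightarrow> 0 < \<eta> \<Longrightarrow>
      measure unit_space {\<omega>\<in>{0..<1}. \<forall>i\<in>{1..k}. \<bar>\<xi> \<bullet> Y i \<omega>\<bar> \<le> \<eta>} \<le> K * (\<eta> / norm \<xi>) powr \<beta>"
    by (rule random_frame[OF k x \<Gamma> E dk \<beta> \<delta> pos]) blast+
  show ?thesis
    by (rule fourier_decay_of_random_frame[where Y = Y and k = k and E = E and K = K and \<beta> = \<beta>,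
          OF k(1) \<beta> Y compact_imp_closed[OF E] K YE small]) (blast intro: that)+
qed

lemma fourier_dim_le: "fourier_dim (E :: (real ^ 'n) set) \<le> real CARD('n)"
  unfolding fourier_dim_def by (rule cSup_least) (auto simp: fourier_decay_exponents_def)

lemma fourier_dim_ge:
  fixes E :: "(real ^ 'n) set"
  assumes "s \<in> insert 0 (fourier_decay_exponents E)"
  shows "s \<le> fourier_dim E"
  unfolding fourier_dim_def
  by (rule cSup_upper[OF assms]) (auto simp: fourier_decay_exponents_def intro!: bdd_aboveI[of _ "real CARD('n)"])

theorem corollary2p3:
  fixes k :: nat
    and x :: "(real ^ 'n) set \<Rightarrow> nat \<Rightarrow> real ^ 'n"
    and \<Gamma> :: "(real ^ 'n) set set"
    and E :: "(real ^ 'n) set"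
  defines "D \<equiv> 2 * (hausdorff_dim (grassmannian k) grassmannian_dist \<Gamma>
                     - ereal (real k * (real CARD('n) - 1 - real k)))"
  assumes "CARD('n) \<ge> 2"
    and "1 \<le> k" and "k < CARD('n)"
    and "\<And>s. s \<in> grassmannian k \<Longrightarrow> orthonormal_basis_of k (x s) s"
    and "\<Gamma> \<subseteq> grassmannian k"
    and "compact E"
    and "dk_Gamma_set x k \<Gamma> E"
  shows "(D \<le> ereal (real CARD('n)) \<longrightarrow> ereal (fourier_dim E) \<ge> D) \<and>
         (D > ereal (real CARD('n)) \<longrightarrow>
            fourier_dim E = real CARD('n) \<and> emeasure lebesgue E > 0)"
proof -
  define H where "H = hausdorff_dim (grassmannian k) grassmannian_dist \<Gamma>"
  define c where "c = real k * (real CARD('n) - 1 - real k)"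
  have decay: "\<exists>(\<mu> :: (real ^ 'n) measure) C. prob_space \<mu> \<and> sets \<mu> = sets borel \<and> emeasure \<mu> (- E) = 0 \<and> 0 < C \<and>
      (\<forall>\<xi>. \<xi> \<noteq> 0 \<longrightarrow> norm (fourier_transform \<mu> \<xi>) \<le> C * norm \<xi> powr (- \<beta>))"
    if "0 < \<beta>" "ereal (\<beta> + c) < H" for \<beta>
    by (rule fourier_decay_measure_on_Gamma_set[of k x \<Gamma> E \<beta>])
       (use assms that in \<open>simp_all only: H_def c_def\<close>, blast)
  have D_gt: "ereal (s / 2 + c) < H" if "ereal s < D" for s
    using that unfolding D_def H_def[symmetric] c_def[symmetric] by (cases H) auto
  have exponent: "s \<in> fourier_decay_exponents E" if "0 < s" "s \<le> real CARD('n)" "ereal s < D" for s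
  proof -
    have "0 < s / 2" using that by simp
    from decay[OF this D_gt[OF \<open>ereal s < D\<close>]] that show ?thesis
      unfolding fourier_decay_exponents_def minus_divide_left by simp
  qed
  have "D \<le> ereal (fourier_dim E)" if "D \<le> ereal (real CARD('n))"
  proof (rule ccontr)
    assume "\<not> D \<le> ereal (fourier_dim E)"
    then obtain s where s: "ereal (fourier_dim E) < ereal s" "ereal s < D"
      using ereal_dense2[of "ereal (fourier_dim E)" D] by (metis not_le)
    have "0 < s" using s(1) fourier_dim_ge[of 0 E] by simp
    moreover have "s \<le> real CARD('n)" using s(2) that by (metis ereal_less_eq(3) less_imp_le order_trans)
    ultimately have "s \<le> fourier_dim E" using exponent[of s] s(2) by (intro fourier_dim_ge) simp
    with s(1) show False by simp
  qed
  moreover have "fourier_dim E = real CARD('n) \<and> emeasure lebesgue E > 0" if big: "D > ereal (real CARD('n))"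
  proof
    have "real CARD('n) \<in> fourier_decay_exponents E" using big by (intro exponent) auto
    then show "fourier_dim E = real CARD('n)"
      using fourier_dim_le[of E] fourier_dim_ge[of "real CARD('n)" E] by simp
    obtain \<gamma> where \<gamma>: "ereal (real CARD('n) / 2 + c) < ereal \<gamma>" "ereal \<gamma> < H"
      using ereal_dense2[OF D_gt[OF big]] by auto
    define \<beta> where "\<beta> = \<gamma> - c"
    have \<beta>: "real CARD('n) < 2 * \<beta>" using \<gamma>(1) by (simp add: \<beta>_def)
    then have \<beta>0: "0 < \<beta>" by (smt (verit) of_nat_0_le_iff)
    have "ereal (\<beta> + c) < H" using \<gamma>(2) by (simp add: \<beta>_def)
    from decay[OF \<beta>0 this] obtain \<mu> :: "(real ^ 'n) measure" and C
      where \<mu>: "prob_space \<mu>" "sets \<mu> = sets borel" and null: "emeasure \<mu> (- E) = 0"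
      and dec: "\<And>\<xi>. \<xi> \<noteq> 0 \<Longrightarrow> norm (fourier_transform \<mu> \<xi>) \<le> C * norm \<xi> powr (- \<beta>)"
      by blast
    obtain B where B: "0 < B" "(\<integral>\<^sup>+\<xi>. ennreal ((norm (fourier_transform \<mu> \<xi>))\<^sup>2) \<partial>lborel) \<le> ennreal B"
      by (rule square_integrable_of_decay[OF \<mu>(1) \<beta> dec])
    show "emeasure lebesgue E > 0"
    proof (rule positive_measure_of_difference_law_bound[OF \<mu> \<open>compact E\<close> null])
      show "0 < 64 ^ CARD('n) * B" using B by simp
      show "measure (difference_law \<mu>) (cball 0 \<rho>) \<le> 64 ^ CARD('n) * B * \<rho> ^ CARD('n)" if "0 < \<rho>" for \<rho>
        by (rule difference_law_ball_le[OF \<mu> B that])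
    qed
  qed
  ultimately show ?thesis by blast
qed

end
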